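(* Suppose that the $T$-periodic system $\dot x(t)=A(t)x(t)+B(t)u(t)$ with unconstrained controls is controllable, and consider the autonomized system on $\mathbb{S}^1\times\mathbb{R}^d$ with controls $u\in\mathcal{U}$. (i) The reachable set $\mathbf{R}^a(0,0)\subset\mathbb{S}^1\times\mathbb{R}^d$ satisfies $\mathbb{S}^1\times\{0\}\subset\mathrm{int}\,\mathbf{R}^a(0,0)$ and $$X(dT+\cdot,\cdot)\mathcal{K}^-\oplus\mathcal{E}^{+,0}\subset\mathrm{int}\,\mathbf{R}^a(0,0)\subset\mathcal{K}^-\oplus\mathcal{E}^{+,0},$$ where $\mathcal{K}^-=\{(\tau,x): x\in K^-_\tau\}$ and the sets $K^-_\tau:=\mathrm{int}\,\mathbf{R}_{\mathbb{N}T+\tau}(0,0)\cap E^-_\tau$, $\tau\in\mathbb{S}^1=[0,T)$, are convex and uniformly bounded (bounded by a constant independent of $\tau$). (ii) The controllable set $\mathbf{C}^a(0,0)$ satisfies $\mathbb{S}^1\times\{0\}\subset\mathrm{int}\,\mathbf{C}^a(0,0)$ and $$\mathcal{E}^{-,0}\oplus X(-dT+\cdot,\cdot)\mathcal{K}^+\subset\mathrm{int}\,\mathbf{C}^a(0,0)\subset\mathcal{E}^{-,0}\oplus\mathcal{K}^+,$$ where $\mathcal{K}^+=\{(\tau,x): x\in K^+_\tau\}$ and the sets $K^+_\tau:=\mathrm{int}\,\mathbf{C}_{-\mathbb{N}T+\tau}(0,0)\cap E^+_\tau$, $\tau\in\mathbb{S}^1$, are convex and uniformly bounded.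
   Context: Setting. Let $T>0$, let $A\in L^\infty(\mathbb{R},\mathbb{R}^{d\times d})$ and $B\in L^\infty(\mathbb{R},\mathbb{R}^{d\times m})$ be $T$-periodic, let $U\subset\mathbb{R}^m$ be a bounded convex neighborhood of the origin, and $\mathcal{U}=\{u\in L^\infty(\mathbb{R},\mathbb{R}^m): u(t)\in U\text{ for a.a. }t\}$. For the control system $\dot x(t)=A(t)x(t)+B(t)u(t)$ let $\varphi(t;t_0,x_0,u)$, $t\in\mathbb{R}$, be the (Carathéodory) solution with $x(t_0)=x_0$. $X(t,s)$ is the principal fundamental solution of $\dot x=A(t)x$: $\frac{d}{dt}X(t,s)=A(t)X(t,s)$, $X(s,s)=I_d$. $\mathbb{N}=\{0,1,2,\ldots\}$. Reachable and controllable sets: $\mathbf{R}_t(t_0,x)=\{\varphi(t;t_0,x,u): u\in\mathcal{U}\}$ for $t\ge t_0$, and $\mathbf{C}_t(t_0,x)=\{y\in\mathbb{R}^d: \exists u\in\mathcal{U},\ \varphi(t_0;t,y,u)=x\}$ for $t\le t_0$. Further $\mathbf{R}_{\mathbb{N}T+\tau}(t_0,0)=\bigcup_k\mathbf{R}_{kT+\tau}(t_0,0)$, the union over $k\in\mathbb{N}$ with $kT+\tau\ge t_0$, and $\mathbf{C}_{-\mathbb{N}T+\tau}(t_0,0)=\bigcup_k\mathbf{C}_{-kT+\tau}(t_0,0)$, the union over $k\in\mathbb{N}$ with $-kT+\tau\le t_0$. The system with unconstrained controls is called controllable if for any $x_1,x_2\in\mathbb{R}^d$ and $t_0\in\mathbb{R}$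 there are $t_1>t_0$ and $u\in L^\infty([t_0,t_1],\mathbb{R}^m)$ with $\varphi(t_1;t_0,x_1,u)=x_2$. Autonomized system. $\mathbb{S}^1$ is the circle parametrized by $\tau\in[0,T)$ (i.e. $\mathbb{R}/T\mathbb{Z}$). The autonomized system $\dot\tau=1\bmod T$, $\dot x=A(\tau)x+B(\tau)u$ on $\mathbb{S}^1\times\mathbb{R}^d$ has solutions $\varphi^a(t;(\tau_0,x_0),u)=(\tau_0+t\bmod T,\ \varphi(\tau_0+t;\tau_0,x_0,u))$, $u\in\mathcal{U}$. Its reachable and controllable sets are $\mathbf{R}^a(\tau,x)=\{\varphi^a(t;(\tau,x),u): t\ge0,u\in\mathcal{U}\}$ and $\mathbf{C}^a(\tau,x)=\{(\sigma,y): \exists t\ge0,u\in\mathcal{U},\ \varphi^a(t;(\sigma,y),u)=(\tau,x)\}$. Spectral subbundles. For $\tau\in[0,T)$ the Floquet multipliers are the eigenvalues $\mu$ of $X(T+\tau,\tau)$ (independent of $\tau$). Let $E^-_\tau,E^0_\tau,E^+_\tau\subset\mathbb{R}^d$ be the direct sums of the real generalized eigenspaces of $X(T+\tau,\tau)$ for the $\mu$ with $|\mu|<1$, $|\mu|=1$, $|\mu|>1$, respectively, and $E^{-,0}_\tau=E^-_\tau\oplus E^0_\tau$, $E^{+,0}_\tau=E^+_\tau\oplus E^0_\tau$. For each of these families, the corresponding calligraphic letter denotes the subbundle, e.g. $\mathcal{E}^{+,0}=\{(\tau,x)\in\mathbb{S}^1\times\mathbb{R}^d: x\in E^{+,0}_\tau\}$.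 Notation. For sets $\mathcal{K}=\{(\tau,x):x\in K_\tau\}$, $\mathcal{L}=\{(\tau,x):x\in L_\tau\}$ and matrices $Y(\tau)$: $Y(\cdot)\mathcal{K}=\{(\tau,x): x\in Y(\tau)K_\tau\}$ and $\mathcal{K}\oplus\mathcal{L}=\{(\tau,x+y): x\in K_\tau,y\in L_\tau\}$. $X(\pm dT+\cdot,\cdot)$ stands for $Y(\tau)=X(\pm dT+\tau,\tau)$. Interiors in $\mathbf{R}^a,\mathbf{C}^a$ are taken in $\mathbb{S}^1\times\mathbb{R}^d$; interiors of $\mathbf{R}_{\mathbb{N}T+\tau}(0,0)$, $\mathbf{C}_{-\mathbb{N}T+\tau}(0,0)$ in $\mathbb{R}^d$. *)

theory Defs
  imports "HOL-Analysis.Analysis" "HOL-Library.Real_Mod" "HOL-Library.Set_Algebras"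
begin

section \<open>Solutions in the sense of Caratheodory\<close>

text \<open>Elements of an \<open>L\<^sup>\<infinity>\<close> space are represented by functions; hence measurability is with
  respect to the Lebesgue sigma-algebra, and periodicity is only required almost everywhere.\<close>

definition Linf :: "real set \<Rightarrow> (real \<Rightarrow> 'a::real_normed_vector) set" where
  "Linf S = {f. f \<in> borel_measurable (lebesgue_on S) \<and>
                (\<exists>C. AE t in lebesgue_on S. norm (f t) \<le> C)}"

definition ae_periodic :: "real \<Rightarrow> (real \<Rightarrow> 'a) \<Rightarrow> bool" where
  "ae_periodic T f \<longleftrightarrow> (AE t in lebesgue. f (t + T) = f t)"

text \<open>A Caratheodory solution of \<open>x' = f(t, x)\<close>, \<open>x(t\<^sub>0) = x\<^sub>0\<close> on the whole real line satisfies the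
  integral equation with a locally Lebesgue integrable integrand (and is therefore locally
  absolutely continuous). The interval integral is oriented, so that times \<open>t < t\<^sub>0\<close> are covered.\<close>

definition caratheodory_solution ::
    "(real \<Rightarrow> 'a \<Rightarrow> 'a) \<Rightarrow> real \<Rightarrow> 'a \<Rightarrow> (real \<Rightarrow> 'a::euclidean_space) \<Rightarrow> bool" where
  "caratheodory_solution f t0 x0 x \<longleftrightarrow>
     continuous_on UNIV x \<and>
     (\<forall>t. interval_lebesgue_integrable lebesgue (ereal t0) (ereal t) (\<lambda>s. f s (x s)) \<and>
          x t = x0 + (LINT s=ereal t0..ereal t|lebesgue. f s (x s)))"

text \<open>For coefficients and controls in \<open>L\<^sup>\<infinity>\<close> there is exactly one solution, so the
  descriptions below are proper. The arguments of \<open>\<phi>(t; t\<^sub>0, x\<^sub>0, u)\<close> are kept in this order,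
  after the coefficients of the system.\<close>

definition phi ::
    "(real \<Rightarrow> real^'d^'d) \<Rightarrow> (real \<Rightarrow> real^'m^'d) \<Rightarrow>
     real \<Rightarrow> real \<Rightarrow> real^'d \<Rightarrow> (real \<Rightarrow> real^'m) \<Rightarrow> real^'d" where
  "phi A B t t0 x0 u =
     (THE x. caratheodory_solution (\<lambda>s y. A s *v y + B s *v u s) t0 x0 x) t"

definition fundamental_solution :: "(real \<Rightarrow> real^'d^'d) \<Rightarrow> real \<Rightarrow> real \<Rightarrow> real^'d^'d" where
  "fundamental_solution A t s =
     (THE Y. caratheodory_solution (\<lambda>r Z. A r ** Z) s (mat 1) Y) t"

section \<open>Reachable and controllable sets\<close>

definition admissible_controls :: "(real^'m) set \<Rightarrow> (real \<Rightarrow> real^'m) set" where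
  "admissible_controls U = {u \<in> Linf UNIV. AE t in lebesgue. u t \<in> U}"

text \<open>Since \<open>phi\<close> expects controls on the whole line, a control on \<open>[t\<^sub>0, t\<^sub>1]\<close> is extended by \<open>0\<close>;
  the extension does not influence the state at time \<open>t\<^sub>1\<close>.\<close>

definition controllable ::
    "(real \<Rightarrow> real^'d^'d) \<Rightarrow> (real \<Rightarrow> real^'m^'d) \<Rightarrow> bool" where
  "controllable A B \<longleftrightarrow>
     (\<forall>x1 x2 t0. \<exists>t1>t0. \<exists>u\<in>Linf {t0..t1}.
        phi A B t1 t0 x1 (\<lambda>t. if t \<in> {t0..t1} then u t else 0) = x2)"

definition reach_at ::
    "(real \<Rightarrow> real^'d^'d) \<Rightarrow> (real \<Rightarrow> real^'m^'d) \<Rightarrow> (real^'m) set \<Rightarrow>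
     real \<Rightarrow> real \<Rightarrow> real^'d \<Rightarrow> (real^'d) set" where
  "reach_at A B U t t0 x = {phi A B t t0 x u |u. u \<in> admissible_controls U}"

definition control_at ::
    "(real \<Rightarrow> real^'d^'d) \<Rightarrow> (real \<Rightarrow> real^'m^'d) \<Rightarrow> (real^'m) set \<Rightarrow>
     real \<Rightarrow> real \<Rightarrow> real^'d \<Rightarrow> (real^'d) set" where
  "control_at A B U t t0 x = {y. \<exists>u\<in>admissible_controls U. phi A B t0 t y u = x}"

definition reach_NT ::
    "(real \<Rightarrow> real^'d^'d) \<Rightarrow> (real \<Rightarrow> real^'m^'d) \<Rightarrow> (real^'m) set \<Rightarrow>
     real \<Rightarrow> real \<Rightarrow> real \<Rightarrow> real^'d \<Rightarrow> (real^'d) set" where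
  "reach_NT A B U T \<tau> t0 x =
     (\<Union>k\<in>{k::nat. real k * T + \<tau> \<ge> t0}. reach_at A B U (real k * T + \<tau>) t0 x)"

definition control_NT ::
    "(real \<Rightarrow> real^'d^'d) \<Rightarrow> (real \<Rightarrow> real^'m^'d) \<Rightarrow> (real^'m) set \<Rightarrow>
     real \<Rightarrow> real \<Rightarrow> real \<Rightarrow> real^'d \<Rightarrow> (real^'d) set" where
  "control_NT A B U T \<tau> t0 x =
     (\<Union>k\<in>{k::nat. - real k * T + \<tau> \<le> t0}. control_at A B U (- real k * T + \<tau>) t0 x)"

section \<open>The autonomized system\<close>

text \<open>The circle \<open>\<real>/T\<int>\<close> is parametrized by \<open>[0, T)\<close> and carries the quotient topology of
  the projection \<open>t \<mapsto> t rmod T\<close>.\<close>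

definition circle :: "real \<Rightarrow> real topology" where
  "circle T = topology (\<lambda>V. V \<subseteq> {0..<T} \<and> open {t. t rmod T \<in> V})"

lemma openin_circle: "openin (circle T) V \<longleftrightarrow> V \<subseteq> {0..<T} \<and> open {t. t rmod T \<in> V}"
proof -
  have "istopology (\<lambda>V. V \<subseteq> {0..<T} \<and> open {t. t rmod T \<in> V})"
    unfolding istopology_def
  proof (intro conjI allI impI)
    fix V W
    assume V: "V \<subseteq> {0..<T} \<and> open {t. t rmod T \<in> V}" and W: "W \<subseteq> {0..<T} \<and> open {t. t rmod T \<in> W}"
    have "{t. t rmod T \<in> V \<inter> W} = {t. t rmod T \<in> V} \<inter> {t. t rmod T \<in> W}" by blast
    then show "open {t. t rmod T \<in> V \<inter> W}" using V W by auto
    show "V \<inter> W \<subseteq> {0..<T}" using V by blast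
  next
    fix \<K> :: "real set set"
    assume K: "\<forall>V\<in>\<K>. V \<subseteq> {0..<T} \<and> open {t. t rmod T \<in> V}"
    have "{t. t rmod T \<in> \<Union>\<K>} = (\<Union>V\<in>\<K>. {t. t rmod T \<in> V})" by blast
    then show "open {t. t rmod T \<in> \<Union>\<K>}" using K by auto
    show "\<Union>\<K> \<subseteq> {0..<T}" using K by blast
  qed
  then show ?thesis by (simp add: circle_def topology_inverse')
qed

lemma topspace_circle: "T > 0 \<Longrightarrow> topspace (circle T) = {0..<T}"
proof -
  assume T: "T > 0"
  have "{t. t rmod T \<in> {0..<T}} = UNIV"
    using T by (auto simp: rmod_nonneg rmod_less)
  then have "openin (circle T) {0..<T}" by (simp only: openin_circle) simp
  then show ?thesis
    by (meson openin_circle openin_subset openin_topspace subset_antisym)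
qed

abbreviation phase_space :: "real \<Rightarrow> (real \<times> (real^'d)) topology" where
  "phase_space T \<equiv> prod_topology (circle T) euclidean"

definition phi_aut ::
    "(real \<Rightarrow> real^'d^'d) \<Rightarrow> (real \<Rightarrow> real^'m^'d) \<Rightarrow> real \<Rightarrow>
     real \<Rightarrow> real \<times> (real^'d) \<Rightarrow> (real \<Rightarrow> real^'m) \<Rightarrow> real \<times> (real^'d)" where
  "phi_aut A B T t p u =
     ((fst p + t) rmod T, phi A B (fst p + t) (fst p) (snd p) u)"

definition reach_aut ::
    "(real \<Rightarrow> real^'d^'d) \<Rightarrow> (real \<Rightarrow> real^'m^'d) \<Rightarrow> (real^'m) set \<Rightarrow> real \<Rightarrow>
     real \<times> (real^'d) \<Rightarrow> (real \<times> (real^'d)) set" where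
  "reach_aut A B U T p = {phi_aut A B T t p u |t u. t \<ge> 0 \<and> u \<in> admissible_controls U}"

definition control_aut ::
    "(real \<Rightarrow> real^'d^'d) \<Rightarrow> (real \<Rightarrow> real^'m^'d) \<Rightarrow> (real^'m) set \<Rightarrow> real \<Rightarrow>
     real \<times> (real^'d) \<Rightarrow> (real \<times> (real^'d)) set" where
  "control_aut A B U T p =
     {q \<in> {0..<T} \<times> UNIV. \<exists>t\<ge>0. \<exists>u\<in>admissible_controls U. phi_aut A B T t q u = p}"

section \<open>Spectral subbundles\<close>

definition complexify :: "real^'d^'d \<Rightarrow> complex^'d^'d" where
  "complexify M = (\<chi> i j. complex_of_real (M $ i $ j))"

definition is_eigenvalue :: "real^'d^'d \<Rightarrow> complex \<Rightarrow> bool" where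
  "is_eigenvalue M \<mu> \<longleftrightarrow> (\<exists>v. v \<noteq> 0 \<and> complexify M *v v = \<mu> *s v)"

definition gen_eigenspace :: "real^'d^'d \<Rightarrow> complex \<Rightarrow> (complex^'d) set" where
  "gen_eigenspace M \<mu> = {v. \<exists>k. (((*v) (complexify M - mat \<mu>)) ^^ k) v = 0}"

text \<open>The real generalized eigenspace of \<open>\<mu>\<close> is spanned by the real and imaginary parts of the
  complex generalized eigenvectors; it is the same space for \<open>\<mu>\<close> and its conjugate.\<close>

definition real_gen_eigenspace :: "real^'d^'d \<Rightarrow> complex \<Rightarrow> (real^'d) set" where
  "real_gen_eigenspace M \<mu> =
     span ((\<lambda>v. \<chi> i. Re (v $ i)) ` gen_eigenspace M \<mu> \<union> (\<lambda>v. \<chi> i. Im (v $ i)) ` gen_eigenspace M \<mu>)"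

definition spectral_space :: "real^'d^'d \<Rightarrow> complex set \<Rightarrow> (real^'d) set" where
  "spectral_space M S = span (\<Union>\<mu>\<in>{\<mu> \<in> S. is_eigenvalue M \<mu>}. real_gen_eigenspace M \<mu>)"

definition E_minus :: "(real \<Rightarrow> real^'d^'d) \<Rightarrow> real \<Rightarrow> real \<Rightarrow> (real^'d) set" where
  "E_minus A T \<tau> = spectral_space (fundamental_solution A (T + \<tau>) \<tau>) {\<mu>. cmod \<mu> < 1}"

definition E_zero :: "(real \<Rightarrow> real^'d^'d) \<Rightarrow> real \<Rightarrow> real \<Rightarrow> (real^'d) set" where
  "E_zero A T \<tau> = spectral_space (fundamental_solution A (T + \<tau>) \<tau>) {\<mu>. cmod \<mu> = 1}"

definition E_plus :: "(real \<Rightarrow> real^'d^'d) \<Rightarrow> real \<Rightarrow> real \<Rightarrow> (real^'d) set" where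
  "E_plus A T \<tau> = spectral_space (fundamental_solution A (T + \<tau>) \<tau>) {\<mu>. cmod \<mu> > 1}"

text \<open>The sums of subspaces are the elementwise sums \<open>{x + y | x \<in> E, y \<in> F}\<close>.\<close>

definition E_minus_zero :: "(real \<Rightarrow> real^'d^'d) \<Rightarrow> real \<Rightarrow> real \<Rightarrow> (real^'d) set" where
  "E_minus_zero A T \<tau> = E_minus A T \<tau> + E_zero A T \<tau>"

definition E_plus_zero :: "(real \<Rightarrow> real^'d^'d) \<Rightarrow> real \<Rightarrow> real \<Rightarrow> (real^'d) set" where
  "E_plus_zero A T \<tau> = E_plus A T \<tau> + E_zero A T \<tau>"

definition bundle_over :: "real \<Rightarrow> (real \<Rightarrow> 'a set) \<Rightarrow> (real \<times> 'a) set" where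
  "bundle_over T K = (SIGMA \<tau>:{0..<T}. K \<tau>)"

definition fibre_sum ::
    "(real \<times> (real^'d)) set \<Rightarrow> (real \<times> (real^'d)) set \<Rightarrow> (real \<times> (real^'d)) set" (infixl "\<oplus>\<^sub>f" 65) where
  "K \<oplus>\<^sub>f L = {(\<tau>, x + y) |\<tau> x y. (\<tau>, x) \<in> K \<and> (\<tau>, y) \<in> L}"

definition fibre_image ::
    "(real \<Rightarrow> real^'d^'d) \<Rightarrow> (real \<times> (real^'d)) set \<Rightarrow> (real \<times> (real^'d)) set" (infixr "\<cdot>\<^sub>f" 70) where
  "Y \<cdot>\<^sub>f K = {(\<tau>, Y \<tau> *v x) |\<tau> x. (\<tau>, x) \<in> K}"

definition K_minus ::
    "(real \<Rightarrow> real^'d^'d) \<Rightarrow> (real \<Rightarrow> real^'m^'d) \<Rightarrow> (real^'m) set \<Rightarrow> real \<Rightarrow>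
     real \<Rightarrow> (real^'d) set" where
  "K_minus A B U T \<tau> = interior (reach_NT A B U T \<tau> 0 0) \<inter> E_minus A T \<tau>"

definition K_plus ::
    "(real \<Rightarrow> real^'d^'d) \<Rightarrow> (real \<Rightarrow> real^'m^'d) \<Rightarrow> (real^'m) set \<Rightarrow> real \<Rightarrow>
     real \<Rightarrow> (real^'d) set" where
  "K_plus A B U T \<tau> = interior (control_NT A B U T \<tau> 0 0) \<inter> E_plus A T \<tau>"

end

theory Submission
  imports Defs "HOL-Computational_Algebra.Fundamental_Theorem_Algebra"
begin

text \<open>
  Time reversal turns controllable sets into reachable sets, so both halves follow from one argument
  about the sets \<open>R t\<close> of states reachable from \<open>0\<close> in time \<open>t\<close>, whose union over the times congruent to
  \<open>\<tau>\<close> modulo \<open>T\<close> is a convex set \<open>F \<tau>\<close> with \<open>0\<close> in its interior. Concatenating controls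
  gives \<open>M\<^sup>k F 0 + R (k T) \<subseteq> F 0\<close> for the monodromy matrix \<open>M\<close>. If a functional \<open>p\<close> is bounded above on
  \<open>F 0\<close>, then iterating this inclusion with a ball inside \<open>R (k T)\<close> forces \<open>p \<bullet> M\<^sup>j x \<longlonglongrightarrow> 0\<close> for all \<open>x\<close>, hence
  \<open>p\<close> vanishes on the spectral space for \<open>\<bar>\<mu>\<bar> \<ge> 1\<close>; by separation this space is contained in \<open>F 0\<close>. Convexity
  then makes \<open>int (F \<tau>)\<close> invariant under adding its elements, so the part of \<open>F \<tau>\<close> in the stable space
  determines the whole set. That part is bounded, since for \<open>x = \<Sum>j<k. M\<^sup>j g\<^sub>j\<close> in the stable
  space only the stable component of \<open>p\<close> with respect to the transpose of \<open>M\<close> contributes to \<open>p \<bullet> x\<close>, and its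
  iterates are summable. Interiors in fibres and in the phase space are related by the flow
  of the uncontrolled system, which maps \<open>int (F \<sigma>)\<close> into \<open>F t\<close> for all \<open>t > \<sigma>\<close>.
\<close>

section \<open>Primitives of locally integrable functions\<close>

text \<open>Multipliers on the unit circle shape the argument. There the powers of M have no
  exponential rate, so E^0 cannot be reached by expansion. The functional argument avoids rates: for
  |\<mu>| >= 1 the sequence \<mu>^j f(v) tends to 0 only if f(v) = 0. Mere convergence therefore
  suffices, and |\<mu>| = 1 and |\<mu>| > 1 are treated together as \<open>unstable\<close>.
  Openness in the phase space is stronger than openness of a fibre, since it needs room on both
  sides of the time \<tau>. The flow provides this room only from a strictly earlier time. Starting
  in the same fibre some whole periods earlier costs a factor X(nT + \<tau>, \<tau>) on the stable
  part, while the unstable part is mapped onto itself. This is the origin of the gap between the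
  inner and the outer inclusion; \<open>bundle_inclusions\<close> gives it for every n > 0, and the
  theorem takes the dimension for n.\<close>

lemma AE_lebesgueE:
  assumes "AE s in lebesgue. P s"
  obtains N where "negligible N" "\<And>s. s \<notin> N \<Longrightarrow> P s"
  using assms by (auto elim!: AE_E3 simp: negligible_iff_null_sets)

text \<open>\<open>x\<close> is locally absolutely continuous with derivative \<open>f\<close>
  almost everywhere. Unlike \<open>caratheodory_solution\<close>, the condition singles out no
  initial time, so a solution can be restarted anywhere.\<close>

definition abs_primitive :: "(real \<Rightarrow> 'a::euclidean_space) \<Rightarrow> (real \<Rightarrow> 'a) \<Rightarrow> bool" where
  "abs_primitive f x \<longleftrightarrow>
     (\<forall>a b. a \<le> b \<longrightarrow> f absolutely_integrable_on {a..b} \<and> (f has_integral (x b - x a)) {a..b})"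

lemma abs_primitiveD:
  assumes "abs_primitive f x" "a \<le> b"
  shows "f absolutely_integrable_on {a..b}" "(f has_integral (x b - x a)) {a..b}"
  using assms by (auto simp: abs_primitive_def)

lemma abs_primitive_continuous:
  assumes "abs_primitive f x"
  shows "continuous_on UNIV x"
proof -
  have "isCont x t" for t
  proof -
    have eq: "x s = x (t - 1) + integral {t-1..s} f" if "s \<in> {t-1..t+1}" for s
      using abs_primitiveD(2)[OF assms, of "t-1" s] that by (auto simp: has_integral_iff)
    have "f integrable_on {t-1..t+1}"
      using abs_primitiveD(2)[OF assms, of "t-1" "t+1"] by auto
    then have "continuous_on {t-1..t+1} (\<lambda>s. x (t - 1) + integral {t-1..s} f)"
      by (intro continuous_intros indefinite_integral_continuous_1)
    then have "continuous_on {t-1..t+1} x"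
      by (rule continuous_on_eq) (rule eq[symmetric])
    then have "continuous_on {t-1<..<t+1} x"
      by (rule continuous_on_subset) auto
    then show ?thesis
      by (simp add: continuous_on_eq_continuous_at)
  qed
  then show ?thesis
    by (simp add: continuous_at_imp_continuous_on)
qed

lemma abs_primitive_cong_AE:
  assumes "abs_primitive f x" "AE s in lebesgue. f s = g s"
  shows "abs_primitive g x"
proof -
  obtain N where N: "negligible N" "\<And>s. s \<notin> N \<Longrightarrow> f s = g s"
    using assms(2) by (rule AE_lebesgueE) blast
  show ?thesis
    unfolding abs_primitive_def
  proof (intro allI impI conjI)
    fix a b :: real assume "a \<le> b"
    note f = abs_primitiveD[OF assms(1) this]
    show "g absolutely_integrable_on {a..b}"
      by (rule absolutely_integrable_spike[OF f(1) N(1)]) (simp add: N(2))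
    show "(g has_integral (x b - x a)) {a..b}"
      by (rule has_integral_spike[OF N(1) _ f(2)]) (simp add: N(2))
  qed
qed

lemma abs_primitive_linear:
  assumes "abs_primitive f x" "bounded_linear h"
  shows "abs_primitive (\<lambda>s. h (f s)) (\<lambda>s. h (x s))"
  unfolding abs_primitive_def
proof (intro allI impI conjI)
  fix a b :: real assume "a \<le> b"
  note f = abs_primitiveD[OF assms(1) this]
  show "(\<lambda>s. h (f s)) absolutely_integrable_on {a..b}"
    using absolutely_integrable_linear[OF f(1) assms(2)] by (simp add: o_def)
  show "((\<lambda>s. h (f s)) has_integral h (x b) - h (x a)) {a..b}"
    using has_integral_linear[OF f(2) assms(2)]
    by (simp add: o_def linear_diff[OF bounded_linear.linear[OF assms(2)]])
qed

lemma abs_primitive_add: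
  assumes "abs_primitive f x" "abs_primitive g y"
  shows "abs_primitive (\<lambda>s. f s + g s) (\<lambda>s. x s + y s)"
  unfolding abs_primitive_def
proof (intro allI impI conjI)
  fix a b :: real assume "a \<le> b"
  note f = abs_primitiveD[OF assms(1) this] and g = abs_primitiveD[OF assms(2) this]
  show "(\<lambda>s. f s + g s) absolutely_integrable_on {a..b}"
    using f g by (intro set_integral_add(1))
  show "((\<lambda>s. f s + g s) has_integral x b + y b - (x a + y a)) {a..b}"
    using has_integral_add[OF f(2) g(2)] by (simp add: algebra_simps)
qed

lemma abs_primitive_scaleR:
  "abs_primitive f x \<Longrightarrow> abs_primitive (\<lambda>s. c *\<^sub>R f s) (\<lambda>s. c *\<^sub>R x s)"
  by (erule abs_primitive_linear) (rule bounded_linear_scaleR_right)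

lemma abs_primitive_diff:
  assumes "abs_primitive f x" "abs_primitive g y"
  shows "abs_primitive (\<lambda>s. f s - g s) (\<lambda>s. x s - y s)"
  using abs_primitive_add[OF assms(1) abs_primitive_scaleR[OF assms(2), of "-1"]] by simp

lemma abs_primitive_shift:
  assumes "abs_primitive f x"
  shows "abs_primitive (\<lambda>s. f (s + c)) (\<lambda>s. x (s + c))"
  unfolding abs_primitive_def
proof (intro allI impI conjI)
  fix a b :: real assume "a \<le> b"
  then have le: "a + c \<le> b + c" by simp
  have shift: "((\<lambda>s. h (s + c)) has_integral i) {a..b}" if "(h has_integral i) {a+c..b+c}"
    for h :: "real \<Rightarrow> 'c::euclidean_space" and i
  proof -
    have "(\<lambda>s. (1/1) *\<^sub>R s + - ((1/1) *\<^sub>R c)) ` {a+c..b+c} = {a..b}"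
      by (auto simp: image_iff intro: bexI[of _ "_ + c"])
    then show ?thesis
      using has_integral_affinity[of h i "a+c" "b+c" 1 c] that by simp
  qed
  note f = abs_primitiveD[OF assms le]
  show "((\<lambda>s. f (s + c)) has_integral x (b + c) - x (a + c)) {a..b}"
    by (rule shift) (rule f)
  have "(\<lambda>s. norm (f s)) integrable_on {a+c..b+c}"
    using f(1) absolutely_integrable_on_def by blast
  then have "(\<lambda>s. norm (f (s + c))) integrable_on {a..b}"
    using shift[of "\<lambda>s. norm (f s)"] by blast
  moreover have "(\<lambda>s. f (s + c)) integrable_on {a..b}"
    using shift[OF f(2)] by blast
  ultimately show "(\<lambda>s. f (s + c)) absolutely_integrable_on {a..b}"
    by (simp add: absolutely_integrable_on_def)
qed

definition oriented_integral :: "real \<Rightarrow> real \<Rightarrow> (real \<Rightarrow> 'a::euclidean_space) \<Rightarrow> 'a" where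
  "oriented_integral a b f = (if a \<le> b then integral {a..b} f else - integral {b..a} f)"

lemma abs_primitive_oriented_integral:
  assumes f: "\<And>a b. f absolutely_integrable_on {a..b}"
  shows "abs_primitive f (\<lambda>t. x0 + oriented_integral t0 t f)"
  unfolding abs_primitive_def
proof (intro allI impI conjI f)
  fix a b :: real assume ab: "a \<le> b"
  have int: "f integrable_on {a..b}" for a b
    using f[of a b] by (simp add: absolutely_integrable_on_def)
  have split: "integral {a..b} f = integral {a..c} f + integral {c..b} f" if "a \<le> c" "c \<le> b" for a b c
    using Henstock_Kurzweil_Integration.integral_combine[OF that int] by simp
  have "oriented_integral t0 b f - oriented_integral t0 a f = integral {a..b} f"
    using ab split[of a t0 b] split[of t0 a b] split[of a b t0]
    by (auto simp: oriented_integral_def algebra_simps)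
  then show "(f has_integral x0 + oriented_integral t0 b f - (x0 + oriented_integral t0 a f)) {a..b}"
    using int by (simp add: has_integral_iff)
qed

lemma interval_integrable_lebesgue_iff:
  "interval_lebesgue_integrable lebesgue (ereal a) (ereal b) f \<longleftrightarrow>
     f absolutely_integrable_on {min a b..max a b}"
  for f :: "real \<Rightarrow> 'a::euclidean_space"
  by (auto simp: interval_lebesgue_integrable_def absolutely_integrable_on_Icc_iff_Ioo min_def max_def)

lemma interval_integral_lebesgue_eq:
  fixes f :: "real \<Rightarrow> 'a::euclidean_space"
  assumes "f absolutely_integrable_on {min a b..max a b}"
  shows "(LINT s=ereal a..ereal b|lebesgue. f s) = oriented_integral a b f"
proof -
  have "(LINT s:{c<..<d}|lebesgue. f s) = integral {c..d} f" if "f absolutely_integrable_on {c..d}" for c d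
    using that
    by (simp add: set_lebesgue_integral_eq_integral absolutely_integrable_on_Icc_iff_Ioo
        integral_open_interval_real)
  then show ?thesis
    using assms
    by (auto simp: interval_lebesgue_integral_def oriented_integral_def min_def max_def split: if_splits)
qed

text \<open>The definition controls the integrand only on intervals with end point
  \<open>t0\<close>. An arbitrary interval is covered by two of these, glued at
  \<open>t0\<close>.\<close>

lemma caratheodory_solution_iff:
  "caratheodory_solution f t0 x0 x \<longleftrightarrow> x t0 = x0 \<and> abs_primitive (\<lambda>s. f s (x s)) x"
proof
  assume sol: "caratheodory_solution f t0 x0 x"
  define g where "g = (\<lambda>s. f s (x s))"
  have g: "g absolutely_integrable_on {min t0 t..max t0 t}" for t
    using sol unfolding caratheodory_solution_def interval_integrable_lebesgue_iff g_def by blast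
  have "g absolutely_integrable_on {a..b}" for a b
  proof -
    define c d where "c = min t0 a" and "d = max t0 b"
    have cd: "c \<le> t0" "t0 \<le> d" "{a..b} \<subseteq> {c..d}"
      by (auto simp: c_def d_def)
    have "min t0 c = c" "max t0 c = t0" "min t0 d = t0" "max t0 d = d"
      using cd(1,2) by auto
    then have "g absolutely_integrable_on {c..t0}" "g absolutely_integrable_on {t0..d}"
      using g[of c] g[of d] by metis+
    then have "g absolutely_integrable_on {c..d}"
      by (rule absolutely_integrable_on_combine) (rule cd)+
    then show ?thesis
      by (rule absolutely_integrable_on_subinterval) (rule cd)
  qed
  then have prim: "abs_primitive g (\<lambda>t. x0 + oriented_integral t0 t g)"
    by (rule abs_primitive_oriented_integral)
  have x: "x t = x0 + oriented_integral t0 t g" for t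
    using sol interval_integral_lebesgue_eq[OF g] unfolding caratheodory_solution_def g_def by metis
  have "abs_primitive g x"
    using prim unfolding x[symmetric] .
  moreover have "x t0 = x0"
    unfolding x[of t0] by (simp add: oriented_integral_def)
  ultimately show "x t0 = x0 \<and> abs_primitive (\<lambda>s. f s (x s)) x" by (simp add: g_def)
next
  define g where "g = (\<lambda>s. f s (x s))"
  assume *: "x t0 = x0 \<and> abs_primitive (\<lambda>s. f s (x s)) x"
  then have prim: "abs_primitive g x" by (simp add: g_def)
  then have g: "g absolutely_integrable_on {min t0 t..max t0 t}" for t
    by (auto intro!: abs_primitiveD(1))
  have "x t = x0 + oriented_integral t0 t g" for t
    using abs_primitiveD(2)[OF prim, of t0 t] abs_primitiveD(2)[OF prim, of t t0] *
    by (cases "t0 \<le> t") (auto simp: oriented_integral_def has_integral_iff)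
  then show "caratheodory_solution f t0 x0 x"
    using abs_primitive_continuous[OF prim] g interval_integral_lebesgue_eq[OF g]
    unfolding caratheodory_solution_def interval_integrable_lebesgue_iff g_def by metis
qed

lemma abs_primitive_bound:
  assumes x: "abs_primitive f x" and "a \<le> b"
    and le: "AE s in lebesgue. s \<in> {a..b} \<longrightarrow> norm (f s) \<le> h s"
    and H: "\<And>s. s \<in> {a..b} \<Longrightarrow> (H has_real_derivative h s) (at s within {a..b})"
  shows "norm (x b - x a) \<le> H b - H a"
proof -
  obtain N where N: "negligible N" "\<And>s. s \<notin> N \<Longrightarrow> s \<in> {a..b} \<longrightarrow> norm (f s) \<le> h s"
    using le by (rule AE_lebesgueE) blast
  have "(h has_integral (H b - H a)) {a..b}"
    using H \<open>a \<le> b\<close>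
    by (intro fundamental_theorem_of_calculus) (auto simp: has_real_derivative_iff_has_vector_derivative)
  \<comment> \<open>The comparison of integrals below wants the bound at every point, hence both
    integrands are set to 0 on the exceptional null set.\<close>
  then have h: "((\<lambda>s. if s \<in> N then 0 else h s) has_integral (H b - H a)) {a..b}"
    by (rule has_integral_spike[OF N(1), rotated]) auto
  have f: "((\<lambda>s. if s \<in> N then 0 else f s) has_integral (x b - x a)) {a..b}"
    using abs_primitiveD(2)[OF x \<open>a \<le> b\<close>] by (rule has_integral_spike[OF N(1), rotated]) auto
  have "norm (integral {a..b} (\<lambda>s. if s \<in> N then 0 else f s)) \<le> integral {a..b} (\<lambda>s. if s \<in> N then 0 else h s)"
    using f h N(2) by (intro integral_norm_bound_integral) (auto intro: has_integral_integrable)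
  then show ?thesis
    unfolding integral_unique[OF f] integral_unique[OF h] .
qed

section \<open>Linear differential equations\<close>

text \<open>Integrating the weight exp(l|s - c|) gains the factor 1/l. With l = 2C this turns a
  Lipschitz constant C into 1/2, both in the Gronwall estimate and in the contraction argument for
  existence.\<close>

lemma abs_primitive_exp_bound:
  assumes x: "abs_primitive f x" and "l > 0" "K \<ge> 0"
    and le: "AE s in lebesgue. s \<in> closed_segment c t \<longrightarrow> norm (f s) \<le> K * exp (l * \<bar>s - c\<bar>)"
  shows "norm (x t - x c) \<le> K / l * exp (l * \<bar>t - c\<bar>)"
proof (cases "c \<le> t")
  case True
  have "norm (x t - x c) \<le> K / l * exp (l * (t - c)) - K / l * exp (l * (c - c))"
  proof (rule abs_primitive_bound[OF x True])
    show "AE s in lebesgue. s \<in> {c..t} \<longrightarrow> norm (f s) \<le> K * exp (l * (s - c))"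
      using le by eventually_elim (use True in \<open>auto simp: closed_segment_eq_real_ivl\<close>)
    show "((\<lambda>s. K / l * exp (l * (s - c))) has_real_derivative K * exp (l * (s - c))) (at s within {c..t})"
      if "s \<in> {c..t}" for s
      using \<open>l > 0\<close> by (auto intro!: derivative_eq_intros)
  qed
  moreover have "K / l \<ge> 0"
    using assms by simp
  ultimately show ?thesis
    using True by simp
next
  case False
  then have "t \<le> c" by simp
  have "norm (x c - x t) \<le> - (K / l) * exp (l * (c - c)) - - (K / l) * exp (l * (c - t))"
  proof (rule abs_primitive_bound[OF x \<open>t \<le> c\<close>])
    show "AE s in lebesgue. s \<in> {t..c} \<longrightarrow> norm (f s) \<le> K * exp (l * (c - s))"
      using le by eventually_elim (use False in \<open>auto simp: closed_segment_eq_real_ivl\<close>)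
    show "((\<lambda>s. - (K / l) * exp (l * (c - s))) has_real_derivative K * exp (l * (c - s))) (at s within {t..c})"
      if "s \<in> {t..c}" for s
      using \<open>l > 0\<close> by (auto intro!: derivative_eq_intros)
  qed
  moreover have "K / l \<ge> 0"
    using assms by simp
  ultimately show ?thesis
    using False by (simp add: norm_minus_commute)
qed

text \<open>Let m be the maximum of exp(-2C|s - c|) |x s| on the segment. The previous bound at the
  maximum point gives m <= |x c| + m/2 + G/(2C), and m/2 is absorbed on the left.\<close>

lemma gronwall:
  assumes x: "abs_primitive f x" and "C > 0" "G \<ge> 0"
    and le: "AE s in lebesgue. s \<in> closed_segment c t \<longrightarrow> norm (f s) \<le> C * norm (x s) + G"
  shows "norm (x t) \<le> (2 * norm (x c) + G / C) * exp (2 * C * \<bar>t - c\<bar>)"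
proof -
  let ?w = "\<lambda>s. exp (- (2 * C * \<bar>s - c\<bar>)) * norm (x s)"
  have "continuous_on UNIV ?w"
    by (intro continuous_intros abs_primitive_continuous[OF x])
  then have "continuous_on (closed_segment c t) ?w"
    by (rule continuous_on_subset) simp
  then obtain r where r: "r \<in> closed_segment c t" "\<And>s. s \<in> closed_segment c t \<Longrightarrow> ?w s \<le> ?w r"
    using continuous_attains_sup[of "closed_segment c t" ?w] compact_segment[of c t] by blast
  define m where "m = ?w r"
  have m: "norm (x s) \<le> m * exp (2 * C * \<bar>s - c\<bar>)" if "s \<in> closed_segment c t" for s
    using r(2)[OF that] by (simp add: m_def exp_minus field_simps)
  have "m \<ge> 0" by (simp add: m_def)
  let ?E = "exp (2 * C * \<bar>r - c\<bar>)"
  have "norm (x r - x c) \<le> (C * m + G) / (2 * C) * ?E"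
  proof (rule abs_primitive_exp_bound[OF x])
    show "2 * C > 0" "C * m + G \<ge> 0"
      using assms \<open>m \<ge> 0\<close> by auto
    have sub: "closed_segment c r \<subseteq> closed_segment c t"
      using r(1) by (simp add: subset_closed_segment)
    show "AE s in lebesgue. s \<in> closed_segment c r \<longrightarrow> norm (f s) \<le> (C * m + G) * exp (2 * C * \<bar>s - c\<bar>)"
      using le
    proof eventually_elim
      case (elim s)
      show ?case
      proof
        assume "s \<in> closed_segment c r"
        with sub have s: "s \<in> closed_segment c t" by auto
        have "norm (f s) \<le> C * norm (x s) + G"
          using elim s by simp
        also have "\<dots> \<le> C * (m * exp (2 * C * \<bar>s - c\<bar>)) + G * exp (2 * C * \<bar>s - c\<bar>)"
          using m[OF s] assms by (intro add_mono mult_left_mono) (auto simp: mult_le_cancel_left1)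
        finally show "norm (f s) \<le> (C * m + G) * exp (2 * C * \<bar>s - c\<bar>)"
          by (simp add: algebra_simps)
      qed
    qed
  qed
  also have "\<dots> = (m / 2 + G / (2 * C)) * ?E"
    using assms by (simp add: field_simps)
  finally have "norm (x r) \<le> norm (x c) + (m / 2 + G / (2 * C)) * ?E"
    by (smt (verit) norm_triangle_sub)
  moreover have "norm (x r) = m * ?E"
    by (simp add: m_def flip: exp_add)
  moreover have "norm (x c) \<le> norm (x c) * ?E"
    using assms by (simp add: mult_le_cancel_left1)
  ultimately have "m * ?E \<le> (norm (x c) + m / 2 + G / (2 * C)) * ?E"
    by (simp add: algebra_simps)
  then have "m \<le> norm (x c) + m / 2 + G / (2 * C)"
    by (rule mult_right_le_imp_le) simp
  then have "m \<le> 2 * norm (x c) + G / C"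
    by simp
  then show ?thesis
    using m[of t] by (smt (verit) ends_in_segment(2) exp_ge_zero mult_right_mono)
qed

section \<open>Essentially bounded coefficients; uniqueness and existence of solutions\<close>

lemma Linf_UNIV_iff:
  "f \<in> Linf UNIV \<longleftrightarrow> f \<in> borel_measurable lebesgue \<and> (\<exists>C. AE t in lebesgue. norm (f t) \<le> C)"
  by (simp only: Linf_def lebesgue_on_UNIV_eq mem_Collect_eq)

lemma Linf_bound:
  assumes "f \<in> Linf UNIV"
  obtains C where "C > 0" "AE t in lebesgue. norm (f t) \<le> C"
proof -
  obtain C where "AE t in lebesgue. norm (f t) \<le> C"
    using assms by (auto simp: Linf_UNIV_iff)
  then have "AE t in lebesgue. norm (f t) \<le> max 1 C"
    by eventually_elim auto
  then show ?thesis
    by (rule that[rotated]) auto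
qed

lemma absolutely_integrable_AE_bound:
  fixes f :: "real \<Rightarrow> 'a::euclidean_space"
  assumes "f \<in> borel_measurable lebesgue" "AE s in lebesgue. norm (f s) \<le> h s"
    and h: "continuous_on UNIV h"
  shows "f absolutely_integrable_on {a..b}"
proof -
  have "h absolutely_integrable_on {a..b}"
    using h by (intro absolutely_integrable_continuous_real) (auto intro: continuous_on_subset)
  then have "integrable lebesgue (\<lambda>s. indicator {a..b} s *\<^sub>R h s)"
    by (simp add: set_integrable_def)
  moreover have "(\<lambda>s. indicator {a..b} s *\<^sub>R f s) \<in> borel_measurable lebesgue"
    using assms(1) by (intro borel_measurable_scaleR borel_measurable_indicator) auto
  moreover have "AE s in lebesgue. norm (indicator {a..b} s *\<^sub>R f s) \<le> norm (indicator {a..b} s *\<^sub>R h s)"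
    using assms(2) by eventually_elim (auto simp: indicator_def)
  ultimately show ?thesis
    unfolding set_integrable_def by (rule Bochner_Integration.integrable_bound)
qed

text \<open>\<open>prod\<close> will be matrix times vector for the trajectories and matrix times
  matrix for the fundamental solution, so both equations share one existence proof.\<close>

locale linf_bilinear = bounded_bilinear prod
  for prod :: "'b::euclidean_space \<Rightarrow> 'a::euclidean_space \<Rightarrow> 'a" (infixl \<open>\<odot>\<close> 70) +
  fixes A :: "real \<Rightarrow> 'b"
  assumes A: "A \<in> Linf UNIV"
begin

lemma coefficient_bound:
  obtains C where "C > 0" "AE s in lebesgue. \<forall>y. norm (A s \<odot> y) \<le> C * norm y"
proof -
  obtain C where C: "C > 0" "AE t in lebesgue. norm (A t) \<le> C"
    using A by (rule Linf_bound)
  obtain K where K: "K > 0" "\<And>a b. norm (a \<odot> b) \<le> norm a * norm b * K"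
    using pos_bounded by blast
  have "AE s in lebesgue. \<forall>y. norm (A s \<odot> y) \<le> (C * K) * norm y"
    using C(2)
  proof eventually_elim
    case (elim s)
    show ?case
    proof
      fix y
      have "norm (A s \<odot> y) \<le> norm (A s) * norm y * K" by (rule K)
      also have "\<dots> \<le> C * norm y * K"
        using elim K(1) by (intro mult_right_mono) auto
      finally show "norm (A s \<odot> y) \<le> (C * K) * norm y" by (simp add: algebra_simps)
    qed
  qed
  with C(1) K(1) show ?thesis
    by (intro that[of "C * K"]) auto
qed

lemma measurable_prod:
  assumes "continuous_on UNIV x"
  shows "(\<lambda>s. A s \<odot> x s) \<in> borel_measurable lebesgue"
proof (rule borel_measurable_continuous_Pair[where H="\<lambda>a b. a \<odot> b"])
  show "A \<in> borel_measurable lebesgue"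
    using A by (simp add: Linf_UNIV_iff)
  show "x \<in> borel_measurable lebesgue"
    using assms by (intro measurable_completion) (simp add: borel_measurable_continuous_onI)
  show "continuous_on UNIV (\<lambda>x. fst x \<odot> snd x)"
    by (intro continuous_on continuous_intros)
qed

text \<open>The inhomogeneities are compared only between \<open>c\<close> and \<open>t\<close>;
  this makes the state independent of the control outside that segment.\<close>

lemma solution_local_unique:
  assumes x: "abs_primitive (\<lambda>s. A s \<odot> x s + g s) x" and y: "abs_primitive (\<lambda>s. A s \<odot> y s + h s) y"
    and eq: "AE s in lebesgue. s \<in> closed_segment c t \<longrightarrow> g s = h s" and "x c = y c"
  shows "x t = y t"
proof -
  obtain C where C: "C > 0" "AE s in lebesgue. \<forall>y. norm (A s \<odot> y) \<le> C * norm y"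
    by (rule coefficient_bound)
  have "norm (x t - y t) \<le> (2 * norm (x c - y c) + 0 / C) * exp (2 * C * \<bar>t - c\<bar>)"
  proof (rule gronwall[OF abs_primitive_diff[OF x y] C(1)])
    show "AE s in lebesgue. s \<in> closed_segment c t \<longrightarrow>
        norm (A s \<odot> x s + g s - (A s \<odot> y s + h s)) \<le> C * norm (x s - y s) + 0"
      using C(2) eq by eventually_elim (auto simp flip: diff_right)
  qed simp
  with \<open>x c = y c\<close> show ?thesis by simp
qed

text \<open>Picard iteration on the whole line at once. The solution is sought in the form w y with
  y bounded and continuous and w = exp(2C|s - t0|), so that the integral operator contracts by 1/2
  in the supremum norm of y.\<close>

lemma solution_exists:
  assumes g: "g \<in> Linf UNIV"
  shows "\<exists>x. x t0 = x0 \<and> abs_primitive (\<lambda>s. A s \<odot> x s + g s) x"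
proof -
  obtain C where C: "C > 0" "AE s in lebesgue. \<forall>y. norm (A s \<odot> y) \<le> C * norm y"
    by (rule coefficient_bound)
  obtain G where G: "G > 0" "AE s in lebesgue. norm (g s) \<le> G"
    using g by (rule Linf_bound)
  define w where "w = (\<lambda>s. exp (2 * C * \<bar>s - t0\<bar>))"
  have w: "w s \<ge> 1" "exp (- (2 * C * \<bar>s - t0\<bar>)) * w s = 1" for s
    using C by (auto simp: w_def simp flip: exp_add)
  have w0: "w s > 0" for s using w(1)[of s] by linarith
  have contw: "continuous_on UNIV w"
    unfolding w_def by (intro continuous_intros)
  define F where "F = (\<lambda>(y :: real \<Rightarrow>\<^sub>C 'a) s. A s \<odot> (w s *\<^sub>R y s) + g s)"
  define P where "P = (\<lambda>y t. x0 + oriented_integral t0 t (F y))"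
  define \<Phi> where "\<Phi> = (\<lambda>y. Bcontfun (\<lambda>t. inverse (w t) *\<^sub>R P y t))"
  have ynorm: "norm (apply_bcontfun y s) \<le> norm y" for y :: "real \<Rightarrow>\<^sub>C 'a" and s
    by (rule norm_bounded)
  have Fb: "AE s in lebesgue. norm (F y s) \<le> (C * norm y + G) * w s" for y
    using C(2) G(2)
  proof eventually_elim
    case (elim s)
    have "norm (F y s) \<le> norm (A s \<odot> (w s *\<^sub>R y s)) + norm (g s)"
      unfolding F_def by (rule norm_triangle_ineq)
    also have "\<dots> \<le> C * norm (w s *\<^sub>R y s) + G"
      using elim by (blast intro: add_mono)
    also have "\<dots> \<le> C * (w s * norm y) + G * w s"
      using ynorm[of y s] w(1)[of s] C(1) G(1)
      by (intro add_mono mult_left_mono) (auto simp: mult_le_cancel_left1)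
    finally show ?case by (simp add: algebra_simps)
  qed
  have P: "abs_primitive (F y) (P y)" "P y t0 = x0" for y
  proof -
    have "(\<lambda>s. A s \<odot> (w s *\<^sub>R y s)) \<in> borel_measurable lebesgue"
      by (intro measurable_prod continuous_intros contw continuous_on_apply_bcontfun)
    then have "F y \<in> borel_measurable lebesgue"
      using g unfolding F_def Linf_UNIV_iff by (intro borel_measurable_add) auto
    then have "F y absolutely_integrable_on {a..b}" for a b
      using Fb[of y] by (rule absolutely_integrable_AE_bound) (intro continuous_intros contw)
    then show "abs_primitive (F y) (P y)"
      unfolding P_def by (rule abs_primitive_oriented_integral)
    show "P y t0 = x0"
      by (simp add: P_def oriented_integral_def)
  qed
  have Pb: "norm (P y t - x0) \<le> (C * norm y + G) / (2 * C) * w t" for y t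
  proof -
    have "norm (P y t - P y t0) \<le> (C * norm y + G) / (2 * C) * exp (2 * C * \<bar>t - t0\<bar>)"
    proof (rule abs_primitive_exp_bound[OF P(1)])
      show "AE s in lebesgue. s \<in> closed_segment t0 t \<longrightarrow> norm (F y s) \<le> (C * norm y + G) * exp (2 * C * \<bar>s - t0\<bar>)"
        using Fb[of y] unfolding w_def by eventually_elim simp
    qed (use C G in auto)
    then show ?thesis by (simp add: P(2) w_def)
  qed
  have \<Phi>: "apply_bcontfun (\<Phi> y) t = inverse (w t) *\<^sub>R P y t" for y t
  proof -
    have "(\<lambda>t. inverse (w t) *\<^sub>R P y t) \<in> bcontfun"
    proof (rule bcontfun_normI)
      show "continuous_on UNIV (\<lambda>t. inverse (w t) *\<^sub>R P y t)"
        using w0 by (intro continuous_intros contw abs_primitive_continuous[OF P(1)]) (auto simp: less_imp_neq[symmetric])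
      show "norm (inverse (w t) *\<^sub>R P y t) \<le> norm x0 + (C * norm y + G) / (2 * C)" for t
      proof -
        have "norm (P y t) \<le> norm x0 + norm (P y t - x0)"
          by (rule norm_triangle_sub)
        also have "\<dots> \<le> norm x0 * w t + (C * norm y + G) / (2 * C) * w t"
          using Pb[of y t] w(1)[of t] by (intro add_mono) (auto simp: mult_le_cancel_left1)
        finally show ?thesis
          using w0[of t] by (simp add: field_simps)
      qed
    qed
    then show ?thesis
      by (simp add: \<Phi>_def Bcontfun_inverse)
  qed
  have contr: "dist (\<Phi> y) (\<Phi> z) \<le> 1/2 * dist y z" for y z
  proof (rule dist_bound)
    fix t
    have "norm ((P y t - P z t) - (P y t0 - P z t0)) \<le> (C * norm (y - z)) / (2 * C) * exp (2 * C * \<bar>t - t0\<bar>)"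
    proof (rule abs_primitive_exp_bound[OF abs_primitive_diff[OF P(1) P(1)]])
      show "AE s in lebesgue. s \<in> closed_segment t0 t \<longrightarrow>
          norm (F y s - F z s) \<le> C * norm (y - z) * exp (2 * C * \<bar>s - t0\<bar>)"
        using C(2)
      proof eventually_elim
        case (elim s)
        have "norm (F y s - F z s) = norm (A s \<odot> (w s *\<^sub>R (y - z) s))"
          by (simp add: F_def diff_right[symmetric] scaleR_diff_right[symmetric] minus_bcontfun.rep_eq)
        also have "\<dots> \<le> C * norm (w s *\<^sub>R (y - z) s)"
          using elim by blast
        also have "\<dots> \<le> C * (w s * norm (y - z))"
          using ynorm[of "y - z" s] w0[of s] C(1) by (intro mult_left_mono) auto
        finally show ?case by (simp add: w_def algebra_simps)
      qed
    qed (use C in auto)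
    then have "norm (P y t - P z t) \<le> norm (y - z) / 2 * w t"
      using C(1) by (simp add: P(2) w_def)
    then show "dist (\<Phi> y t) (\<Phi> z t) \<le> 1/2 * dist y z"
      using w0[of t]
      by (simp add: \<Phi> dist_norm divide_inverse_commute[symmetric] pos_divide_le_eq flip: scaleR_diff_right)
  qed
  have "\<exists>!y. \<Phi> y = y"
    by (rule banach_fix_type[of "1/2"]) (use contr in auto)
  then obtain y where "\<Phi> y = y" by blast
  then have "w t *\<^sub>R y t = P y t" for t
    using \<Phi>[of y t] w0[of t] by simp
  then have "F y = (\<lambda>s. A s \<odot> P y s + g s)"
    by (simp add: F_def)
  then show ?thesis
    using P[of y] by auto
qed

end

section \<open>Generalized eigenspaces\<close>

lemma funpow_add_eq_zero:
  fixes L :: "'a::zero \<Rightarrow> 'a"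
  assumes "(L ^^ k) v = 0" "L 0 = 0"
  shows "(L ^^ (j + k)) v = 0"
proof -
  have "(L ^^ j) 0 = 0" for j
    using assms(2) by (induction j) auto
  then show ?thesis
    using assms(1) by (simp add: funpow_add)
qed

lemma shifted_matrix_mult: "(C - mat \<mu>) *v v = C *v v - \<mu> *s v" for C :: "complex^'d^'d"
proof -
  have "mat \<mu> *v v = \<mu> *s v"
    by (simp add: vec_eq_iff matrix_vector_mult_def mat_def if_distrib[of "\<lambda>x. x * _"] sum.delta cong: if_cong)
  then show ?thesis
    by (simp add: matrix_vector_mult_diff_rdistrib)
qed

lemma shifted_matrix_scale: "C *v (c *s v) - \<mu> *s (c *s v) = c *s (C *v v - \<mu> *s v)"
  for C :: "complex^'d^'d"
  by (simp add: vector_scalar_commute vec.scale_right_diff_distrib vector_smult_assoc mult.commute)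

lemma complexify_matrix_mult: "complexify (M ** N) = complexify M ** complexify N"
  by (simp add: complexify_def matrix_matrix_mult_def vec_eq_iff)

lemma complexify_one: "complexify (mat 1) = mat 1"
  by (simp add: complexify_def mat_def vec_eq_iff)

definition Re_vec :: "complex^'d \<Rightarrow> real^'d" where "Re_vec v = (\<chi> i. Re (v $ i))"

lemma Re_vec_complexify: "Re_vec (complexify M *v v) = M *v Re_vec v"
  by (simp add: Re_vec_def complexify_def matrix_vector_mult_def vec_eq_iff)

lemma Re_vec_funpow_complexify: "Re_vec (((*v) (complexify M) ^^ j) v) = ((*v) M ^^ j) (Re_vec v)"
  by (induction j) (auto simp: Re_vec_complexify)

lemma linear_Re_vec: "linear Re_vec"
  by (auto simp: Re_vec_def vec_eq_iff intro: linearI)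

lemma norm_Re_vec_le: "norm (Re_vec v) \<le> norm v"
  unfolding norm_vec_def by (rule L2_set_mono) (auto simp: Re_vec_def abs_Re_le_cmod)

lemma gen_eigenspaceI: "((*v) (complexify M - mat \<mu>) ^^ k) v = 0 \<Longrightarrow> v \<in> gen_eigenspace M \<mu>"
  by (auto simp: gen_eigenspace_def)

text \<open>Induction on the height of v, the number of applications of M - \<mu> that annihilate
  it.\<close>

lemma gen_eigenspace_induct [consumes 1, case_names zero step]:
  assumes "v \<in> gen_eigenspace M \<mu>" and "P 0"
    and step: "\<And>v. v \<in> gen_eigenspace M \<mu> \<Longrightarrow> complexify M *v v - \<mu> *s v \<in> gen_eigenspace M \<mu> \<Longrightarrow>
      P (complexify M *v v - \<mu> *s v) \<Longrightarrow> P v"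
  shows "P v"
proof -
  obtain k where "((*v) (complexify M - mat \<mu>) ^^ k) v = 0"
    using assms(1) by (auto simp: gen_eigenspace_def)
  then show ?thesis
  proof (induction k arbitrary: v)
    case 0
    then show ?case using \<open>P 0\<close> by simp
  next
    case (Suc k)
    then have *: "((*v) (complexify M - mat \<mu>) ^^ k) (complexify M *v v - \<mu> *s v) = 0"
      by (metis comp_apply funpow_Suc_right shifted_matrix_mult)
    show ?case
      by (rule step[OF gen_eigenspaceI[OF Suc.prems] gen_eigenspaceI[OF *] Suc.IH[OF *]])
  qed
qed

lemma gen_eigenspace_shift:
  assumes "complexify M *v v - \<mu> *s v \<in> gen_eigenspace M \<mu>"
  shows "v \<in> gen_eigenspace M \<mu>"
proof -
  obtain k where "((*v) (complexify M - mat \<mu>) ^^ k) (complexify M *v v - \<mu> *s v) = 0"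
    using assms by (auto simp: gen_eigenspace_def)
  then have "((*v) (complexify M - mat \<mu>) ^^ Suc k) v = 0"
    by (simp add: funpow_Suc_right shifted_matrix_mult del: funpow.simps(2))
  then show ?thesis by (rule gen_eigenspaceI)
qed

lemma gen_eigenspace_zero [simp]: "0 \<in> gen_eigenspace M \<mu>"
  by (rule gen_eigenspaceI[where k=0]) simp

lemma gen_eigenspace_add:
  assumes "v \<in> gen_eigenspace M \<mu>" "w \<in> gen_eigenspace M \<mu>"
  shows "v + w \<in> gen_eigenspace M \<mu>"
proof -
  let ?L = "(*v) (complexify M - mat \<mu>)"
  obtain j k where jk: "(?L ^^ j) v = 0" "(?L ^^ k) w = 0"
    using assms by (auto simp: gen_eigenspace_def)
  have "(?L ^^ (k + j)) v = 0" "(?L ^^ (j + k)) w = 0"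
    using jk by (auto intro!: funpow_add_eq_zero simp: matrix_vector_mult_0_right)
  moreover have "(?L ^^ n) (v + w) = (?L ^^ n) v + (?L ^^ n) w" for n
    by (induction n) (auto simp: matrix_vector_right_distrib)
  ultimately show ?thesis
    by (intro gen_eigenspaceI[where k="j + k"]) (simp add: add.commute)
qed

lemma gen_eigenspace_scale:
  assumes "v \<in> gen_eigenspace M \<mu>"
  shows "c *s v \<in> gen_eigenspace M \<mu>"
proof -
  let ?L = "(*v) (complexify M - mat \<mu>)"
  have "(?L ^^ n) (c *s v) = c *s (?L ^^ n) v" for n
    by (induction n) (auto simp: vector_scalar_commute)
  then show ?thesis
    using assms by (auto simp: gen_eigenspace_def)
qed

lemma gen_eigenspace_diff:
  assumes "v \<in> gen_eigenspace M \<mu>" "w \<in> gen_eigenspace M \<mu>"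
  shows "v - w \<in> gen_eigenspace M \<mu>"
  using gen_eigenspace_add[OF assms(1) gen_eigenspace_scale[OF assms(2), of "-1"]] by simp

lemma gen_eigenspace_intertwine:
  assumes P: "N ** P = P ** M" and v: "v \<in> gen_eigenspace M \<mu>"
  shows "complexify P *v v \<in> gen_eigenspace N \<mu>"
  using v
proof (induction rule: gen_eigenspace_induct)
  case zero
  then show ?case by simp
next
  case (step v)
  have "complexify N *v (complexify P *v v) = complexify P *v (complexify M *v v)"
    using arg_cong[OF P, of complexify] by (simp add: complexify_matrix_mult matrix_vector_mul_assoc)
  then have "complexify N *v (complexify P *v v) - \<mu> *s (complexify P *v v) =
      complexify P *v (complexify M *v v - \<mu> *s v)"
    by (simp add: matrix_vector_mult_diff_distrib vector_scalar_commute)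
  then show ?case
    using step by (metis gen_eigenspace_shift)
qed

lemma gen_eigenspace_eigenvalue:
  assumes "v \<in> gen_eigenspace M \<mu>" "v \<noteq> 0"
  shows "is_eigenvalue M \<mu>"
proof -
  have "v = 0 \<or> is_eigenvalue M \<mu>"
    using assms(1)
  proof (induction rule: gen_eigenspace_induct)
    case (step v)
    then show ?case
      by (auto simp: is_eigenvalue_def)
  qed simp
  with assms(2) show ?thesis by simp
qed

text \<open>Im v is Re (-i v) and the complex space is closed under scaling, so real parts suffice.
  Moreover \<mu> may range over all of S, because a generalized eigenspace is nonzero only at an
  eigenvalue.\<close>

lemma spectral_space_eq:
  "spectral_space M S = span (\<Union>\<mu>\<in>S. Re_vec ` gen_eigenspace M \<mu>)" (is "_ = span ?R")
proof
  have "real_gen_eigenspace M \<mu> \<subseteq> span ?R" if "\<mu> \<in> S" for \<mu>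
    unfolding real_gen_eigenspace_def
  proof (rule span_minimal)
    have "(\<chi> i. Im (v $ i)) = Re_vec (- \<i> *s v)" for v :: "complex^'a"
      by (simp add: Re_vec_def vec_eq_iff)
    then show "(\<lambda>v. \<chi> i. Re (v $ i)) ` gen_eigenspace M \<mu> \<union> (\<lambda>v. \<chi> i. Im (v $ i)) ` gen_eigenspace M \<mu> \<subseteq> span ?R"
      using that gen_eigenspace_scale by (fastforce simp: Re_vec_def[symmetric] intro!: span_base)
  qed simp
  then show "spectral_space M S \<subseteq> span ?R"
    unfolding spectral_space_def by (intro span_minimal) auto
  have "Re_vec v \<in> spectral_space M S" if v: "v \<in> gen_eigenspace M \<mu>" and "\<mu> \<in> S" for v \<mu>
  proof (cases "v = 0")
    case True
    then show ?thesis
      by (simp add: linear_0[OF linear_Re_vec] spectral_space_def span_zero)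
  next
    case False
    then have "is_eigenvalue M \<mu>"
      using v by (rule gen_eigenspace_eigenvalue[rotated])
    moreover have "Re_vec v \<in> real_gen_eigenspace M \<mu>"
      unfolding real_gen_eigenspace_def Re_vec_def using v by (intro span_base) auto
    ultimately show ?thesis
      unfolding spectral_space_def using \<open>\<mu> \<in> S\<close> by (intro span_base) auto
  qed
  then show "span ?R \<subseteq> spectral_space M S"
    unfolding spectral_space_def by (intro span_minimal) auto
qed

lemma subspace_spectral_space: "subspace (spectral_space M S)"
  by (simp add: spectral_space_eq)

lemma spectral_space_Un: "spectral_space M (S \<union> S') = spectral_space M S + spectral_space M S'"
  by (auto simp: spectral_space_eq image_Un UN_Un span_Un set_plus_def)

lemma spectral_space_intertwine:
  fixes M N P :: "real^'d^'d"
  assumes P: "N ** P = P ** M" and x: "x \<in> spectral_space M S"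
  shows "P *v x \<in> spectral_space N S"
proof -
  have "(*v) P ` span (\<Union>\<mu>\<in>S. Re_vec ` gen_eigenspace M \<mu>) = span ((*v) P ` (\<Union>\<mu>\<in>S. Re_vec ` gen_eigenspace M \<mu>))"
    by (rule linear_span_image[symmetric]) (rule matrix_vector_mul_linear)
  also have "\<dots> \<subseteq> span (\<Union>\<mu>\<in>S. Re_vec ` gen_eigenspace N \<mu>)"
    using gen_eigenspace_intertwine[OF P]
    by (intro span_mono) (auto simp flip: Re_vec_complexify)
  finally show ?thesis
    using x by (auto simp: spectral_space_eq)
qed

text \<open>With w = (M - \<mu>) v one has N w = v - \<mu> N v. For \<mu> = 0 the induction gives w
  = 0 and thus v = 0; otherwise (N - 1/\<mu>) v is a multiple of N w, which lies in the space of N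
  for 1/\<mu>.\<close>

lemma spectral_space_inverse:
  assumes inv: "N ** M = mat 1" "M ** N = mat 1"
    and S: "\<And>\<mu>. \<mu> \<in> S \<Longrightarrow> \<mu> \<noteq> 0 \<Longrightarrow> inverse \<mu> \<in> S'"
  shows "spectral_space M S \<subseteq> spectral_space N S'"
proof -
  have NM: "complexify N *v (complexify M *v v) = v" for v
    using inv(1) by (metis complexify_matrix_mult complexify_one matrix_vector_mul_assoc matrix_vector_mul_lid)
  have *: "v = 0 \<or> (\<mu> \<noteq> 0 \<and> v \<in> gen_eigenspace N (inverse \<mu>))" if "v \<in> gen_eigenspace M \<mu>" for v \<mu>
    using that
  proof (induction rule: gen_eigenspace_induct)
    case (step v)
    let ?w = "complexify M *v v - \<mu> *s v"
    have w: "complexify N *v ?w = v - \<mu> *s (complexify N *v v)"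
      by (simp add: matrix_vector_mult_diff_distrib vector_scalar_commute NM)
    show ?case
    proof (cases "\<mu> = 0")
      case True
      then have "?w = 0" using step by auto
      then have "v = 0" using w True by simp
      then show ?thesis by simp
    next
      case False
      have "?w \<in> gen_eigenspace N (inverse \<mu>)"
        using step(3) by auto
      then have "complexify N *v ?w \<in> gen_eigenspace N (inverse \<mu>)"
        by (rule gen_eigenspace_intertwine[rotated]) simp
      then have "- inverse \<mu> *s (complexify N *v ?w) \<in> gen_eigenspace N (inverse \<mu>)"
        by (rule gen_eigenspace_scale)
      also have "- inverse \<mu> *s (complexify N *v ?w) = complexify N *v v - inverse \<mu> *s v"
        unfolding w using False by (simp add: vec_eq_iff field_simps)
      finally show ?thesis
        using False gen_eigenspace_shift by blast
    qed
  qed simp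
  show ?thesis
    unfolding spectral_space_eq
  proof (rule span_minimal)
    show "(\<Union>\<mu>\<in>S. Re_vec ` gen_eigenspace M \<mu>) \<subseteq> span (\<Union>\<mu>\<in>S'. Re_vec ` gen_eigenspace N \<mu>)"
    proof safe
      fix v \<mu> assume v: "v \<in> gen_eigenspace M \<mu>" and \<mu>: "\<mu> \<in> S"
      consider "v = 0" | "\<mu> \<noteq> 0" "v \<in> gen_eigenspace N (inverse \<mu>)"
        using *[OF v] by blast
      then show "Re_vec v \<in> span (\<Union>\<mu>\<in>S'. Re_vec ` gen_eigenspace N \<mu>)"
        by cases (use S[OF \<mu>] in \<open>auto simp: linear_0[OF linear_Re_vec] span_zero intro!: span_base\<close>)
    qed
  qed simp
qed

subsection \<open>The spectral decomposition\<close>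

text \<open>If (M - \<nu>) w = (M - \<mu>) y, then (M - \<mu>)(w - y) = (\<nu> - \<mu>) w, so a
  multiple of w - y is a preimage of w; y comes from the induction.\<close>

lemma gen_eigenspace_surj:
  assumes "w \<in> gen_eigenspace M \<nu>" "\<nu> \<noteq> \<mu>"
  obtains y where "y \<in> gen_eigenspace M \<nu>" "w = complexify M *v y - \<mu> *s y"
proof -
  have "\<exists>y\<in>gen_eigenspace M \<nu>. w = complexify M *v y - \<mu> *s y"
    using assms(1)
  proof (induction rule: gen_eigenspace_induct)
    case zero
    then show ?case by (intro bexI[of _ 0]) auto
  next
    case (step w)
    then obtain y where y: "y \<in> gen_eigenspace M \<nu>"
      "complexify M *v w - \<nu> *s w = complexify M *v y - \<mu> *s y" by blast
    show ?case
    proof (rule bexI)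
      show "inverse (\<nu> - \<mu>) *s (w - y) \<in> gen_eigenspace M \<nu>"
        using step y by (intro gen_eigenspace_scale gen_eigenspace_diff)
      have "complexify M *v (w - y) - \<mu> *s (w - y) = (\<nu> - \<mu>) *s w"
        using y(2) by (simp add: matrix_vector_mult_diff_distrib algebra_simps vector_sub_rdistrib vec_eq_iff)
      then have "inverse (\<nu> - \<mu>) *s (complexify M *v (w - y) - \<mu> *s (w - y)) = w"
        using assms(2) by (simp only: vector_smult_assoc) simp
      then show "w = complexify M *v (inverse (\<nu> - \<mu>) *s (w - y)) - \<mu> *s (inverse (\<nu> - \<mu>) *s (w - y))"
        by (simp only: shifted_matrix_scale)
    qed
  qed
  then show ?thesis using that by blast
qed

text \<open>Every w in the span is (M - \<mu>) y + g with y in the span and g in the space of \<mu>,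
  since the components for other numbers \<nu> have preimages. For w = (M - \<mu>) v this gives (M -
  \<mu>)(v - y) = g, so v - y lies in the space of \<mu>.\<close>

lemma span_gen_eigenspaces_shift:
  assumes "complexify M *v v - \<mu> *s v \<in> vec.span (\<Union>\<nu>. gen_eigenspace M \<nu>)"
  shows "v \<in> vec.span (\<Union>\<nu>. gen_eigenspace M \<nu>)" (is "_ \<in> ?V")
proof -
  have "\<exists>y\<in>?V. \<exists>g\<in>gen_eigenspace M \<mu>. w = complexify M *v y - \<mu> *s y + g" if "w \<in> ?V" for w
    using that
  proof (induction rule: vec.span_induct_alt)
    case base
    show ?case
      by (intro bexI[of _ 0]) (auto simp: vec.span_zero)
  next
    case (step c x w)
    then obtain y g where yg: "y \<in> ?V" "g \<in> gen_eigenspace M \<mu>" "w = complexify M *v y - \<mu> *s y + g"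
      by blast
    from step obtain \<nu> where x: "x \<in> gen_eigenspace M \<nu>" by blast
    show ?case
    proof (cases "\<nu> = \<mu>")
      case True
      then show ?thesis
        using yg x by (intro bexI[of _ y] bexI[of _ "c *s x + g"])
          (auto intro: gen_eigenspace_add gen_eigenspace_scale simp: algebra_simps)
    next
      case False
      then obtain z where z: "z \<in> gen_eigenspace M \<nu>" "x = complexify M *v z - \<mu> *s z"
        using gen_eigenspace_surj[OF x] by blast
      have "c *s z + y \<in> ?V"
        using z(1) yg(1) by (intro vec.span_add vec.span_scale) (auto intro: vec.span_base)
      moreover have "c *s x + w = complexify M *v (c *s z + y) - \<mu> *s (c *s z + y) + g"
        unfolding yg(3) z(2)
        by (simp add: matrix_vector_right_distrib vector_scalar_commute vec.scale_right_diff_distrib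
            vec.scale_right_distrib vector_smult_assoc mult.commute)
      ultimately show ?thesis
        using yg(2) by blast
    qed
  qed
  from this[OF assms] obtain y g where yg: "y \<in> ?V" "g \<in> gen_eigenspace M \<mu>"
    "complexify M *v v - \<mu> *s v = complexify M *v y - \<mu> *s y + g" by blast
  then have "complexify M *v (v - y) - \<mu> *s (v - y) = g"
    by (simp add: matrix_vector_mult_diff_distrib vec.scale_right_diff_distrib algebra_simps)
  then have "v - y \<in> gen_eigenspace M \<mu>"
    using yg(2) gen_eigenspace_shift by metis
  then have "v - y + y \<in> ?V"
    using yg(1) by (intro vec.span_add) (auto intro: vec.span_base)
  then show ?thesis by simp
qed

text \<open>An annihilating polynomial of \<open>v\<close> splits into linear factors, which are stripped off one at a
  time with the previous lemma.\<close>

lemma span_gen_eigenspaces: "v \<in> vec.span (\<Union>\<nu>. gen_eigenspace M \<nu>)" (is "_ \<in> ?V")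
proof -
  let ?L = "(*v) (complexify M)"
  have L: "?L (\<Sum>i\<in>I. c i *s w i) = (\<Sum>i\<in>I. c i *s ?L (w i))" for I and c :: "nat \<Rightarrow> complex" and w
    by (induction I rule: infinite_finite_induct) (auto simp: matrix_vector_right_distrib vector_scalar_commute)
  \<comment> \<open>\<open>ev p\<close> is p(M) v.\<close>
  define ev where "ev = (\<lambda>p. \<Sum>i\<le>degree p. coeff p i *s (?L ^^ i) v)"
  have ev: "ev p = (\<Sum>i\<le>n. coeff p i *s (?L ^^ i) v)" if "degree p \<le> n" for p n
    unfolding ev_def using that by (intro sum.mono_neutral_left) (auto simp: coeff_eq_0)
  have ev_pCons: "ev (pCons a p) = a *s v + ?L (ev p)" for a p
  proof -
    have "ev (pCons a p) = (\<Sum>i\<le>Suc (degree p). coeff (pCons a p) i *s (?L ^^ i) v)"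
      by (intro ev degree_pCons_le)
    also have "\<dots> = a *s v + (\<Sum>i\<le>degree p. coeff p i *s ?L ((?L ^^ i) v))"
      by (subst sum.atMost_Suc_shift) simp
    finally show ?thesis by (simp add: L ev_def)
  qed
  have main: "v \<in> ?V" if "p \<noteq> 0" "ev p \<in> ?V" for p
    using that
  proof (induction "degree p" arbitrary: p)
    case 0
    then obtain a where p: "p = [:a:]" by (metis degree_eq_zeroE)
    then have "inverse a *s ev p \<in> ?V" "a \<noteq> 0"
      using 0 by (auto intro!: vec.span_scale)
    then show ?case
      using p by (simp add: ev_def vector_smult_assoc)
  next
    case (Suc n)
    then have "\<not> constant (poly p)"
      by (simp add: constant_degree)
    then obtain a where "poly p a = 0"
      using fundamental_theorem_of_algebra by blast
    then obtain q where q: "p = [:- a, 1:] * q"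
      by (metis dvdE poly_eq_0_iff_dvd)
    then have q': "p = pCons 0 q - smult a q" by simp
    have "q \<noteq> 0" using q Suc by auto
    have deg: "degree p = Suc (degree q)"
      unfolding q using \<open>q \<noteq> 0\<close> by (subst degree_mult_eq) auto
    have "ev p = (\<Sum>i\<le>Suc (degree q). coeff (pCons 0 q) i *s (?L ^^ i) v - a *s (coeff q i *s (?L ^^ i) v))"
      unfolding ev_def deg by (intro sum.cong refl) (simp add: q' vec.scale_left_diff_distrib vector_smult_assoc)
    also have "\<dots> = ev (pCons 0 q) - a *s ev q"
      by (simp add: sum_subtractf ev[of q "Suc (degree q)"] ev[OF degree_pCons_le] vec.scale_sum_right
          del: sum.atMost_Suc)
    also have "\<dots> = ?L (ev q) - a *s ev q"
      by (simp add: ev_pCons)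
    finally have "ev q \<in> ?V"
      using Suc.prems span_gen_eigenspaces_shift by metis
    then show ?case
      using Suc \<open>q \<noteq> 0\<close> deg by simp
  qed
  \<comment> \<open>One more iterate than the dimension forces a linear relation. Dependence is a
    property of the set of iterates, so a repetition among them is handled separately, by a
    difference of two monomials.\<close>
  have "\<exists>p. p \<noteq> 0 \<and> ev p = 0"
  proof (cases "inj_on (\<lambda>i. (?L ^^ i) v) {..CARD('a)}")
    case True
    let ?S = "(\<lambda>i. (?L ^^ i) v) ` {..CARD('a)}"
    have "vec.dependent ?S"
    proof (rule ccontr)
      assume "\<not> vec.dependent ?S"
      then have "card ?S \<le> vec.dim (UNIV :: (complex^'a) set)"
        by (intro vec.independent_card_le_dim) auto
      then show False
        using card_image[OF True] by (simp add: card_cart_basis)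
    qed
    then obtain u w where u: "(\<Sum>x\<in>?S. u x *s x) = 0" "w \<in> ?S" "u w \<noteq> 0"
      by (auto simp: vec.dependent_finite)
    define p where "p = Poly (map (\<lambda>i. u ((?L ^^ i) v)) [0..<Suc (CARD('a))])"
    have p: "coeff p i = (if i \<le> CARD('a) then u ((?L ^^ i) v) else 0)" for i
      unfolding p_def by (auto simp: nth_default_def simp del: upt_Suc)
    have "degree p \<le> CARD('a)"
      by (rule degree_le) (simp add: p)
    then have "ev p = (\<Sum>i\<le>CARD('a). u ((?L ^^ i) v) *s (?L ^^ i) v)"
      by (simp add: ev p)
    also have "\<dots> = (\<Sum>x\<in>?S. u x *s x)"
      by (simp add: sum.reindex[OF True])
    finally have "ev p = 0" using u by simp
    moreover have "p \<noteq> 0"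
    proof -
      obtain i where "i \<le> CARD('a)" "w = (?L ^^ i) v" using u(2) by auto
      then have "coeff p i \<noteq> 0" using u(3) by (simp add: p)
      then show ?thesis by auto
    qed
    ultimately show ?thesis by blast
  next
    case False
    then obtain i j where ij: "i < j" "(?L ^^ i) v = (?L ^^ j) v"
      unfolding inj_on_def by (metis linorder_neqE_nat)
    let ?p = "monom 1 i - monom 1 j :: complex poly"
    have "degree ?p \<le> j"
      using ij by (intro degree_diff_le) (auto simp: degree_monom_eq)
    then have "ev ?p = (\<Sum>k\<le>j. (if k = i then (?L ^^ i) v else 0) - (if k = j then (?L ^^ j) v else 0))"
      by (subst ev) (auto intro!: sum.cong)
    also have "\<dots> = 0"
      using ij by (simp add: sum_subtractf)
    finally have "ev ?p = 0" .
    moreover have "coeff ?p i \<noteq> 0" using ij by simp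
    then have "?p \<noteq> 0" by (metis coeff_0)
    ultimately show ?thesis by blast
  qed
  then show ?thesis
    using main vec.span_zero by metis
qed

lemma spectral_space_UNIV: "spectral_space M UNIV = UNIV"
proof -
  have "Re_vec w \<in> spectral_space M UNIV" if "w \<in> vec.span (\<Union>\<nu>. gen_eigenspace M \<nu>)" for w
    using that
  proof (induction rule: vec.span_induct_alt)
    case base
    then show ?case
      by (simp add: linear_0[OF linear_Re_vec] subspace_0[OF subspace_spectral_space])
  next
    case (step c x y)
    then have "Re_vec (c *s x) \<in> spectral_space M UNIV"
      unfolding spectral_space_eq by (auto intro!: span_base imageI gen_eigenspace_scale)
    then show ?case
      using step by (simp add: linear_add[OF linear_Re_vec] subspace_add[OF subspace_spectral_space])
  qed
  moreover have "Re_vec (\<chi> i. complex_of_real (x $ i)) = x" for x :: "real^'a"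
    by (simp add: Re_vec_def vec_eq_iff)
  ultimately have "x \<in> spectral_space M UNIV" for x
    using span_gen_eigenspaces by metis
  then show ?thesis by auto
qed

lemma spectral_space_decompose:
  obtains y z where "y \<in> spectral_space M {\<mu>. cmod \<mu> < 1}" "z \<in> spectral_space M {\<mu>. cmod \<mu> \<ge> 1}" "x = y + z"
proof -
  have "{\<mu>. cmod \<mu> < 1} \<union> {\<mu>. cmod \<mu> \<ge> 1} = UNIV" by auto
  then have "x \<in> spectral_space M ({\<mu>. cmod \<mu> < 1} \<union> {\<mu>. cmod \<mu> \<ge> 1})"
    by (simp add: spectral_space_UNIV)
  then show ?thesis
    using that by (auto simp: spectral_space_Un set_plus_def)
qed

subsection \<open>Powers of a matrix on its spectral spaces\<close>

text \<open>Summing the recursion bounds the partial sums by s <= a 0 + q s +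
  \<open>suminf b\<close>, which can be solved for s because q < 1.\<close>

lemma summable_affine_recursion:
  fixes a b :: "nat \<Rightarrow> real"
  assumes "\<And>n. 0 \<le> a n" "0 \<le> q" "q < 1" "\<And>n. 0 \<le> b n" "summable b"
    and rec: "\<And>n. a (Suc n) \<le> q * a n + b n"
  shows "summable a"
proof (rule bounded_imp_summable)
  fix n
  have "sum a {..n} \<le> sum a {..Suc n}"
    using assms(1) by simp
  also have "\<dots> = a 0 + (\<Sum>i\<le>n. a (Suc i))"
    by (rule sum.atMost_Suc_shift)
  also have "\<dots> \<le> a 0 + (\<Sum>i\<le>n. q * a i + b i)"
    by (intro add_left_mono sum_mono rec)
  also have "\<dots> = a 0 + q * sum a {..n} + sum b {..n}"
    by (simp add: sum.distrib sum_distrib_left)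
  also have "\<dots> \<le> a 0 + q * sum a {..n} + suminf b"
    using assms(4,5) by (intro add_left_mono sum_le_suminf) auto
  finally have "sum a {..n} * (1 - q) \<le> a 0 + suminf b"
    by (simp add: algebra_simps)
  then show "sum a {..n} \<le> (a 0 + suminf b) / (1 - q)"
    using assms(3) by (simp add: pos_le_divide_eq)
qed (use assms in auto)

text \<open>For a generalized eigenvector v the norms of M^j v satisfy an affine recursion with
  factor |\<mu>|, whose inhomogeneity comes from the vector (M - \<mu>) v of smaller height and is
  summable by induction.\<close>

lemma summable_stable_powers:
  assumes "x \<in> spectral_space M {\<mu>. cmod \<mu> < 1}"
  shows "summable (\<lambda>j. norm (((*v) M ^^ j) x))"
proof -
  let ?L = "(*v) (complexify M)"
  have gen: "summable (\<lambda>j. norm ((?L ^^ j) v))" if "v \<in> gen_eigenspace M \<mu>" "cmod \<mu> < 1" for v \<mu>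
    using that(1)
  proof (induction rule: gen_eigenspace_induct)
    case zero
    have "(?L ^^ j) 0 = 0" for j by (induction j) auto
    then show ?case by simp
  next
    case (step v)
    have diff: "(?L ^^ j) (?L v - \<mu> *s v) = (?L ^^ Suc j) v - \<mu> *s (?L ^^ j) v" for j
      by (induction j) (auto simp: matrix_vector_mult_diff_distrib vector_scalar_commute)
    show ?case
    proof (rule summable_affine_recursion[OF _ _ that(2) _ step(3)])
      fix j
      have "norm ((?L ^^ Suc j) v) \<le> norm (\<mu> *s (?L ^^ j) v) + norm ((?L ^^ Suc j) v - \<mu> *s (?L ^^ j) v)"
        by (rule norm_triangle_sub)
      also have "norm (\<mu> *s w) = cmod \<mu> * norm w" for w :: "complex^'a"
        by (simp add: norm_vec_def norm_mult L2_set_right_distrib)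
      finally show "norm ((?L ^^ Suc j) v) \<le> cmod \<mu> * norm ((?L ^^ j) v) + norm ((?L ^^ j) (?L v - \<mu> *s v))"
        unfolding diff .
    qed auto
  qed
  have add: "((*v) M ^^ j) (c *\<^sub>R x + y) = c *\<^sub>R ((*v) M ^^ j) x + ((*v) M ^^ j) y" for c x y j
    by (induction j) (auto simp: matrix_vector_right_distrib matrix_vector_mult_scaleR)
  show ?thesis
    using assms unfolding spectral_space_eq
  proof (induction rule: span_induct_alt)
    case base
    have "((*v) M ^^ j) 0 = 0" for j by (induction j) auto
    then show ?case by simp
  next
    case (step c x y)
    then obtain v \<mu> where v: "v \<in> gen_eigenspace M \<mu>" "cmod \<mu> < 1" "x = Re_vec v" by auto
    have "summable (\<lambda>j. norm (((*v) M ^^ j) x))"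
      by (rule summable_comparison_test[OF _ gen[OF v(1,2)]])
        (auto simp: v(3) norm_Re_vec_le simp flip: Re_vec_funpow_complexify)
    then have "summable (\<lambda>j. \<bar>c\<bar> * norm (((*v) M ^^ j) x) + norm (((*v) M ^^ j) y))"
      using step(2) by (intro summable_add summable_mult)
    then show ?case
      by (rule summable_comparison_test[rotated])
        (auto simp: add intro!: exI[of _ 0] norm_triangle_le add_mono)
  qed
qed

text \<open>On a generalized eigenspace the functional \<open>f\<close> satisfies \<open>f (M\<^sup>j v) = \<mu>\<^sup>j f v\<close>, by induction on
  the height of \<open>v\<close>.\<close>

lemma orthogonal_unstable:
  assumes p: "\<And>x. (\<lambda>j. p \<bullet> ((*v) M ^^ j) x) \<longlonglongrightarrow> 0" and x: "x \<in> spectral_space M {\<mu>. cmod \<mu> \<ge> 1}"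
  shows "p \<bullet> x = 0"
proof -
  let ?L = "(*v) (complexify M)"
  \<comment> \<open>The complex linear extension of p; its imaginary part at v is its real part at
    -i v.\<close>
  define f where "f = (\<lambda>v. \<Sum>i\<in>UNIV. complex_of_real (p $ i) * v $ i)"
  have Re_f: "Re (f v) = p \<bullet> Re_vec v" for v
    by (simp add: f_def Re_vec_def inner_vec_def)
  have Im_f: "Im (f v) = p \<bullet> Re_vec (- \<i> *s v)" for v
    by (simp add: f_def Re_vec_def inner_vec_def)
  have f_diff: "f (v - w) = f v - f w" and f_scale: "f (c *s v) = c * f v" for v w c
    by (auto simp: f_def algebra_simps sum_subtractf sum_distrib_left)
  have "(?L ^^ j) (c *s v) = c *s (?L ^^ j) v" for c v j
    by (induction j) (auto simp: vector_scalar_commute)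
  note scale = this[symmetric]
  have lim: "(\<lambda>j. f ((?L ^^ j) v)) \<longlonglongrightarrow> 0" for v
  proof -
    have "(\<lambda>j. Re (f ((?L ^^ j) v))) \<longlonglongrightarrow> 0"
      unfolding Re_f Re_vec_funpow_complexify by (rule p)
    moreover have "(\<lambda>j. Im (f ((?L ^^ j) v))) \<longlonglongrightarrow> 0"
      unfolding Im_f scale Re_vec_funpow_complexify by (rule p)
    ultimately show ?thesis
      by (simp add: tendsto_complex_iff)
  qed
  have gen: "f ((?L ^^ j) v) = 0" if "v \<in> gen_eigenspace M \<mu>" "cmod \<mu> \<ge> 1" for j v \<mu>
    using that(1)
  proof (induction arbitrary: j rule: gen_eigenspace_induct)
    case zero
    have "(?L ^^ j) 0 = 0" for j by (induction j) auto
    then show ?case by (simp add: f_def)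
  next
    case (step v)
    have pow: "f ((?L ^^ j) v) = \<mu> ^ j * f v" for j
    proof (induction j)
      case (Suc j)
      have "(?L ^^ j) (?L v - \<mu> *s v) = (?L ^^ Suc j) v - \<mu> *s (?L ^^ j) v" for j
        by (induction j) (auto simp: matrix_vector_mult_diff_distrib vector_scalar_commute)
      then have "f ((?L ^^ Suc j) v) - \<mu> * f ((?L ^^ j) v) = 0"
        using step(3)[of j] by (simp only: f_diff f_scale)
      then show ?case using Suc by simp
    qed simp
    \<comment> \<open>Here |\<mu>| >= 1 enters: |f v| is at most |\<mu>^j f v|, which tends to
      0.\<close>
    have "norm (f v) \<le> norm (f ((?L ^^ j) v))" for j
      unfolding pow using that(2) by (simp add: norm_mult norm_power mult_le_cancel_right1 one_le_power)
    then have "norm (f v) \<le> norm (0::complex)"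
      by (intro LIMSEQ_le_const[OF tendsto_norm[OF lim]]) auto
    then show ?case by (simp add: pow)
  qed
  show ?thesis
    using x unfolding spectral_space_eq
  proof (induction rule: span_induct_alt)
    case (step c x y)
    then obtain v \<mu> where "v \<in> gen_eigenspace M \<mu>" "cmod \<mu> \<ge> 1" "x = Re_vec v" by auto
    then have "p \<bullet> x = 0"
      using gen[of v \<mu> 0] Re_f[of v] by simp
    then show ?case
      using step by (simp add: inner_add_right)
  qed simp
qed

section \<open>Reachable sets of abstract periodic linear systems\<close>

lemma bounded_bilinear_matrix_vector_mult:
  "bounded_bilinear ((*v) :: real^'n^'m \<Rightarrow> real^'n \<Rightarrow> real^'m)"
  unfolding bilinear_conv_bounded_bilinear[symmetric] bilinear_def
  by (auto intro!: linearI simp: matrix_vector_mult_add_rdistrib scaleR_matrix_vector_assoc)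

lemmas continuous_on_matrix_vector_mult [continuous_intros] =
  bounded_bilinear.continuous_on[OF bounded_bilinear_matrix_vector_mult]

lemma bounded_bilinear_matrix_matrix_mult:
  "bounded_bilinear ((**) :: real^'n^'m \<Rightarrow> real^'k^'n \<Rightarrow> real^'k^'m)"
  unfolding bilinear_conv_bounded_bilinear[symmetric] bilinear_def
  by (auto intro!: linearI simp: vec_eq_iff matrix_matrix_mult_def algebra_simps sum.distrib sum_distrib_left)

lemmas continuous_on_matrix_matrix_mult [continuous_intros] =
  bounded_bilinear.continuous_on[OF bounded_bilinear_matrix_matrix_mult]

text \<open>A slightly stretched point (1 + h) x is still interior. Then x + v is the convex
  combination of this point, with weight e = 1/(1 + h), and of v/(1 - e), which lies in V. The
  choice of \<open>h\<close> keeps h|x| below the radius d.\<close>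

lemma interior_convex_add_subspace:
  fixes C :: "'a::euclidean_space set"
  assumes C: "convex C" and V: "subspace V" "V \<subseteq> C" and x: "x \<in> interior C" and v: "v \<in> V"
  shows "x + v \<in> interior C"
proof -
  obtain d where d: "d > 0" "ball x d \<subseteq> interior C"
    using x open_contains_ball by (metis open_interior)
  define h where "h = d / (2 * (norm x + 1))"
  have n: "norm x + 1 > 0"
    by (simp add: add_nonneg_pos)
  then have h: "h > 0" using d by (simp add: h_def)
  have "norm (h *\<^sub>R x) \<le> h * (norm x + 1)"
    using h by simp
  also have "\<dots> = d / 2"
    using n unfolding h_def by (auto simp: divide_simps)
  finally have "norm (h *\<^sub>R x) \<le> d / 2" .
  then have "x + h *\<^sub>R x \<in> ball x d"
    using d(1) by (simp add: dist_norm)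
  then have c: "(1 + h) *\<^sub>R x \<in> interior C"
    using d(2) by (auto simp: scaleR_left_distrib)
  define e where "e = 1 / (1 + h)"
  have e: "0 < e" "e \<le> 1" "e * (1 + h) = 1" "e < 1"
    using h by (auto simp: e_def)
  define w where "w = (1 / (1 - e)) *\<^sub>R v"
  have "w \<in> closure C"
    using V v unfolding w_def by (meson closure_subset subsetD subspace_scale)
  from mem_interior_closure_convex_shrink[OF C c this e(1,2)]
  have "w - e *\<^sub>R (w - (1 + h) *\<^sub>R x) \<in> interior C" .
  also have "w - e *\<^sub>R (w - (1 + h) *\<^sub>R x) = (1 - e) *\<^sub>R w + (e * (1 + h)) *\<^sub>R x"
    by (simp add: algebra_simps)
  also have "\<dots> = x + v"
    using e by (simp add: w_def)
  finally show ?thesis .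
qed

lemma inner_matrix_vector: "p \<bullet> (M *v x) = (transpose M *v p) \<bullet> x" for M :: "real^'n^'m"
  by (simp add: dot_lmul_matrix)

lemma inner_funpow_transpose:
  "p \<bullet> ((*v) M ^^ j) x = ((*v) (transpose M) ^^ j) p \<bullet> x" for M :: "real^'n^'n"
proof (induction j arbitrary: p)
  case (Suc j)
  have "p \<bullet> ((*v) M ^^ Suc j) x = (transpose M *v p) \<bullet> ((*v) M ^^ j) x"
    by (simp only: funpow.simps(2) o_apply inner_matrix_vector)
  also have "\<dots> = ((*v) (transpose M) ^^ j) (transpose M *v p) \<bullet> x"
    by (rule Suc)
  finally show ?case
    by (simp only: funpow_Suc_right o_apply)
qed simp

text \<open>What the argument uses of the control system, in a form that holds in both directions of
  time. \<open>R_mono\<close> is switching the control off. \<open>R_split\<close> is concatenation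
  after k whole periods, where periodicity lets the remaining control start afresh at time 0.
  \<open>R_interior\<close> carries the controllability.\<close>

locale periodic_reach =
  fixes T :: real and X :: "real \<Rightarrow> real \<Rightarrow> real^'d^'d" and R :: "real \<Rightarrow> (real^'d) set"
  assumes T_pos: "T > 0"
    and X_cocycle: "X t s ** X s r = X t r"
    and X_refl: "X t t = mat 1"
    and X_periodic: "X (t + T) (s + T) = X t s"
    and X_continuous: "continuous_on UNIV (\<lambda>t. X 0 t)" "continuous_on UNIV (\<lambda>t. X t 0)"
    and R_at_0: "R 0 = {0}"
    and R_convex: "0 \<le> t \<Longrightarrow> convex (R t)"
    and R_mono: "0 \<le> s \<Longrightarrow> s \<le> t \<Longrightarrow> y \<in> R s \<Longrightarrow> X t s *v y \<in> R t"
    and R_split: "0 \<le> t \<Longrightarrow>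
      R (t + real k * T) = (*v) (X (t + real k * T) (real k * T)) ` R (real k * T) + R t"
    and R_bounded: "bounded (R T)"
    and R_interior: "\<exists>k. 0 \<in> interior (R (real k * T))"
begin

text \<open>The shifts n are integers and \<tau> is any real, so that \<open>F\<close> is periodic
  on the line and the flow may pass the point where the circle is cut.\<close>

definition F :: "real \<Rightarrow> (real^'d) set" where
  "F \<tau> = (\<Union>t\<in>{t. t \<ge> 0 \<and> (\<exists>n::int. t = \<tau> + of_int n * T)}. R t)"

definition stable :: "real \<Rightarrow> (real^'d) set" where
  "stable \<tau> = spectral_space (X (T + \<tau>) \<tau>) {\<mu>. cmod \<mu> < 1}"

definition unstable :: "real \<Rightarrow> (real^'d) set" where
  "unstable \<tau> = spectral_space (X (T + \<tau>) \<tau>) {\<mu>. cmod \<mu> \<ge> 1}"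

lemma X_cocycle_vec: "X t s *v (X s r *v x) = X t r *v x"
  by (simp add: matrix_vector_mul_assoc X_cocycle)

lemma X_inverse [simp]: "X t s *v (X s t *v x) = x"
  by (simp add: X_cocycle_vec X_refl)

lemma X_shift: "X (t + of_int n * T) (s + of_int n * T) = X t s"
proof -
  have nat: "X (t + real k * T) (s + real k * T) = X t s" for k t s
  proof (induction k)
    case (Suc k)
    then show ?case
      using X_periodic[of "t + real k * T" "s + real k * T"] by (simp add: algebra_simps)
  qed simp
  show ?thesis
  proof (cases n)
    case (nonneg k)
    then show ?thesis using nat by simp
  next
    case (neg k)
    then have "real_of_int n = - real (Suc k)" by simp
    then have "of_int n * T = - (real (Suc k) * T)"
      by (simp only: mult_minus_left)
    then show ?thesis
      using nat[of "t - real (Suc k) * T" "Suc k" "s - real (Suc k) * T"] by simp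
  qed
qed

section \<open>Convexity of the fibres and their interiors\<close>

lemma zero_in_R: "0 \<le> t \<Longrightarrow> 0 \<in> R t"
  using R_mono[of 0 t 0] by (simp add: R_at_0)

lemma FI: "x \<in> R t \<Longrightarrow> 0 \<le> t \<Longrightarrow> t = \<tau> + of_int n * T \<Longrightarrow> x \<in> F \<tau>"
  by (auto simp: F_def)

lemma FE:
  assumes "x \<in> F \<tau>"
  obtains n :: int where "0 \<le> \<tau> + of_int n * T" "x \<in> R (\<tau> + of_int n * T)"
  using assms by (auto simp: F_def)

lemma F_periodic: "F (\<tau> + of_int n * T) = F \<tau>"
proof -
  have "F (\<tau> + of_int n * T) \<subseteq> F \<tau>" for \<tau> n
    by (auto elim!: FE intro: FI[where n = "n + m" for m] simp: algebra_simps)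
  from this[of \<tau> n] this[of "\<tau> + of_int n * T" "- n"] show ?thesis
    by simp
qed

lemma F_flow:
  assumes "y \<in> F \<sigma>" "\<sigma> \<le> \<tau>"
  shows "X \<tau> \<sigma> *v y \<in> F \<tau>"
proof -
  obtain n :: int where n: "0 \<le> \<sigma> + of_int n * T" "y \<in> R (\<sigma> + of_int n * T)"
    using assms(1) by (rule FE)
  then have "X (\<tau> + of_int n * T) (\<sigma> + of_int n * T) *v y \<in> R (\<tau> + of_int n * T)"
    using assms(2) by (intro R_mono) auto
  then show ?thesis
    using n assms(2) by (intro FI[where n=n]) (auto simp: X_shift)
qed

text \<open>Rest at 0 for k periods, then apply the old control. The sets along one residue class of
  times therefore increase, which makes their union convex.\<close>

lemma R_subset_shift:
  assumes "0 \<le> t"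
  shows "R t \<subseteq> R (t + real k * T)"
proof
  fix x assume "x \<in> R t"
  moreover have "0 \<in> (*v) (X (t + real k * T) (real k * T)) ` R (real k * T)"
    using zero_in_R[of "real k * T"] T_pos by (auto intro!: image_eqI[of _ _ 0])
  ultimately show "x \<in> R (t + real k * T)"
    unfolding R_split[OF assms] by (force simp: set_plus_def)
qed

lemma convex_F: "convex (F \<tau>)"
proof (rule convexI)
  fix x y :: "real^'d" and u v :: real
  assume xy: "x \<in> F \<tau>" "y \<in> F \<tau>" and uv: "0 \<le> u" "0 \<le> v" "u + v = 1"
  obtain n :: int where n: "0 \<le> \<tau> + of_int n * T" "x \<in> R (\<tau> + of_int n * T)"
    using xy(1) by (rule FE)
  obtain m :: int where m: "0 \<le> \<tau> + of_int m * T" "y \<in> R (\<tau> + of_int m * T)"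
    using xy(2) by (rule FE)
  define N where "N = max n m"
  have up: "R (\<tau> + of_int i * T) \<subseteq> R (\<tau> + of_int N * T)" if "i \<le> N" "0 \<le> \<tau> + of_int i * T" for i
    using R_subset_shift[OF that(2), of "nat (N - i)"] that(1) by (simp add: algebra_simps)
  have N: "0 \<le> \<tau> + of_int N * T"
    using n(1) m(1) by (auto simp: N_def max_def)
  have "x \<in> R (\<tau> + of_int N * T)" "y \<in> R (\<tau> + of_int N * T)"
    using up[of n] up[of m] n m by (auto simp: N_def)
  then have "u *\<^sub>R x + v *\<^sub>R y \<in> R (\<tau> + of_int N * T)"
    using R_convex[OF N] uv by (simp add: convexD)
  then show "u *\<^sub>R x + v *\<^sub>R y \<in> F \<tau>"
    using N by (rule FI[where n=N]) simp
qed

lemma continuous_on_X: "continuous_on UNIV (\<lambda>t. X \<sigma> t)"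
proof -
  have "continuous_on UNIV (\<lambda>t. X \<sigma> 0 ** X 0 t)"
    by (intro continuous_intros X_continuous)
  then show ?thesis by (simp add: X_cocycle)
qed

lemma open_flow:
  assumes "open G"
  shows "open {p. fst p > \<sigma> \<and> X \<sigma> (fst p) *v snd p \<in> G}"
proof -
  have "continuous_on UNIV (\<lambda>p :: real \<times> (real^'d). X \<sigma> (fst p))"
    by (rule continuous_on_compose2[OF continuous_on_X]) (auto intro!: continuous_intros)
  then have "continuous_on UNIV (\<lambda>p. X \<sigma> (fst p) *v snd p)"
    by (intro continuous_intros)
  then have "open ((\<lambda>p. X \<sigma> (fst p) *v snd p) -` G)"
    using assms by (simp add: continuous_on_open_vimage)
  moreover have "open (fst -` {\<sigma><..} :: (real \<times> (real^'d)) set)"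
    by (rule open_vimage_fst) auto
  moreover have "{p. fst p > \<sigma> \<and> X \<sigma> (fst p) *v snd p \<in> G} =
      (fst -` {\<sigma><..}) \<inter> ((\<lambda>p. X \<sigma> (fst p) *v snd p) -` G)"
    by auto
  ultimately show ?thesis
    by (simp only: open_Int)
qed

text \<open>The witness \<open>?O\<close> is open because X \<sigma> t depends continuously on t and
  t > \<sigma> is an open condition; in particular it contains points at times before
  \<tau>.\<close>

lemma interior_flow:
  assumes y: "y \<in> interior (F \<sigma>)" and "\<sigma> < \<tau>"
  shows "(\<tau>, X \<tau> \<sigma> *v y) \<in> interior {(t, x). x \<in> F t}"
proof (rule interiorI)
  let ?O = "{p. fst p > \<sigma> \<and> X \<sigma> (fst p) *v snd p \<in> interior (F \<sigma>)}"
  show "open ?O"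
    by (rule open_flow) simp
  show "(\<tau>, X \<tau> \<sigma> *v y) \<in> ?O"
    using assms by simp
  show "?O \<subseteq> {(t, x). x \<in> F t}"
  proof safe
    fix t x assume *: "X \<sigma> (fst (t, x)) *v snd (t, x) \<in> interior (F \<sigma>)" "\<sigma> < fst (t, x)"
    have "X t \<sigma> *v (X \<sigma> t *v x) \<in> F t"
      by (rule F_flow) (use * interior_subset in auto)
    then show "x \<in> F t" by simp
  qed
qed

lemma interior_slice:
  assumes "(\<tau>, x) \<in> interior {(t, x). x \<in> G t}"
  shows "x \<in> interior (G \<tau>)"
proof -
  obtain A B where AB: "open A" "open B" "(\<tau>, x) \<in> A \<times> B" "A \<times> B \<subseteq> interior {(t, x). x \<in> G t}"
    using open_prod_elim[OF open_interior assms] by blast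
  then have "A \<times> B \<subseteq> {(t, x). x \<in> G t}"
    using interior_subset by blast
  then show ?thesis
    using AB by (intro interiorI[of B]) auto
qed

lemma period_below: obtains n :: nat where "- real n * T < \<tau>"
proof -
  obtain n :: nat where "- \<tau> < real n * T"
    using reals_Archimedean3[OF T_pos] by blast
  then show ?thesis by (intro that[of n]) simp
qed

lemma F_at_multiple: "F (- real n * T) = F 0" "X (T + - real n * T) (- real n * T) = X T 0"
  using F_periodic[of 0 "- int n"] X_shift[of T "- int n" 0] by simp_all

lemma zero_interior: "(\<tau>, 0) \<in> interior {(t, x). x \<in> F t}"
proof -
  obtain k where k: "0 \<in> interior (R (real k * T))"
    using R_interior by blast
  have "R (real k * T) \<subseteq> F 0"
  proof
    fix x assume "x \<in> R (real k * T)"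
    then show "x \<in> F 0"
      by (rule FI[where n="int k"]) (use T_pos in auto)
  qed
  then have "0 \<in> interior (F 0)"
    using k interior_mono by blast
  \<comment> \<open>Any multiple of T below \<tau> serves as the earlier time, because the fibre
    there is \<open>F 0\<close>.\<close>
  obtain n :: nat where n: "- real n * T < \<tau>" by (rule period_below)
  show ?thesis
    using interior_flow[of 0 "- real n * T" \<tau>] \<open>0 \<in> interior (F 0)\<close> n F_at_multiple(1) by simp
qed

lemma zero_interior_F: "0 \<in> interior (F \<tau>)"
  using zero_interior by (rule interior_slice)

section \<open>Functionals bounded above on a fibre, and the unstable space\<close>

lemma X_power: "((*v) (X T 0) ^^ j) x = X (real j * T) 0 *v x"
proof (induction j)
  case (Suc j)
  have "X (real (Suc j) * T) (real j * T) = X T 0"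
    using X_shift[of T "int j" 0] by (simp add: algebra_simps)
  then show ?case
    using Suc X_cocycle_vec[of "real (Suc j) * T" "real j * T" 0 x] by simp
qed (simp add: X_refl)

text \<open>The point y is reached at some time mT. A control that produces g, started at mT, adds g
  to the freely transported y.\<close>

lemma F_0_absorbs:
  assumes "y \<in> F 0" "g \<in> R (real k * T)"
  shows "X (real k * T) 0 *v y + g \<in> F 0"
proof -
  obtain n :: int where n: "0 \<le> of_int n * T" "y \<in> R (of_int n * T)"
    using FE[OF assms(1)] by auto
  define m where "m = nat n"
  have m: "of_int n = real m"
    using n(1) T_pos by (simp add: m_def zero_le_mult_iff)
  have "X (real k * T + real m * T) (real m * T) = X (real k * T) 0"
    using X_shift[of "real k * T" "int m" 0] by simp
  then have "X (real k * T) 0 *v y + g \<in> R (real k * T + real m * T)"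
    using R_split[of "real k * T" m] n(2) assms(2) T_pos m by (auto simp: set_plus_def)
  then show ?thesis
    using T_pos by (intro FI[where n="int k + int m"]) (auto simp: algebra_simps)
qed

text \<open>The support numbers \<open>h j = sup {p \<bullet> M\<^sup>j y | y \<in> F 0}\<close> of the monodromy matrix \<open>M\<close> decrease in \<open>j\<close>.
  Since \<open>F 0\<close> absorbs a ball every \<open>k\<close> periods, their decrements dominate \<open>p \<bullet> M\<^sup>j x\<close>.\<close>

lemma bounded_functional_decays:
  assumes p: "\<And>y. y \<in> F 0 \<Longrightarrow> p \<bullet> y \<le> c"
  shows "(\<lambda>j. p \<bullet> ((*v) (X T 0) ^^ j) x) \<longlonglongrightarrow> 0"
proof -
  let ?M = "\<lambda>j. X (real j * T) 0"
  define h where "h = (\<lambda>j. SUP y\<in>F 0. p \<bullet> (?M j *v y))"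
  obtain k where "0 \<in> interior (R (real k * T))"
    using R_interior by blast
  then obtain d where d: "d > 0" "ball 0 d \<subseteq> R (real k * T)"
    by (auto simp: mem_interior)
  define e where "e = d / (norm x + 1)"
  have "e > 0" using d by (simp add: e_def add_nonneg_pos)
  have "norm (e *\<^sub>R x) < d"
    using d(1) by (simp add: e_def divide_simps add_nonneg_pos)
  then have ex: "e *\<^sub>R x \<in> R (real k * T)" "- (e *\<^sub>R x) \<in> R (real k * T)"
    using d(2) by (auto simp: subset_iff)
  have M_F: "?M j *v y \<in> F 0" if "y \<in> F 0" for j y
    using F_0_absorbs[OF that zero_in_R[of "real j * T"]] T_pos by simp
  have bdd: "bdd_above ((\<lambda>y. p \<bullet> (?M j *v y)) ` F 0)" for j
    by (rule bdd_aboveI2[of _ _ c]) (rule p[OF M_F])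
  have F0: "0 \<in> F 0"
    using zero_interior_F interior_subset by blast
  have M_add: "?M (j + i) *v y = ?M j *v (?M i *v y)" for i j y
    by (simp only: X_power[symmetric] funpow_add o_def)
  \<comment> \<open>With y in \<open>F 0\<close>, both M^k y + e x and M^k y - e x lie in
    \<open>F 0\<close>, so h j bounds the functional after M^j at both; the worse sign yields the
    absolute value.\<close>
  have dec: "h (j + k) + e * \<bar>p \<bullet> (?M j *v x)\<bar> \<le> h j" for j
  proof -
    have "(SUP y\<in>F 0. p \<bullet> (?M (j + k) *v y)) \<le> h j - e * \<bar>p \<bullet> (?M j *v x)\<bar>"
    proof (rule cSUP_least)
      fix y assume y: "y \<in> F 0"
      have "p \<bullet> (?M j *v (?M k *v y + g)) \<le> h j" if "g \<in> R (real k * T)" for g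
        unfolding h_def using F_0_absorbs[OF y that] by (intro cSUP_upper bdd)
      from this[OF ex(1)] this[OF ex(2)]
      have "p \<bullet> (?M (j + k) *v y) + e * (p \<bullet> (?M j *v x)) \<le> h j" "p \<bullet> (?M (j + k) *v y) - e * (p \<bullet> (?M j *v x)) \<le> h j"
        unfolding M_add by (simp_all add: matrix_vector_right_distrib matrix_vector_mult_diff_distrib
            matrix_vector_mult_scaleR inner_add_right inner_diff_right flip: diff_conv_add_uminus)
      then show "p \<bullet> (?M (j + k) *v y) \<le> h j - e * \<bar>p \<bullet> (?M j *v x)\<bar>"
        by (auto simp: abs_if)
    qed (use F0 in auto)
    then show ?thesis by (simp add: h_def)
  qed
  have "h (Suc j) \<le> h j" for j
    unfolding h_def
  proof (rule cSUP_least)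
    fix y assume "y \<in> F 0"
    from cSUP_upper[OF M_F[OF this, of 1] bdd, of j]
    show "p \<bullet> (?M (Suc j) *v y) \<le> (SUP y\<in>F 0. p \<bullet> (?M j *v y))"
      by (simp only: Suc_eq_plus1 M_add)
  qed (use F0 in auto)
  then have "decseq h" by (simp add: decseq_SucI)
  moreover have "0 \<le> h j" for j
    unfolding h_def using cSUP_upper[OF F0 bdd, of j] by simp
  ultimately obtain l where l: "h \<longlonglongrightarrow> l"
    using decseq_convergent by blast
  then have lim: "(\<lambda>j. (h j - h (j + k)) / e) \<longlonglongrightarrow> (l - l) / e"
    by (intro tendsto_intros LIMSEQ_ignore_initial_segment) (use \<open>e > 0\<close> in auto)
  have "\<forall>j. norm (p \<bullet> (?M j *v x)) \<le> (h j - h (j + k)) / e"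
    using dec \<open>e > 0\<close> by (simp add: field_simps)
  then have "(\<lambda>j. p \<bullet> (?M j *v x)) \<longlonglongrightarrow> 0"
    by (rule Lim_null_comparison[OF always_eventually]) (use lim in simp)
  then show ?thesis by (simp add: X_power)
qed

lemma unstable_subset_F_0: "unstable 0 \<subseteq> F 0"
proof
  fix x assume x: "x \<in> unstable 0"
  \<comment> \<open>Separation only reaches the closure. Doubling x and shrinking back halfway
    towards the interior point 0 puts x itself into \<open>F 0\<close>.\<close>
  have "2 *\<^sub>R x \<in> closure (F 0)"
  proof (rule ccontr)
    assume "2 *\<^sub>R x \<notin> closure (F 0)"
    then obtain p b where pb: "p \<bullet> (2 *\<^sub>R x) < b" "\<And>y. y \<in> closure (F 0) \<Longrightarrow> b < p \<bullet> y"
      using separating_hyperplane_closed_point[of "closure (F 0)" "2 *\<^sub>R x"] convex_F convex_closure by blast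
    have "- p \<bullet> y \<le> - b" if "y \<in> F 0" for y
      using pb(2)[of y] that closure_subset by fastforce
    then have "- p \<bullet> x = 0"
      using x by (intro orthogonal_unstable[OF bounded_functional_decays[where c = "- b"]]) (auto simp: unstable_def)
    moreover have "0 \<in> closure (F 0)"
      using zero_interior_F interior_subset closure_subset by blast
    then have "b < 0" using pb(2) by fastforce
    ultimately show False using pb(1) by simp
  qed
  from mem_interior_closure_convex_shrink[OF convex_F zero_interior_F this, of "1/2"]
  have "2 *\<^sub>R x - x \<in> interior (F 0)" by simp
  then show "x \<in> F 0"
    using interior_subset by (auto simp: scaleR_2)
qed

section \<open>Transport of spectral spaces and decomposition of the fibres\<close>

lemma spectral_space_flow:
  assumes "v \<in> spectral_space (X (T + \<sigma>) \<sigma>) S"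
  shows "X \<tau> \<sigma> *v v \<in> spectral_space (X (T + \<tau>) \<tau>) S"
proof (rule spectral_space_intertwine[OF _ assms])
  have "X \<tau> \<sigma> = X (T + \<tau>) (T + \<sigma>)"
    using X_periodic[of \<tau> \<sigma>] by (simp add: add.commute)
  then have "X \<tau> \<sigma> ** X (T + \<sigma>) \<sigma> = X (T + \<tau>) \<sigma>"
    by (simp only: X_cocycle)
  then show "X (T + \<tau>) \<tau> ** X \<tau> \<sigma> = X \<tau> \<sigma> ** X (T + \<sigma>) \<sigma>"
    by (simp only: X_cocycle)
qed

lemma unstable_subset_F: "unstable \<tau> \<subseteq> F \<tau>"
proof
  fix v assume v: "v \<in> unstable \<tau>"
  obtain n :: nat where n: "- real n * T < \<tau>" by (rule period_below)
  let ?\<sigma> = "- real n * T"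
  have "X ?\<sigma> \<tau> *v v \<in> spectral_space (X (T + ?\<sigma>) ?\<sigma>) {\<mu>. cmod \<mu> \<ge> 1}"
    using v unfolding unstable_def by (rule spectral_space_flow)
  then have "X ?\<sigma> \<tau> *v v \<in> unstable 0"
    unfolding F_at_multiple unstable_def by simp
  then have "X ?\<sigma> \<tau> *v v \<in> F ?\<sigma>"
    unfolding F_at_multiple using unstable_subset_F_0 by blast
  from F_flow[OF this, of \<tau>] n show "v \<in> F \<tau>" by simp
qed

lemma interior_F_add_unstable:
  assumes "x \<in> interior (F \<tau>)" "v \<in> unstable \<tau>"
  shows "x + v \<in> interior (F \<tau>)"
proof -
  have "subspace (unstable \<tau>)"
    unfolding unstable_def by (rule subspace_spectral_space)
  from interior_convex_add_subspace[OF convex_F this unstable_subset_F assms] show ?thesis .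
qed

lemma interior_decompose:
  assumes x: "x \<in> interior (F \<tau>)"
  obtains y z where "y \<in> interior (F \<tau>) \<inter> stable \<tau>" "z \<in> unstable \<tau>" "x = y + z"
proof -
  obtain y z where yz: "y \<in> stable \<tau>" "z \<in> unstable \<tau>" "x = y + z"
    unfolding stable_def unstable_def by (rule spectral_space_decompose)
  have "- z \<in> unstable \<tau>"
    using yz(2) subspace_neg[OF subspace_spectral_space] by (simp add: unstable_def)
  from interior_F_add_unstable[OF x this] yz show ?thesis
    by (intro that[of y z]) auto
qed

text \<open>Start at \<sigma> = \<tau> - nT, where the fibre is the same, from x plus v pulled back
  to \<sigma>. The pullback is again unstable, so the starting point is interior. The flow then
  restores v, while x is multiplied by the period map over n periods.\<close>

lemma interior_flow_period:
  assumes x: "x \<in> interior (F \<tau>)" and v: "v \<in> unstable \<tau>" and "n > 0"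
  shows "(\<tau>, X (real n * T + \<tau>) \<tau> *v x + v) \<in> interior {(t, x). x \<in> F t}"
proof -
  define \<sigma> where "\<sigma> = \<tau> - real n * T"
  have \<sigma>: "F \<sigma> = F \<tau>" "\<sigma> < \<tau>" "X \<tau> \<sigma> = X (real n * T + \<tau>) \<tau>" "X (T + \<sigma>) \<sigma> = X (T + \<tau>) \<tau>"
    using F_periodic[of \<tau> "- int n"] X_shift[of "real n * T + \<tau>" "- int n" \<tau>] X_shift[of "T + \<tau>" "- int n" \<tau>]
      T_pos \<open>n > 0\<close> by (auto simp: \<sigma>_def algebra_simps)
  have "X \<sigma> \<tau> *v v \<in> unstable \<tau>"
    using spectral_space_flow[of v \<tau> _ \<sigma>] v \<sigma>(4) by (simp add: unstable_def)
  then have "x + X \<sigma> \<tau> *v v \<in> interior (F \<sigma>)"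
    using interior_F_add_unstable[OF x] \<sigma>(1) by simp
  from interior_flow[OF this \<sigma>(2)] show ?thesis
    by (simp add: matrix_vector_right_distrib flip: \<sigma>(3))
qed

section \<open>Boundedness of the stable part\<close>

lemma functional_bound_R:
  assumes b: "\<And>g. g \<in> R T \<Longrightarrow> norm g \<le> b" and "b \<ge> 0" and "x \<in> R (real k * T)"
  shows "p \<bullet> x \<le> b * (\<Sum>j<k. norm (((*v) (transpose (X T 0)) ^^ j) p))"
  using assms(3)
proof (induction k arbitrary: p x)
  case 0
  then show ?case by (simp add: R_at_0)
next
  case (Suc k)
  let ?N = "transpose (X T 0)"
  have eq: "X (T + real k * T) (real k * T) = X T 0"
    using X_shift[of T "int k" 0] by simp
  have "x \<in> R (T + real k * T)"
    using Suc.prems by (simp add: algebra_simps)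
  then obtain y g where yg: "y \<in> R (real k * T)" "g \<in> R T" "x = X T 0 *v y + g"
    using R_split[of T k] T_pos unfolding eq by (auto simp: set_plus_def)
  \<comment> \<open>The last period contributes g. What was reached before is transported by M,
    which moves to the functional as the transpose; hence the induction runs over arbitrary
    p.\<close>
  have "p \<bullet> x = (?N *v p) \<bullet> y + p \<bullet> g"
    by (simp add: yg inner_add_right inner_matrix_vector)
  also have "\<dots> \<le> b * (\<Sum>j<k. norm (((*v) ?N ^^ j) (?N *v p))) + b * norm p"
  proof (rule add_mono)
    have "p \<bullet> g \<le> norm p * norm g" by (rule norm_cauchy_schwarz)
    also have "\<dots> \<le> b * norm p"
      using b[OF yg(2)] by (metis mult.commute mult_left_mono norm_ge_zero)
    finally show "p \<bullet> g \<le> b * norm p" .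
  qed (rule Suc.IH[OF yg(1)])
  also have "\<dots> = b * (\<Sum>j<Suc k. norm (((*v) ?N ^^ j) p))"
    by (simp only: sum.lessThan_Suc_shift funpow_Suc_right o_apply funpow_0 distrib_left add.commute)
  finally show ?case .
qed

lemma functional_bound_F_0: "\<exists>c. \<forall>x\<in>F 0 \<inter> stable 0. p \<bullet> x \<le> c"
proof -
  let ?M = "X T 0" and ?N = "transpose (X T 0)"
  obtain p1 p2 where p: "p1 \<in> spectral_space ?N {\<mu>. cmod \<mu> < 1}" "p2 \<in> spectral_space ?N {\<mu>. cmod \<mu> \<ge> 1}" "p = p1 + p2"
    by (rule spectral_space_decompose)
  obtain b where b: "\<And>g. g \<in> R T \<Longrightarrow> norm g \<le> b"
    using R_bounded by (auto simp: bounded_iff)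
  have "b \<ge> 0" using b[OF zero_in_R] T_pos by force
  let ?s = "\<lambda>j. norm (((*v) ?N ^^ j) p1)"
  have "p \<bullet> x \<le> b * suminf ?s" if x: "x \<in> F 0" "x \<in> stable 0" for x
  proof -
    \<comment> \<open>Duality: x itself serves as the functional. As M^j x tends to 0, so does the
      product of x with N^j z for every z. Hence x annihilates the unstable space of N, which
      contains p2.\<close>
    have "x \<bullet> p2 = 0"
    proof (rule orthogonal_unstable[OF _ p(2)])
      fix z
      have "summable (\<lambda>j. norm (((*v) ?M ^^ j) x))"
        using x(2) by (intro summable_stable_powers) (simp add: stable_def)
      then have "(\<lambda>j. ((*v) ?M ^^ j) x) \<longlonglongrightarrow> 0"
        using summable_LIMSEQ_zero tendsto_norm_zero_iff by blast
      then have "(\<lambda>j. z \<bullet> ((*v) ?M ^^ j) x) \<longlonglongrightarrow> z \<bullet> 0"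
        by (intro tendsto_intros)
      moreover have "z \<bullet> ((*v) ?M ^^ j) x = x \<bullet> ((*v) ?N ^^ j) z" for j
        by (subst (2) inner_commute) (rule inner_funpow_transpose)
      ultimately show "(\<lambda>j. x \<bullet> ((*v) ?N ^^ j) z) \<longlonglongrightarrow> 0"
        by simp
    qed
    moreover have "p1 \<bullet> x \<le> b * suminf ?s"
    proof -
      obtain n :: int where n: "0 \<le> of_int n * T" "x \<in> R (of_int n * T)"
        using FE[OF x(1)] by auto
      have "of_int n = real (nat n)"
        using n(1) T_pos by (simp add: zero_le_mult_iff)
      with n(2) have "x \<in> R (real (nat n) * T)"
        by (simp only:)
      then have "p1 \<bullet> x \<le> b * (\<Sum>j<nat n. ?s j)"
        using functional_bound_R[OF _ \<open>b \<ge> 0\<close>] b by blast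
      also have "\<dots> \<le> b * suminf ?s"
        using \<open>b \<ge> 0\<close> by (intro mult_left_mono sum_le_suminf summable_stable_powers p(1)) auto
      finally show ?thesis .
    qed
    ultimately show ?thesis
      by (simp add: p(3) inner_add_left inner_commute[of p2])
  qed
  then show ?thesis by blast
qed

text \<open>Over 0, the functionals i and -i for basis vectors i bound all coordinates. A point over
  \<tau> is carried forward to T, where fibre and stable space are those of 0; pulling it back costs
  a factor that is bounded on the compact interval. Negative \<tau> are needed for reversed
  time.\<close>

lemma bounded_F_stable: "\<exists>C. \<forall>\<tau>\<in>{-T..T}. \<forall>x\<in>F \<tau> \<inter> stable \<tau>. norm x \<le> C"
proof -
  obtain c where c: "\<And>p x. x \<in> F 0 \<inter> stable 0 \<Longrightarrow> p \<bullet> x \<le> c p"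
    using functional_bound_F_0 by metis
  define C0 where "C0 = (\<Sum>i\<in>(Basis :: (real^'d) set). max (c i) (c (- i)))"
  have C0: "norm x \<le> C0" if "x \<in> F 0 \<inter> stable 0" for x
  proof -
    have "norm x \<le> (\<Sum>i\<in>Basis. \<bar>x \<bullet> i\<bar>)" by (rule norm_le_l1)
    also have "\<dots> \<le> C0"
      unfolding C0_def
    proof (rule sum_mono)
      fix i :: "real^'d"
      show "\<bar>x \<bullet> i\<bar> \<le> max (c i) (c (- i))"
        using c[OF that, of i] c[OF that, of "- i"] unfolding inner_minus_left inner_commute[of i] by linarith
    qed
    finally show ?thesis .
  qed
  obtain K where K: "K \<ge> 0" "\<And>(a :: real^'d^'d) b. norm (a *v b) \<le> norm a * norm b * K"
    using bounded_bilinear.nonneg_bounded[OF bounded_bilinear_matrix_vector_mult] by blast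
  have "compact ((\<lambda>t. X t 0) ` {-T..T})"
    by (intro compact_continuous_image continuous_on_subset[OF X_continuous(2)]) auto
  from compact_imp_bounded[OF this]
  obtain b where b: "\<And>t. t \<in> {-T..T} \<Longrightarrow> norm (X t 0) \<le> b"
    unfolding bounded_iff by blast
  have F_T: "F T = F 0" "stable T = stable 0"
    using F_periodic[of 0 1] X_periodic[of T 0] by (simp_all add: stable_def)
  show ?thesis
  proof (intro exI ballI)
    fix \<tau> x assume \<tau>: "\<tau> \<in> {-T..T}" and x: "x \<in> F \<tau> \<inter> stable \<tau>"
    let ?y = "X T \<tau> *v x"
    have "?y \<in> F 0 \<inter> stable 0"
      using F_flow[of x \<tau> T] spectral_space_flow[of x \<tau> _ T] x \<tau> F_T by (auto simp: stable_def)
    then have y: "norm ?y \<le> C0" by (rule C0)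
    have "norm x = norm (X \<tau> 0 *v (X 0 T *v ?y))"
      by (simp add: X_cocycle_vec X_refl)
    also have "\<dots> \<le> norm (X \<tau> 0) * norm (X 0 T *v ?y) * K"
      by (rule K)
    also have "\<dots> \<le> b * (norm (X 0 T) * C0 * K) * K"
    proof -
      have "norm (X 0 T *v ?y) \<le> norm (X 0 T) * norm ?y * K" by (rule K)
      also have "\<dots> \<le> norm (X 0 T) * C0 * K"
        using y K(1) by (intro mult_right_mono mult_left_mono) auto
      finally have "norm (X 0 T *v ?y) \<le> norm (X 0 T) * C0 * K" .
      moreover have "0 \<le> b"
        using b[OF \<tau>] norm_ge_zero order.trans by blast
      ultimately show ?thesis
        using b[OF \<tau>] K(1) by (intro mult_right_mono mult_mono) auto
    qed
    finally show "norm x \<le> b * (norm (X 0 T) * C0 * K) * K" .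
  qed
qed

end

section \<open>Interiors in the phase space\<close>

lemma rmod_decompose: "T > 0 \<Longrightarrow> \<exists>n::int. t = t rmod T + of_int n * T"
  by (intro exI[of _ "\<lfloor>t / T\<rfloor>"]) (simp add: rmod_def)

lemma rmod_eqI: "T > 0 \<Longrightarrow> s \<in> {0..<T} \<Longrightarrow> t = s + of_int n * T \<Longrightarrow> t rmod T = s"
  by (rule rmod_unique) auto

text \<open>A box A x B over the line yields one over the circle: the projection V of A is open
  because its preimage is the union of the translates of A by multiples of T, and periodicity of
  \<open>F\<close> identifies the fibres.\<close>

lemma interior_phase_spaceI:
  assumes "T > 0" and periodic: "\<And>t n. F (t + of_int n * T) = F t"
    and \<tau>: "\<tau> \<in> {0..<T}" and x: "(\<tau>, x) \<in> interior {(t, x). x \<in> F t}"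
  shows "(\<tau>, x) \<in> phase_space T interior_of (SIGMA t:{0..<T}. F t)"
proof -
  obtain A B where AB: "open A" "open B" "(\<tau>, x) \<in> A \<times> B" "A \<times> B \<subseteq> interior {(t, x). x \<in> F t}"
    using open_prod_elim[OF open_interior x] by blast
  define V where "V = (\<lambda>t. t rmod T) ` A"
  have "{t. t rmod T \<in> V} = (\<Union>n::int. (+) (of_int n * T) ` A)"
  proof (intro equalityI subsetI)
    fix t assume "t \<in> {t. t rmod T \<in> V}"
    then obtain a where a: "a \<in> A" "t rmod T = a rmod T" by (auto simp: V_def)
    obtain n m :: int where "t = t rmod T + of_int n * T" "a = a rmod T + of_int m * T"
      using rmod_decompose[OF \<open>T > 0\<close>] by meson
    then have "t = of_int (n - m) * T + a"
      using a(2) by (simp add: algebra_simps)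
    then show "t \<in> (\<Union>n::int. (+) (of_int n * T) ` A)"
      using a(1) by blast
  next
    fix t assume "t \<in> (\<Union>n::int. (+) (of_int n * T) ` A)"
    then obtain n :: int and a where a: "a \<in> A" "t = of_int n * T + a" by auto
    obtain m :: int where "a = a rmod T + of_int m * T"
      using rmod_decompose[OF \<open>T > 0\<close>] by meson
    then have "t = a rmod T + of_int (n + m) * T"
      unfolding a(2) by (metis add.left_commute add.commute of_int_add distrib_right)
    then have "t rmod T = a rmod T"
      using \<open>T > 0\<close> by (intro rmod_eqI[where n="n + m"]) (auto simp: rmod_nonneg rmod_less)
    then show "t \<in> {t. t rmod T \<in> V}"
      using a(1) by (simp add: V_def)
  qed
  then have "open {t. t rmod T \<in> V}"
    using AB(1) by (auto intro: open_translation)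
  then have "openin (circle T) V"
    using \<open>T > 0\<close> by (auto simp: openin_circle V_def rmod_nonneg rmod_less)
  then have "openin (phase_space T) (V \<times> B)"
    using AB(2) by (simp add: openin_prod_Times_iff)
  moreover have "V \<times> B \<subseteq> (SIGMA t:{0..<T}. F t)"
  proof safe
    fix t y assume "t \<in> V" "y \<in> B"
    then obtain a where a: "a \<in> A" "t = a rmod T" by (auto simp: V_def)
    then have "y \<in> F a"
      using AB(4) \<open>y \<in> B\<close> interior_subset by blast
    moreover obtain m :: int where "a = t + of_int m * T"
      using rmod_decompose[OF \<open>T > 0\<close>] a(2) by meson
    ultimately show "y \<in> F t"
      using periodic by simp
    show "t \<in> {0..<T}"
      using \<open>T > 0\<close> by (simp add: a rmod_nonneg rmod_less)
  qed
  moreover have "\<tau> rmod T = \<tau>"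
    using \<open>T > 0\<close> \<tau> by (intro rmod_eqI[where n=0]) auto
  then have "\<tau> \<in> V"
    using AB(3) by (force simp: V_def)
  then have "(\<tau>, x) \<in> V \<times> B"
    using AB(3) by simp
  ultimately show ?thesis
    by (meson interior_of_maximal subsetD)
qed

text \<open>Only the interior of the fibre is extracted, which is all that the outer inclusion
  uses.\<close>

lemma interior_phase_spaceD:
  assumes "(\<tau>, x) \<in> phase_space T interior_of (SIGMA t:{0..<T}. F t)"
  shows "\<tau> \<in> {0..<T}" "x \<in> interior (F \<tau>)"
proof -
  obtain W where W: "openin (phase_space T) W" "(\<tau>, x) \<in> W" "W \<subseteq> (SIGMA t:{0..<T}. F t)"
    using assms by (auto simp: interior_of_def)
  have "\<forall>t y. (t, y) \<in> W \<longrightarrow>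
      (\<exists>V B. openin (circle T) V \<and> openin euclidean B \<and> t \<in> V \<and> y \<in> B \<and> V \<times> B \<subseteq> W)"
    using W(1) by (rule openin_prod_topology_alt[THEN iffD1])
  then have "\<exists>V B. openin (circle T) V \<and> openin euclidean B \<and> \<tau> \<in> V \<and> x \<in> B \<and> V \<times> B \<subseteq> W"
    using W(2) by (elim allE impE) assumption+
  then obtain V B where VB: "openin (circle T) V" "open B" "\<tau> \<in> V" "x \<in> B" "V \<times> B \<subseteq> W"
    by (elim exE conjE) (simp only: open_openin)
  have "B \<subseteq> F \<tau>"
    using VB W(3) by blast
  then show "x \<in> interior (F \<tau>)"
    using VB by (intro interiorI[of B]) auto
  show "\<tau> \<in> {0..<T}"
    using W by blast
qed

lemma interior_scale_time:
  fixes F :: "real \<Rightarrow> 'a::euclidean_space set"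
  assumes "(e * \<tau>, x) \<in> interior {(t, x). x \<in> F t}"
  shows "(\<tau>, x) \<in> interior {(t, x). x \<in> F (e * t)}"
proof (rule interiorI)
  let ?f = "\<lambda>p :: real \<times> 'a. (e * fst p, snd p)"
  show "open (?f -` interior {(t, x). x \<in> F t})"
    by (intro open_vimage continuous_intros) auto
  show "(\<tau>, x) \<in> ?f -` interior {(t, x). x \<in> F t}"
    using assms by simp
  show "?f -` interior {(t, x). x \<in> F t} \<subseteq> {(t, x). x \<in> F (e * t)}"
    using interior_subset by fastforce
qed

context periodic_reach
begin

text \<open>The factor \<open>e = -1\<close> serves the controllable sets, which are reachable sets in reversed time.\<close>

lemma bundle_inclusions:
  fixes e :: real and P
  assumes e: "e = 1 \<or> e = -1" and P: "P = (SIGMA \<tau>:{0..<T}. F (e * \<tau>))" and n: "n > 0"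
    and Y: "\<And>\<tau>. Y \<tau> = X (real n * T + e * \<tau>) (e * \<tau>)"
    and K: "\<And>\<tau>. \<tau> \<in> {0..<T} \<Longrightarrow> K \<tau> = interior (F (e * \<tau>)) \<inter> stable (e * \<tau>)"
    and E: "\<And>\<tau>. E \<tau> = unstable (e * \<tau>)"
  shows "{0..<T} \<times> {0} \<subseteq> phase_space T interior_of P"
    and "Y \<cdot>\<^sub>f bundle_over T K \<oplus>\<^sub>f bundle_over T E \<subseteq> phase_space T interior_of P"
    and "phase_space T interior_of P \<subseteq> bundle_over T K \<oplus>\<^sub>f bundle_over T E"
    and "\<forall>\<tau>\<in>{0..<T}. convex (K \<tau>)"
    and "\<exists>C. \<forall>\<tau>\<in>{0..<T}. \<forall>x\<in>K \<tau>. norm x \<le> C"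
proof -
  have periodic: "F (e * (t + of_int n * T)) = F (e * t)" for t and n :: int
    using e F_periodic[of t n] F_periodic[of "- t" "- n"] by (auto simp: algebra_simps)
  have interior: "(\<tau>, x) \<in> phase_space T interior_of P"
    if "\<tau> \<in> {0..<T}" "(e * \<tau>, x) \<in> interior {(t, x). x \<in> F t}" for \<tau> x
    unfolding P using that by (intro interior_phase_spaceI T_pos periodic interior_scale_time)
  show "{0..<T} \<times> {0} \<subseteq> phase_space T interior_of P"
    using interior zero_interior by blast
  show "Y \<cdot>\<^sub>f bundle_over T K \<oplus>\<^sub>f bundle_over T E \<subseteq> phase_space T interior_of P"
  proof
    fix p assume "p \<in> Y \<cdot>\<^sub>f bundle_over T K \<oplus>\<^sub>f bundle_over T E"
    then obtain \<tau> x v where p: "p = (\<tau>, Y \<tau> *v x + v)" "\<tau> \<in> {0..<T}" "x \<in> K \<tau>" "v \<in> E \<tau>"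
      by (auto simp: fibre_sum_def fibre_image_def bundle_over_def)
    then have "x \<in> interior (F (e * \<tau>))" "v \<in> unstable (e * \<tau>)"
      using K E by auto
    then show "p \<in> phase_space T interior_of P"
      unfolding p(1) Y by (intro interior p(2) interior_flow_period n)
  qed
  show "phase_space T interior_of P \<subseteq> bundle_over T K \<oplus>\<^sub>f bundle_over T E"
  proof
    fix p assume p: "p \<in> phase_space T interior_of P"
    obtain \<tau> x where [simp]: "p = (\<tau>, x)" by (cases p)
    have \<tau>: "\<tau> \<in> {0..<T}" and x: "x \<in> interior (F (e * \<tau>))"
      using interior_phase_spaceD[of \<tau> x T "\<lambda>\<tau>. F (e * \<tau>)"] p by (simp_all add: P)
    obtain y z where "y \<in> interior (F (e * \<tau>)) \<inter> stable (e * \<tau>)" "z \<in> unstable (e * \<tau>)" "x = y + z"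
      using x by (rule interior_decompose)
    then show "p \<in> bundle_over T K \<oplus>\<^sub>f bundle_over T E"
      using \<tau> K E by (auto simp: fibre_sum_def bundle_over_def)
  qed
  have "convex (interior (F (e * \<tau>)) \<inter> stable (e * \<tau>))" for \<tau>
    using convex_interior[OF convex_F] subspace_imp_convex[OF subspace_spectral_space]
    unfolding stable_def by (rule convex_Int)
  then show "\<forall>\<tau>\<in>{0..<T}. convex (K \<tau>)"
    using K by simp
  obtain C where C: "\<And>\<tau> x. \<tau> \<in> {-T..T} \<Longrightarrow> x \<in> F \<tau> \<inter> stable \<tau> \<Longrightarrow> norm x \<le> C"
    using bounded_F_stable by blast
  have "norm x \<le> C" if \<tau>: "\<tau> \<in> {0..<T}" and x: "x \<in> K \<tau>" for \<tau> x
  proof (rule C)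
    show "e * \<tau> \<in> {-T..T}"
      using e \<tau> by auto
    show "x \<in> F (e * \<tau>) \<inter> stable (e * \<tau>)"
      using x K[OF \<tau>] interior_subset by blast
  qed
  then show "\<exists>C. \<forall>\<tau>\<in>{0..<T}. \<forall>x\<in>K \<tau>. norm x \<le> C"
    by blast
qed

end

lemma fibre_sum_commute: "K \<oplus>\<^sub>f L = L \<oplus>\<^sub>f K"
proof -
  have "K \<oplus>\<^sub>f L \<subseteq> L \<oplus>\<^sub>f K" for K L :: "(real \<times> (real^'d)) set"
  proof
    fix p assume "p \<in> K \<oplus>\<^sub>f L"
    then obtain \<tau> x y where "p = (\<tau>, y + x)" "(\<tau>, x) \<in> K" "(\<tau>, y) \<in> L"
      by (auto simp: fibre_sum_def add.commute)
    then show "p \<in> L \<oplus>\<^sub>f K"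
      unfolding fibre_sum_def by blast
  qed
  then show ?thesis by blast
qed

section \<open>The linear control system\<close>

lemma AE_lebesgue_shift:
  fixes c :: real
  assumes "AE s in lebesgue. P s"
  shows "AE s in lebesgue. P (s + c)"
proof -
  obtain N where N: "negligible N" "\<And>s. s \<notin> N \<Longrightarrow> P s"
    using assms by (rule AE_lebesgueE) blast
  have "(+) (- c) ` N \<in> null_sets lebesgue"
    unfolding negligible_iff_null_sets[symmetric] by (rule negligible_translation[OF N(1)])
  moreover have "{s. \<not> P (s + c)} \<subseteq> (+) (- c) ` N"
    using N(2) by (force simp: image_iff intro: bexI[of _ "_ + c"])
  ultimately show ?thesis
    by (intro AE_I') auto
qed

lemma Linf_shift:
  fixes f :: "real \<Rightarrow> 'a::euclidean_space"
  assumes "f \<in> Linf UNIV"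
  shows "(\<lambda>s. f (s + c)) \<in> Linf UNIV"
proof -
  obtain C where C: "AE t in lebesgue. norm (f t) \<le> C"
    using assms by (auto simp: Linf_UNIV_iff)
  have "{s. f (s + c) \<in> B} \<in> sets lebesgue" if "B \<in> sets borel" for B
  proof -
    have "{s. f s \<in> B} \<in> sets lebesgue"
      using assms that by (simp add: Linf_UNIV_iff borel_measurable_lebesgue_preimage_borel)
    then have "(+) (- c) ` {s. f s \<in> B} \<in> sets lebesgue"
      by (rule lebesgue_sets_translation)
    also have "(+) (- c) ` {s. f s \<in> B} = {s. f (s + c) \<in> B}"
      by (force simp: image_iff intro: exI[of _ "_ + c"])
    finally show ?thesis .
  qed
  then show ?thesis
    using AE_lebesgue_shift[OF C, of c] by (auto simp: Linf_UNIV_iff borel_measurable_lebesgue_preimage_borel)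
qed

lemma Linf_const: "(\<lambda>s. c) \<in> Linf UNIV"
  unfolding Linf_UNIV_iff by (intro conjI exI[of _ "norm c"]) auto

lemma Linf_add:
  fixes f g :: "real \<Rightarrow> 'a::euclidean_space"
  assumes "f \<in> Linf UNIV" "g \<in> Linf UNIV"
  shows "(\<lambda>s. f s + g s) \<in> Linf UNIV"
proof -
  obtain C D where "AE t in lebesgue. norm (f t) \<le> C" "AE t in lebesgue. norm (g t) \<le> D"
    using assms by (auto simp: Linf_UNIV_iff)
  then have "AE t in lebesgue. norm (f t + g t) \<le> C + D"
    by eventually_elim (rule norm_triangle_mono)
  then show ?thesis
    using assms by (auto simp: Linf_UNIV_iff)
qed

lemma Linf_bilinear:
  fixes prod :: "'a::euclidean_space \<Rightarrow> 'b::euclidean_space \<Rightarrow> 'c::euclidean_space"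
  assumes prod: "bounded_bilinear prod" and f: "f \<in> Linf UNIV" and g: "g \<in> Linf UNIV"
  shows "(\<lambda>s. prod (f s) (g s)) \<in> Linf UNIV"
proof -
  obtain K where K: "K \<ge> 0" "\<And>a b. norm (prod a b) \<le> norm a * norm b * K"
    using bounded_bilinear.nonneg_bounded[OF prod] by blast
  obtain C where C: "C > 0" "AE t in lebesgue. norm (f t) \<le> C"
    using f by (rule Linf_bound)
  obtain D where D: "D > 0" "AE t in lebesgue. norm (g t) \<le> D"
    using g by (rule Linf_bound)
  have "AE t in lebesgue. norm (prod (f t) (g t)) \<le> C * D * K"
    using C(2) D(2)
  proof eventually_elim
    case (elim t)
    have "norm (prod (f t) (g t)) \<le> norm (f t) * norm (g t) * K" by (rule K)
    also have "\<dots> \<le> C * D * K"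
      using elim C(1) K(1) by (intro mult_right_mono mult_mono) auto
    finally show ?case .
  qed
  moreover have "(\<lambda>s. prod (f s) (g s)) \<in> borel_measurable lebesgue"
  proof (rule borel_measurable_continuous_Pair[where H=prod])
    show "continuous_on UNIV (\<lambda>x. prod (fst x) (snd x))"
      by (intro bounded_bilinear.continuous_on[OF prod] continuous_intros)
  qed (use f g in \<open>simp_all add: Linf_UNIV_iff\<close>)
  ultimately show ?thesis
    unfolding Linf_UNIV_iff by blast
qed

lemma Linf_scaleR: "f \<in> Linf UNIV \<Longrightarrow> (\<lambda>s. c *\<^sub>R f s) \<in> Linf UNIV" for f :: "real \<Rightarrow> 'a::euclidean_space"
  using Linf_bilinear[OF bounded_bilinear_scaleR Linf_const] .

lemma Linf_If_interval:
  fixes f g :: "real \<Rightarrow> 'a::euclidean_space"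
  assumes f: "f \<in> Linf UNIV" and g: "g \<in> Linf UNIV"
  shows "(\<lambda>s. if s \<in> closed_segment a b then f s else g s) \<in> Linf UNIV"
proof -
  obtain C where C: "AE t in lebesgue. norm (f t) \<le> C"
    using f by (auto simp: Linf_UNIV_iff)
  obtain D where D: "AE t in lebesgue. norm (g t) \<le> D"
    using g by (auto simp: Linf_UNIV_iff)
  have "AE t in lebesgue. norm (if t \<in> closed_segment a b then f t else g t) \<le> max C D"
    using C D by eventually_elim auto
  moreover have "(\<lambda>s. if s \<in> closed_segment a b then f s else g s) \<in> borel_measurable lebesgue"
    using f g by (intro measurable_If_set) (auto simp: Linf_UNIV_iff closed_segment_eq_real_ivl)
  ultimately show ?thesis
    unfolding Linf_UNIV_iff by blast
qed

lemma Linf_interval_extend: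
  fixes u :: "real \<Rightarrow> 'a::euclidean_space"
  assumes "u \<in> Linf {a..b}"
  shows "(\<lambda>t. if t \<in> {a..b} then u t else 0) \<in> Linf UNIV"
proof -
  obtain C where C: "AE t in lebesgue_on {a..b}. norm (u t) \<le> C" and u: "u \<in> borel_measurable (lebesgue_on {a..b})"
    using assms by (auto simp: Linf_def)
  have "AE t in lebesgue. t \<in> {a..b} \<longrightarrow> norm (u t) \<le> C"
    using C by (simp add: AE_restrict_space_iff)
  then have "AE t in lebesgue. norm (if t \<in> {a..b} then u t else 0) \<le> max C 0"
    by eventually_elim auto
  moreover have "(\<lambda>t. if t \<in> {a..b} then u t else 0) \<in> borel_measurable lebesgue"
    using u by (rule borel_measurable_if_I) auto
  ultimately show ?thesis
    unfolding Linf_UNIV_iff by blast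
qed

lemma ae_periodic_int:
  assumes "ae_periodic T f"
  shows "AE s in lebesgue. f (s + of_int n * T) = f s"
proof -
  have nat: "AE s in lebesgue. f (s + real k * T) = f s" for k
  proof (induction k)
    case (Suc k)
    have "AE s in lebesgue. f (s + real k * T + T) = f (s + real k * T)"
      using assms AE_lebesgue_shift unfolding ae_periodic_def by blast
    with Suc show ?case
      by eventually_elim (simp add: algebra_simps)
  qed simp
  show ?thesis
  proof (cases n)
    case (nonneg k)
    then show ?thesis using nat by simp
  next
    case (neg k)
    then have "real_of_int n = - real (Suc k)" by simp
    then have n: "of_int n * T = - (real (Suc k) * T)"
      by (simp only: mult_minus_left)
    from AE_lebesgue_shift[OF nat[of "Suc k"], of "- (real (Suc k) * T)"] show ?thesis
      unfolding n by eventually_elim (simp add: eq_commute)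
  qed
qed

section \<open>Interior points of linear images and of convex sets\<close>

lemma interior_matrix_image:
  fixes P Q :: "real^'n^'n"
  assumes PQ: "\<And>x. P *v (Q *v x) = x" "\<And>x. Q *v (P *v x) = x" and z: "z \<in> interior S"
  shows "P *v z \<in> interior ((*v) P ` S)"
proof (rule interiorI)
  show "open ((*v) Q -` interior S)"
    by (intro open_vimage continuous_intros) auto
  show "P *v z \<in> (*v) Q -` interior S"
    using z PQ by simp
  show "(*v) Q -` interior S \<subseteq> (*v) P ` S"
    using PQ(1) interior_subset by (force intro: image_eqI[of _ _ "Q *v _"])
qed

text \<open>With n the dimension, x is the average over the basis of the axis points n (x \<bullet>
  b) b. For small x all of them lie on axis segments contained in S; \<open>e\<close> is the
  smallest of the given half-lengths.\<close>

lemma convex_axes_interior: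
  fixes S :: "'a::euclidean_space set"
  assumes S: "convex S" "0 \<in> S"
    and axes: "\<And>b. b \<in> Basis \<Longrightarrow> \<exists>\<delta>>0. \<delta> *\<^sub>R b \<in> S" "\<And>b. b \<in> Basis \<Longrightarrow> \<exists>\<delta>>0. - (\<delta> *\<^sub>R b) \<in> S"
  shows "0 \<in> interior S"
proof -
  obtain p where p: "\<And>b. b \<in> Basis \<Longrightarrow> p b > 0 \<and> p b *\<^sub>R b \<in> S"
    using axes(1) by metis
  obtain q where q: "\<And>b. b \<in> Basis \<Longrightarrow> q b > 0 \<and> - (q b *\<^sub>R b) \<in> S"
    using axes(2) by metis
  define e where "e = Min ((\<lambda>b. min (p b) (q b)) ` (Basis :: 'a set))"
  have "e > 0"
    using p q by (simp add: e_def)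
  moreover have "e \<le> min (p b) (q b)" if "b \<in> Basis" for b
    unfolding e_def using that by (intro Min_le) auto
  ultimately have e: "e > 0" "\<And>b. b \<in> Basis \<Longrightarrow> e \<le> p b \<and> e \<le> q b"
    by auto
  have scale: "c *\<^sub>R x \<in> S" if "x \<in> S" "0 \<le> c" "c \<le> 1" for c x
    using convexD[OF S(1) that(1) S(2), of c "1 - c"] that by simp
  have axis: "c *\<^sub>R b \<in> S" if "b \<in> Basis" "\<bar>c\<bar> \<le> e" for c b
  proof (cases "c \<ge> 0")
    case True
    then show ?thesis
      using scale[of "p b *\<^sub>R b" "c / p b"] p[OF that(1)] e(2)[OF that(1)] that(2) by simp
  next
    case False
    moreover have "q b > 0" "- (q b *\<^sub>R b) \<in> S" "- c \<le> q b"
      using q[OF that(1)] e(2)[OF that(1)] that(2) by auto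
    ultimately show ?thesis
      using scale[of "- (q b *\<^sub>R b)" "- c / q b"] by (simp add: divide_nonpos_pos pos_divide_le_eq pos_le_divide_eq)
  qed
  have "ball 0 (e / DIM('a)) \<subseteq> S"
  proof
    fix x :: 'a assume "x \<in> ball 0 (e / DIM('a))"
    then have x: "norm x * DIM('a) < e"
      by (simp add: pos_less_divide_eq)
    have "(\<Sum>b\<in>Basis. (1 / DIM('a)) *\<^sub>R ((DIM('a) * (x \<bullet> b)) *\<^sub>R b)) \<in> S"
    proof (rule convex_sum[OF _ S(1)])
      fix b :: 'a assume b: "b \<in> Basis"
      have "\<bar>DIM('a) * (x \<bullet> b)\<bar> \<le> norm x * DIM('a)"
        using Basis_le_norm[OF b, of x] by (simp add: abs_mult mult.commute mult_left_mono)
      with x show "(DIM('a) * (x \<bullet> b)) *\<^sub>R b \<in> S"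
        by (intro axis[OF b]) simp
    qed auto
    also have "(\<Sum>b\<in>Basis. (1 / DIM('a)) *\<^sub>R ((DIM('a) * (x \<bullet> b)) *\<^sub>R b)) = x"
      by (simp add: euclidean_representation)
    finally show "x \<in> S" .
  qed
  then show ?thesis
    using e(1) by (auto simp: mem_interior intro!: exI[of _ "e / DIM('a)"])
qed

section \<open>Trajectories and the fundamental solution\<close>

locale linear_system =
  fixes A :: "real \<Rightarrow> real^'d^'d" and B :: "real \<Rightarrow> real^'m^'d"
  assumes A_Linf: "A \<in> Linf UNIV" and B_Linf: "B \<in> Linf UNIV"
begin

interpretation vec: linf_bilinear "(*v)" A
  by (intro linf_bilinear.intro bounded_bilinear_matrix_vector_mult linf_bilinear_axioms.intro A_Linf)

interpretation mat: linf_bilinear "(**)" A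
  by (intro linf_bilinear.intro bounded_bilinear_matrix_matrix_mult linf_bilinear_axioms.intro A_Linf)

definition solution :: "(real \<Rightarrow> real^'m) \<Rightarrow> (real \<Rightarrow> real^'d) \<Rightarrow> bool" where
  "solution u x \<longleftrightarrow> abs_primitive (\<lambda>s. A s *v x s + B s *v u s) x"

lemma solution_eq:
  assumes "solution u x" "solution v y" "AE s in lebesgue. s \<in> closed_segment c t \<longrightarrow> u s = v s" "x c = y c"
  shows "x t = y t"
proof (rule vec.solution_local_unique)
  show "abs_primitive (\<lambda>s. A s *v x s + B s *v u s) x" "abs_primitive (\<lambda>s. A s *v y s + B s *v v s) y"
    using assms by (simp_all add: solution_def)
  show "AE s in lebesgue. s \<in> closed_segment c t \<longrightarrow> B s *v u s = B s *v v s"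
    using assms(3) by eventually_elim auto
qed fact

lemma phi_eqI:
  assumes "solution u x" "x t0 = x0"
  shows "phi A B t t0 x0 u = x t"
proof -
  have "(THE x. caratheodory_solution (\<lambda>s y. A s *v y + B s *v u s) t0 x0 x) = x"
  proof (rule the_equality)
    show "caratheodory_solution (\<lambda>s y. A s *v y + B s *v u s) t0 x0 x"
      using assms by (simp add: caratheodory_solution_iff solution_def)
    fix y assume "caratheodory_solution (\<lambda>s y. A s *v y + B s *v u s) t0 x0 y"
    then have y: "solution u y" "y t0 = x0"
      by (simp_all add: caratheodory_solution_iff solution_def)
    have "y t = x t" for t
      by (rule solution_eq[OF y(1) assms(1), where c=t0]) (use y(2) assms(2) in auto)
    then show "y = x" by blast
  qed
  then show ?thesis by (simp add: phi_def)
qed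

lemma solution_phi:
  assumes "u \<in> Linf UNIV"
  shows "solution u (\<lambda>t. phi A B t t0 x0 u)"
proof -
  have "(\<lambda>s. B s *v u s) \<in> Linf UNIV"
    by (rule Linf_bilinear[OF bounded_bilinear_matrix_vector_mult B_Linf assms])
  then obtain x where "x t0 = x0" "solution u x"
    using vec.solution_exists unfolding solution_def by blast
  moreover from this have "(\<lambda>t. phi A B t t0 x0 u) = x"
    by (auto intro: phi_eqI)
  ultimately show ?thesis by simp
qed

lemma phi_initial: "u \<in> Linf UNIV \<Longrightarrow> phi A B t0 t0 x0 u = x0"
proof -
  assume "u \<in> Linf UNIV"
  then have "(\<lambda>s. B s *v u s) \<in> Linf UNIV"
    by (rule Linf_bilinear[OF bounded_bilinear_matrix_vector_mult B_Linf])
  then obtain x where "x t0 = x0" "solution u x"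
    using vec.solution_exists unfolding solution_def by blast
  then show ?thesis
    using phi_eqI[of u x t0 x0 t0] by simp
qed

lemma phi_cocycle:
  assumes "u \<in> Linf UNIV"
  shows "phi A B t s (phi A B s r x u) u = phi A B t r x u"
  using solution_phi[OF assms] by (rule phi_eqI) simp

lemma phi_local:
  assumes "u \<in> Linf UNIV" "v \<in> Linf UNIV" "AE s in lebesgue. s \<in> closed_segment r t \<longrightarrow> u s = v s"
  shows "phi A B t r x u = phi A B t r x v"
  by (rule solution_eq[OF solution_phi[OF assms(1)] solution_phi[OF assms(2)] assms(3)])
    (simp add: phi_initial assms)

lemma phi_linear:
  assumes "u \<in> Linf UNIV" "v \<in> Linf UNIV"
  shows "phi A B t r (a *\<^sub>R x + b *\<^sub>R y) (\<lambda>s. a *\<^sub>R u s + b *\<^sub>R v s) =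
    a *\<^sub>R phi A B t r x u + b *\<^sub>R phi A B t r y v"
proof (rule phi_eqI)
  show "solution (\<lambda>s. a *\<^sub>R u s + b *\<^sub>R v s) (\<lambda>t. a *\<^sub>R phi A B t r x u + b *\<^sub>R phi A B t r y v)"
    using abs_primitive_add[OF abs_primitive_scaleR[of _ _ a] abs_primitive_scaleR[of _ _ b],
        OF solution_phi[OF assms(1), unfolded solution_def] solution_phi[OF assms(2), unfolded solution_def],
        of r x r y]
    by (simp add: solution_def matrix_vector_right_distrib matrix_vector_mult_scaleR algebra_simps)
qed (simp add: phi_initial assms)

abbreviation "X \<equiv> fundamental_solution A"

lemma fundamental_solution_exists:
  "\<exists>Y. Y s = mat 1 \<and> abs_primitive (\<lambda>r. A r ** Y r) Y \<and> (\<forall>t. X t s = Y t)"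
proof -
  obtain Y where Y: "Y s = mat 1" "abs_primitive (\<lambda>r. A r ** Y r) Y"
    using mat.solution_exists[OF Linf_const[of 0], of s "mat 1"] by auto
  have "(THE Y. caratheodory_solution (\<lambda>r Z. A r ** Z) s (mat 1) Y) = Y"
  proof (rule the_equality)
    show "caratheodory_solution (\<lambda>r Z. A r ** Z) s (mat 1) Y"
      using Y by (simp add: caratheodory_solution_iff)
    fix Z assume "caratheodory_solution (\<lambda>r Z. A r ** Z) s (mat 1) Z"
    then have Z: "Z s = mat 1" "abs_primitive (\<lambda>r. A r ** Z r) Z"
      by (simp_all add: caratheodory_solution_iff)
    have "Z t = Y t" for t
      by (rule mat.solution_local_unique[where g="\<lambda>_. 0" and h="\<lambda>_. 0" and c=s]) (use Y Z in simp_all)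
    then show "Z = Y" by blast
  qed
  then show ?thesis
    using Y by (auto simp: fundamental_solution_def)
qed

text \<open>Reduces the cocycle, identity and periodicity laws of the matrices to those of
  \<open>phi\<close>.\<close>

lemma X_mult: "X t s *v x = phi A B t s x (\<lambda>_. 0)"
proof -
  obtain Y where Y: "Y s = mat 1" "abs_primitive (\<lambda>r. A r ** Y r) Y" "\<And>t. X t s = Y t"
    using fundamental_solution_exists by blast
  have "abs_primitive (\<lambda>r. (A r ** Y r) *v x) (\<lambda>r. Y r *v x)"
    by (rule abs_primitive_linear[OF Y(2)])
      (rule bounded_bilinear.bounded_linear_left[OF bounded_bilinear_matrix_vector_mult])
  then have "solution (\<lambda>_. 0) (\<lambda>r. Y r *v x)"
    by (simp add: solution_def matrix_vector_mul_assoc)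
  from phi_eqI[OF this, of s x t] show ?thesis
    by (simp add: Y)
qed

lemma phi_decompose:
  assumes "u \<in> Linf UNIV"
  shows "phi A B t r x u = X t r *v x + phi A B t r 0 u"
  unfolding X_mult using phi_linear[OF Linf_const[of 0] assms, of t r 1 x 1 0] by simp

lemma X_cocycle: "X t s ** X s r = X t r"
proof -
  have "(X t s ** X s r) *v x = X t r *v x" for x
    unfolding matrix_vector_mul_assoc[symmetric] X_mult by (rule phi_cocycle[OF Linf_const])
  then show ?thesis unfolding matrix_eq by blast
qed

lemma X_refl: "X t t = mat 1"
  unfolding matrix_eq by (simp add: X_mult phi_initial Linf_const)

lemma X_bound: "\<exists>C. \<forall>t s. norm (X t s) \<le> 2 * norm (mat 1 :: real^'d^'d) * exp (C * \<bar>t - s\<bar>)"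
proof -
  obtain C where C: "C > 0" "AE s in lebesgue. \<forall>y. norm (A s ** y) \<le> C * norm (y :: real^'d^'d)"
    by (rule mat.coefficient_bound)
  have "norm (X t s) \<le> 2 * norm (mat 1 :: real^'d^'d) * exp (2 * C * \<bar>t - s\<bar>)" for t s
  proof -
    obtain Y where Y: "Y s = mat 1" "abs_primitive (\<lambda>r. A r ** Y r) Y" "\<And>t. X t s = Y t"
      using fundamental_solution_exists by blast
    have "norm (Y t) \<le> (2 * norm (Y s) + 0 / C) * exp (2 * C * \<bar>t - s\<bar>)"
    proof (rule gronwall[OF Y(2) C(1)])
      show "AE r in lebesgue. r \<in> closed_segment s t \<longrightarrow> norm (A r ** Y r) \<le> C * norm (Y r) + 0"
        using C(2) by eventually_elim auto
    qed simp
    then show ?thesis by (simp add: Y)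
  qed
  then show ?thesis by blast
qed

lemma continuous_on_X_fst: "continuous_on UNIV (\<lambda>t. X t s)"
proof -
  obtain Y where Y: "abs_primitive (\<lambda>r. A r ** Y r) Y" "\<And>t. X t s = Y t"
    using fundamental_solution_exists by blast
  then show ?thesis
    using abs_primitive_continuous by simp
qed

text \<open>No differential equation in the second argument is at hand. Instead X s r - X s t = X s
  r (I - X r t), where the first factor is locally bounded by \<open>X_bound\<close> and the second
  tends to 0 by continuity in the first argument.\<close>

lemma continuous_on_X_snd: "continuous_on UNIV (\<lambda>t. X s t)"
proof -
  obtain C where C: "\<And>t s. norm (X t s) \<le> 2 * norm (mat 1 :: real^'d^'d) * exp (C * \<bar>t - s\<bar>)"
    using X_bound by blast
  obtain K where K: "K \<ge> 0" "\<And>(a :: real^'d^'d) (b :: real^'d^'d). norm (a ** b) \<le> norm a * norm b * K"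
    using bounded_bilinear.nonneg_bounded[OF bounded_bilinear_matrix_matrix_mult] by blast
  have "((\<lambda>r. X s r - X s t) \<longlongrightarrow> 0) (at t)" for t
  proof (rule Lim_null_comparison)
    let ?b = "\<lambda>r. 2 * norm (mat 1 :: real^'d^'d) * exp (C * \<bar>s - r\<bar>)"
    have id: "X s r - X s t = X s r ** (X t t - X r t)" for r
      unfolding bounded_bilinear.diff_right[OF bounded_bilinear_matrix_matrix_mult]
      by (simp add: X_refl X_cocycle)
    have "norm (X s r - X s t) \<le> ?b r * norm (X t t - X r t) * K" for r
    proof -
      have "norm (X s r - X s t) \<le> norm (X s r) * norm (X t t - X r t) * K"
        unfolding id by (rule K)
      also have "\<dots> \<le> ?b r * norm (X t t - X r t) * K"
        using C[of s r] K(1) by (intro mult_right_mono) auto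
      finally show ?thesis .
    qed
    then show "\<forall>\<^sub>F r in at t. norm (X s r - X s t) \<le> ?b r * norm (X t t - X r t) * K"
      by simp
    have "((\<lambda>r. X r t) \<longlongrightarrow> X t t) (at t)"
      using continuous_on_X_fst[of t] by (auto simp: continuous_on_def)
    then have "((\<lambda>r. ?b r * norm (X t t - X r t) * K) \<longlongrightarrow> ?b t * norm (X t t - X t t) * K) (at t)"
      by (intro tendsto_intros)
    then show "((\<lambda>r. ?b r * norm (X t t - X r t) * K) \<longlongrightarrow> 0) (at t)"
      by simp
  qed
  then show ?thesis
    by (auto simp: continuous_on_def LIM_zero_iff)
qed

lemma phi_bound:
  assumes G: "G \<ge> 0"
  shows "\<exists>b. \<forall>u\<in>Linf UNIV. (AE s in lebesgue. norm (u s) \<le> G) \<longrightarrow> norm (phi A B t r 0 u) \<le> b"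
proof -
  obtain C where C: "C > 0" "AE s in lebesgue. \<forall>y. norm (A s *v y) \<le> C * norm y"
    by (rule vec.coefficient_bound)
  obtain D where D: "D > 0" "AE s in lebesgue. norm (B s) \<le> D"
    using B_Linf by (rule Linf_bound)
  obtain K where K: "K \<ge> 0" "\<And>(a :: real^'m^'d) b. norm (a *v b) \<le> norm a * norm b * K"
    using bounded_bilinear.nonneg_bounded[OF bounded_bilinear_matrix_vector_mult] by blast
  have "norm (phi A B t r 0 u) \<le> D * G * K / C * exp (2 * C * \<bar>t - r\<bar>)"
    if u: "u \<in> Linf UNIV" "AE s in lebesgue. norm (u s) \<le> G" for u
  proof -
    let ?x = "\<lambda>t. phi A B t r 0 u"
    have "norm (?x t) \<le> (2 * norm (?x r) + D * G * K / C) * exp (2 * C * \<bar>t - r\<bar>)"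
    proof (rule gronwall[OF solution_phi[OF u(1), unfolded solution_def] C(1)])
      show "AE s in lebesgue. s \<in> closed_segment r t \<longrightarrow>
          norm (A s *v ?x s + B s *v u s) \<le> C * norm (?x s) + D * G * K"
        using C(2) D(2) u(2)
      proof eventually_elim
        case (elim s)
        have "norm (B s *v u s) \<le> norm (B s) * norm (u s) * K" by (rule K)
        also have "\<dots> \<le> D * G * K"
          using elim D(1) K(1) by (intro mult_right_mono mult_mono) auto
        finally have "norm (B s *v u s) \<le> D * G * K" .
        moreover have "norm (A s *v ?x s) \<le> C * norm (?x s)"
          using elim by blast
        ultimately show ?case
          by (intro impI norm_triangle_mono)
      qed
    qed (use D K G in auto)
    then show ?thesis
      by (simp add: phi_initial[OF u(1)])
  qed
  then show ?thesis by blast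
qed

end

section \<open>Periodic coefficients, admissible controls and controllability\<close>

locale periodic_system = linear_system A B
  for A :: "real \<Rightarrow> real^'d^'d" and B :: "real \<Rightarrow> real^'m^'d" +
  fixes T :: real and U :: "(real^'m) set"
  assumes T_pos: "T > 0" and A_periodic: "ae_periodic T A" and B_periodic: "ae_periodic T B"
    and U_bounded: "bounded U" and U_convex: "convex U" and U_interior: "0 \<in> interior U"
begin

lemma phi_shift:
  assumes u: "u \<in> Linf UNIV"
  shows "phi A B t r x (\<lambda>s. u (s + of_int n * T)) = phi A B (t + of_int n * T) (r + of_int n * T) x u"
proof (rule phi_eqI)
  let ?c = "of_int n * T" and ?x = "\<lambda>t. phi A B t (r + of_int n * T) x u"
  have "abs_primitive (\<lambda>s. A (s + ?c) *v ?x (s + ?c) + B (s + ?c) *v u (s + ?c)) (\<lambda>s. ?x (s + ?c))"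
    using abs_primitive_shift[OF solution_phi[OF u, unfolded solution_def]] .
  moreover have "AE s in lebesgue. A (s + ?c) *v ?x (s + ?c) + B (s + ?c) *v u (s + ?c) =
      A s *v ?x (s + ?c) + B s *v u (s + ?c)"
    using ae_periodic_int[OF A_periodic, of n] ae_periodic_int[OF B_periodic, of n]
    by eventually_elim simp
  ultimately show "solution (\<lambda>s. u (s + ?c)) (\<lambda>s. ?x (s + ?c))"
    unfolding solution_def by (rule abs_primitive_cong_AE)
qed (simp add: phi_initial u)

lemma X_shift: "X (t + of_int n * T) (s + of_int n * T) = X t s"
  using phi_shift[OF Linf_const[of 0]] by (simp add: matrix_eq X_mult)

abbreviation "\<U> \<equiv> admissible_controls U"

lemma admissible_Linf: "u \<in> \<U> \<Longrightarrow> u \<in> Linf UNIV"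
  by (simp add: admissible_controls_def)

lemma zero_admissible: "(\<lambda>_. 0) \<in> \<U>"
  using U_interior interior_subset by (auto simp: admissible_controls_def Linf_const)

lemma admissible_shift: "u \<in> \<U> \<Longrightarrow> (\<lambda>s. u (s + c)) \<in> \<U>"
  using AE_lebesgue_shift[where P="\<lambda>s. u s \<in> U"] by (simp add: admissible_controls_def Linf_shift)

lemma admissible_If: "u \<in> \<U> \<Longrightarrow> v \<in> \<U> \<Longrightarrow> (\<lambda>s. if s \<in> closed_segment a b then u s else v s) \<in> \<U>"
  unfolding admissible_controls_def
  by (auto intro: Linf_If_interval elim: eventually_elim2)

lemma admissible_convex:
  assumes "u \<in> \<U>" "v \<in> \<U>" "0 \<le> a" "0 \<le> b" "a + b = 1"
  shows "(\<lambda>s. a *\<^sub>R u s + b *\<^sub>R v s) \<in> \<U>"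
proof -
  have "AE s in lebesgue. u s \<in> U" "AE s in lebesgue. v s \<in> U"
    using assms by (simp_all add: admissible_controls_def)
  then have "AE s in lebesgue. a *\<^sub>R u s + b *\<^sub>R v s \<in> U"
    by eventually_elim (use assms U_convex in \<open>auto simp: convexD\<close>)
  then show ?thesis
    using assms by (simp add: admissible_controls_def Linf_add Linf_scaleR)
qed

text \<open>For negative t these are the states at time t of trajectories that arrive at 0 at time
  0, which is a controllable set; one definition serves both directions of time.\<close>

definition R :: "real \<Rightarrow> (real^'d) set" where
  "R t = (\<lambda>u. phi A B t 0 0 u) ` \<U>"

lemma reach_at_eq: "reach_at A B U t 0 0 = R t"
  by (auto simp: reach_at_def R_def)

lemma control_at_eq: "control_at A B U t 0 0 = R t"
proof -
  have "phi A B 0 t y u = 0 \<longleftrightarrow> y = phi A B t 0 0 u" if "u \<in> \<U>" for u y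
    using phi_cocycle[OF admissible_Linf[OF that], of t 0 t y] phi_cocycle[OF admissible_Linf[OF that], of 0 t 0 0]
      phi_initial[OF admissible_Linf[OF that]] by metis
  then show ?thesis
    by (auto simp: control_at_def R_def)
qed

lemma convex_R: "convex (R t)"
proof (rule convexI)
  fix x y and a b :: real
  assume "x \<in> R t" "y \<in> R t" and ab: "0 \<le> a" "0 \<le> b" "a + b = 1"
  then obtain u v where uv: "u \<in> \<U>" "v \<in> \<U>" "x = phi A B t 0 0 u" "y = phi A B t 0 0 v"
    by (auto simp: R_def)
  have eq: "a *\<^sub>R x + b *\<^sub>R y = phi A B t 0 0 (\<lambda>s. a *\<^sub>R u s + b *\<^sub>R v s)"
    using phi_linear[OF admissible_Linf admissible_Linf, OF uv(1,2), of t 0 a 0 b 0] by (simp add: uv(3,4))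
  show "a *\<^sub>R x + b *\<^sub>R y \<in> R t"
    unfolding eq R_def by (rule imageI) (rule admissible_convex[OF uv(1,2) ab])
qed

lemma R_at_0: "R 0 = {0}"
  using zero_admissible by (auto simp: R_def phi_initial admissible_Linf)

lemma bounded_R: "bounded (R t)"
proof -
  obtain G where G: "\<And>x. x \<in> U \<Longrightarrow> norm x \<le> G"
    using U_bounded by (auto simp: bounded_iff)
  obtain b where b: "\<And>u. u \<in> Linf UNIV \<Longrightarrow> (AE s in lebesgue. norm (u s) \<le> max 0 G) \<Longrightarrow> norm (phi A B t 0 0 u) \<le> b"
    using phi_bound[of "max 0 G" t 0] by auto
  have "norm (phi A B t 0 0 u) \<le> b" if "u \<in> \<U>" for u
  proof (rule b)
    have "AE s in lebesgue. u s \<in> U"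
      using that by (simp add: admissible_controls_def)
    then show "AE s in lebesgue. norm (u s) \<le> max 0 G"
      by eventually_elim (simp add: G le_max_iff_disj)
  qed (rule admissible_Linf[OF that])
  then show ?thesis
    by (auto simp: bounded_iff R_def)
qed

text \<open>In either direction of time, u acts next to time 0 and v beyond \<open>c\<close>; for t
  < 0 the segment extends to the left of 0.\<close>

lemma phi_concat:
  assumes u: "u \<in> \<U>" and v: "v \<in> \<U>" and c: "c \<in> closed_segment 0 t"
  shows "X t c *v phi A B c 0 0 u + phi A B t c 0 v \<in> R t"
proof -
  define w where "w = (\<lambda>s. if s \<in> closed_segment 0 c then u s else v s)"
  have w: "w \<in> \<U>"
    unfolding w_def using u v by (rule admissible_If)
  have 1: "phi A B c 0 0 w = phi A B c 0 0 u"
    using w u by (intro phi_local admissible_Linf) (auto simp: w_def)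
  \<comment> \<open>The two segments meet in \<open>c\<close>, where \<open>w\<close> takes the
    value of \<open>u\<close>.\<close>
  have "AE s in lebesgue. s \<noteq> c"
    by (intro AE_I'[of "{c}"]) (auto simp flip: negligible_iff_null_sets)
  then have "AE s in lebesgue. s \<in> closed_segment c t \<longrightarrow> w s = v s"
    by eventually_elim (use c in \<open>auto simp: w_def closed_segment_eq_real_ivl split: if_splits\<close>)
  then have 2: "phi A B t c x w = phi A B t c x v" for x
    using w v by (intro phi_local admissible_Linf)
  have "phi A B t 0 0 w = phi A B t c (phi A B c 0 0 u) v"
    using phi_cocycle[OF admissible_Linf[OF w], of t c 0 0] by (simp add: 1 2)
  also have "\<dots> = X t c *v phi A B c 0 0 u + phi A B t c 0 v"
    by (rule phi_decompose[OF admissible_Linf[OF v]])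
  finally show ?thesis
    unfolding R_def using w by (metis imageI)
qed

text \<open>By periodicity the part of the control beyond nT can be moved back by nT. Negative n are
  the case of reversed time.\<close>

lemma R_split:
  assumes c: "of_int n * T \<in> closed_segment 0 (t + of_int n * T)"
  shows "R (t + of_int n * T) = (*v) (X (t + of_int n * T) (of_int n * T)) ` R (of_int n * T) + R t"
proof -
  let ?c = "of_int n * T"
  have shift: "phi A B t 0 0 (\<lambda>s. u (s + ?c)) = phi A B (t + ?c) ?c 0 u" if "u \<in> \<U>" for u
    using phi_shift[OF admissible_Linf[OF that], of t 0 0 n] by simp
  show ?thesis
  proof (intro equalityI subsetI)
    fix x assume "x \<in> R (t + ?c)"
    then obtain u where u: "u \<in> \<U>" "x = phi A B (t + ?c) 0 0 u"
      by (auto simp: R_def)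
    have "x = phi A B (t + ?c) ?c (phi A B ?c 0 0 u) u"
      by (simp add: u(2) phi_cocycle admissible_Linf[OF u(1)])
    also have "\<dots> = X (t + ?c) ?c *v phi A B ?c 0 0 u + phi A B t 0 0 (\<lambda>s. u (s + ?c))"
      unfolding shift[OF u(1)] by (rule phi_decompose[OF admissible_Linf[OF u(1)]])
    finally show "x \<in> (*v) (X (t + ?c) ?c) ` R ?c + R t"
      using u(1) admissible_shift[OF u(1)] by (auto simp: set_plus_def R_def)
  next
    fix x assume "x \<in> (*v) (X (t + ?c) ?c) ` R ?c + R t"
    then obtain u v where uv: "u \<in> \<U>" "v \<in> \<U>" "x = X (t + ?c) ?c *v phi A B ?c 0 0 u + phi A B t 0 0 v"
      by (auto simp: set_plus_def R_def)
    let ?v = "\<lambda>s. v (s + - ?c)"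
    have "?v \<in> \<U>" using uv(2) by (rule admissible_shift)
    from phi_concat[OF uv(1) this c] shift[OF this] show "x \<in> R (t + ?c)"
      by (simp add: uv(3))
  qed
qed

lemma R_flow:
  assumes "y \<in> R s" "s \<in> closed_segment 0 t"
  shows "X t s *v y \<in> R t"
proof -
  obtain u where "u \<in> \<U>" "y = phi A B s 0 0 u"
    using assms(1) by (auto simp: R_def)
  then show ?thesis
    using phi_concat[OF _ zero_admissible assms(2)] by (simp flip: X_mult)
qed

lemma periodic_reach_direction:
  assumes e: "e = 1 \<or> e = (-1::real)" and int: "\<exists>k. 0 \<in> interior (R (e * (real k * T)))"
  shows "periodic_reach T (\<lambda>t s. X (e * t) (e * s)) (\<lambda>t. R (e * t))"
proof
  \<comment> \<open>The times e k T become integer multiples of T, to which \<open>X_shift\<close>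
    and \<open>R_split\<close> apply.\<close>
  obtain n :: int where n: "e = of_int n"
    using e by (metis of_int_1 of_int_minus)
  show "X (e * (t + T)) (e * (s + T)) = X (e * t) (e * s)" for t s
    using X_shift[of "e * t" n "e * s"] by (simp add: n algebra_simps)
  show "continuous_on UNIV (\<lambda>t. X (e * 0) (e * t))" "continuous_on UNIV (\<lambda>t. X (e * t) (e * 0))"
    by (rule continuous_on_compose2[OF continuous_on_X_snd] continuous_on_compose2[OF continuous_on_X_fst],
        auto intro!: continuous_intros)+
  show "X (e * t) (e * s) *v y \<in> R (e * t)" if "0 \<le> s" "s \<le> t" "y \<in> R (e * s)" for s t y
    using that e by (intro R_flow) (auto simp: closed_segment_eq_real_ivl)
  show "R (e * (t + real k * T)) = (*v) (X (e * (t + real k * T)) (e * (real k * T))) ` R (e * (real k * T)) + R (e * t)"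
    if "0 \<le> t" for t k
  proof -
    have eq: "of_int (n * int k) * T = e * (real k * T)"
      by (simp add: n)
    have "e * c \<in> closed_segment 0 (e * t + e * c)" if "c \<ge> 0" for c
      using e \<open>0 \<le> t\<close> that by (auto simp: closed_segment_eq_real_ivl)
    from this[of "real k * T"] have "e * (real k * T) \<in> closed_segment 0 (e * t + e * (real k * T))"
      using T_pos by simp
    then show ?thesis
      using R_split[of "n * int k" "e * t"] unfolding eq by (simp add: distrib_left)
  qed
qed (use T_pos X_cocycle X_refl R_at_0 convex_R bounded_R int in auto)

text \<open>By linearity a control that steers -x to 0 at t1 steers 0 to X t1 0 x. Extended by 0 it
  keeps the first trajectory at 0, so the second one is X t 0 x for all t >= t1. Each x has its own
  t1, and this persistence lets finitely many x share one time. The factor \<delta> = r/C makes the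
  control admissible.\<close>

lemma control_to_zero:
  assumes ctrl: "controllable A B"
  shows "\<exists>\<delta>>0. \<forall>\<^sub>F t in at_top. X t 0 *v (\<delta> *\<^sub>R x) \<in> R t"
proof -
  obtain t1 u1 where t1: "t1 > 0" "u1 \<in> Linf {0..t1}" and
    u1: "phi A B t1 0 (- x) (\<lambda>t. if t \<in> {0..t1} then u1 t else 0) = 0"
    using ctrl unfolding controllable_def by blast
  define u where "u = (\<lambda>t. if t \<in> {0..t1} then u1 t else 0)"
  have u: "u \<in> Linf UNIV"
    unfolding u_def by (rule Linf_interval_extend) (rule t1)
  obtain C where C: "C > 0" "AE t in lebesgue. norm (u t) \<le> C"
    using u by (rule Linf_bound)
  obtain r where r: "r > 0" "cball 0 r \<subseteq> U"
    using U_interior by (auto simp: mem_interior_cball)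
  define \<delta> where "\<delta> = r / C"
  have \<delta>: "\<delta> > 0" using r C by (simp add: \<delta>_def)
  have "AE t in lebesgue. \<delta> *\<^sub>R u t \<in> U"
    using C(2)
  proof eventually_elim
    case (elim t)
    then have "norm (\<delta> *\<^sub>R u t) \<le> r"
      using C(1) r(1) by (simp add: \<delta>_def field_simps)
    then show ?case using r(2) by auto
  qed
  then have adm: "(\<lambda>t. \<delta> *\<^sub>R u t) \<in> \<U>"
    using u by (simp add: admissible_controls_def Linf_scaleR)
  have "X t 0 *v (\<delta> *\<^sub>R x) \<in> R t" if "t \<ge> t1" for t
  proof -
    have "AE s in lebesgue. s \<noteq> t1"
      by (intro AE_I'[of "{t1}"]) (auto simp flip: negligible_iff_null_sets)
    then have "AE s in lebesgue. s \<in> closed_segment t1 t \<longrightarrow> u s = 0"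
      by eventually_elim (use that in \<open>auto simp: u_def closed_segment_eq_real_ivl\<close>)
    then have "phi A B t t1 0 u = phi A B t t1 0 (\<lambda>_. 0)"
      by (intro phi_local u Linf_const)
    then have "phi A B t t1 0 u = 0"
      by (simp flip: X_mult)
    then have "phi A B t 0 (- x) u = 0"
      using phi_cocycle[OF u, of t t1 0 "- x"] u1 by (simp add: u_def)
    moreover have "X t 0 *v (- x) = - (X t 0 *v x)"
      using matrix_vector_mult_scaleR[of "X t 0" "-1" x] by simp
    ultimately have "phi A B t 0 0 u = X t 0 *v x"
      using phi_decompose[OF u, of t 0 "- x"] by simp
    then have "phi A B t 0 0 (\<lambda>s. \<delta> *\<^sub>R u s) = X t 0 *v (\<delta> *\<^sub>R x)"
      using phi_linear[OF u u, of t 0 \<delta> 0 0 0] by (simp add: matrix_vector_mult_scaleR)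
    then show ?thesis
      using adm by (force simp: R_def)
  qed
  then show ?thesis
    using \<delta> by (auto simp: eventually_at_top_linorder)
qed

lemma X_inverse: "X t s *v (X s t *v x) = x"
  by (simp add: matrix_vector_mul_assoc X_cocycle X_refl)

text \<open>Pulled back by X t 0, the points \<delta> x do not move with t, so all axis directions
  and their negatives can be used at one common time; \<open>S\<close> is the pulled-back reachable
  set.\<close>

lemma zero_interior_R:
  assumes "controllable A B"
  shows "\<exists>k. 0 \<in> interior (R (real k * T))"
proof -
  obtain \<delta> where \<delta>: "\<And>x. \<delta> x > 0 \<and> (\<forall>\<^sub>F t in at_top. X t 0 *v (\<delta> x *\<^sub>R x) \<in> R t)"
    using control_to_zero[OF assms] by metis
  have "\<forall>\<^sub>F t in at_top. \<forall>x\<in>Basis \<union> uminus ` Basis. X t 0 *v (\<delta> x *\<^sub>R x) \<in> R t"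
    using \<delta> by (intro eventually_ball_finite) auto
  then obtain t0 where t0: "\<And>t x. t \<ge> t0 \<Longrightarrow> x \<in> Basis \<union> uminus ` Basis \<Longrightarrow> X t 0 *v (\<delta> x *\<^sub>R x) \<in> R t"
    by (auto simp: eventually_at_top_linorder)
  obtain k :: nat where "t0 < real k * T"
    using reals_Archimedean3[OF T_pos] by blast
  define t where "t = real k * T"
  have t: "X t 0 *v (\<delta> x *\<^sub>R x) \<in> R t" if "x \<in> Basis \<union> uminus ` Basis" for x
    using t0[OF _ that, of t] \<open>t0 < real k * T\<close> by (simp add: t_def)
  define S where "S = (*v) (X t 0) -` R t"
  have "0 \<in> interior S"
  proof (rule convex_axes_interior)
    show "convex S"
      unfolding S_def by (intro convex_linear_vimage convex_R matrix_vector_mul_linear)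
    show "0 \<in> S"
      using R_flow[of 0 0 t] by (simp add: S_def R_at_0)
    fix b :: "real^'d" assume b: "b \<in> Basis"
    then show "\<exists>e>0. e *\<^sub>R b \<in> S"
      using t[of b] \<delta>[of b] by (auto simp: S_def)
    show "\<exists>e>0. - (e *\<^sub>R b) \<in> S"
      using t[of "- b"] \<delta>[of "- b"] b by (intro exI[of _ "\<delta> (- b)"]) (auto simp: S_def)
  qed
  then have "X t 0 *v 0 \<in> interior ((*v) (X t 0) ` S)"
    by (rule interior_matrix_image[OF X_inverse X_inverse])
  also have "\<dots> \<subseteq> interior (R t)"
    by (intro interior_mono) (auto simp: S_def)
  finally show ?thesis
    by (auto simp: t_def)
qed

text \<open>Controllability is assumed forward in time only. Move a trajectory on [0, kT] from 0 to
  z to the interval [-kT, 0]. Comparing it at -kT with the trajectory of the same control through 0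
  at time 0 shows that -X (-kT) 0 z lies in R (-kT), which thus contains an invertible linear image
  of R (kT).\<close>

lemma zero_interior_R_backward:
  assumes "controllable A B"
  shows "\<exists>k. 0 \<in> interior (R (- (real k * T)))"
proof -
  obtain k where k: "0 \<in> interior (R (real k * T))"
    using zero_interior_R[OF assms] by blast
  let ?t = "real k * T"
  let ?P = "- X (- ?t) 0" and ?Q = "- X 0 (- ?t)"
  have minus: "- M *v x = - (M *v x)" "M *v (- x) = - (M *v x)" for M :: "real^'d^'d" and x
    using scaleR_matrix_vector_assoc[of "-1" M x] matrix_vector_mult_scaleR[of M "-1" x] by simp_all
  have "?P *v 0 \<in> interior ((*v) ?P ` R ?t)"
    by (rule interior_matrix_image[OF _ _ k, of _ ?Q]) (simp_all add: minus X_inverse)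
  moreover have "(*v) ?P ` R ?t \<subseteq> R (- ?t)"
  proof safe
    fix z assume "z \<in> R ?t"
    then obtain u where u: "u \<in> \<U>" "z = phi A B ?t 0 0 u"
      by (auto simp: R_def)
    define v where "v = (\<lambda>s. u (s + of_int (int k) * T))"
    have v: "v \<in> \<U>" unfolding v_def by (rule admissible_shift) (rule u)
    have "phi A B 0 (- ?t) 0 v = z"
      using phi_shift[OF admissible_Linf[OF u(1)], of 0 "- ?t" 0 "int k"] by (simp add: v_def u(2))
    then have "phi A B (- ?t) 0 z v = 0"
      using phi_cocycle[OF admissible_Linf[OF v], of "- ?t" 0 "- ?t" 0] phi_initial[OF admissible_Linf[OF v]] by simp
    then have "phi A B (- ?t) 0 0 v = ?P *v z"
      using phi_decompose[OF admissible_Linf[OF v], of "- ?t" 0 z] by (simp add: minus eq_neg_iff_add_eq_0 add.commute)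
    then show "?P *v z \<in> R (- ?t)"
      using v by (force simp: R_def)
  qed
  ultimately have "?P *v 0 \<in> interior (R (- ?t))"
    using interior_mono by blast
  then show ?thesis
    unfolding matrix_vector_mult_0_right by blast
qed

end

section \<open>Identification with the subbundles and sets of the theorem\<close>

context periodic_system
begin

lemma E_sums:
  "E_minus_zero A T \<tau> = spectral_space (X (T + \<tau>) \<tau>) {\<mu>. cmod \<mu> \<le> 1}"
  "E_plus_zero A T \<tau> = spectral_space (X (T + \<tau>) \<tau>) {\<mu>. cmod \<mu> \<ge> 1}"
proof -
  have "{\<mu>. cmod \<mu> \<le> 1} = {\<mu>. cmod \<mu> < 1} \<union> {\<mu>. cmod \<mu> = 1}"
    "{\<mu>. cmod \<mu> \<ge> 1} = {\<mu>. cmod \<mu> > 1} \<union> {\<mu>. cmod \<mu> = 1}"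
    by auto
  then show "E_minus_zero A T \<tau> = spectral_space (X (T + \<tau>) \<tau>) {\<mu>. cmod \<mu> \<le> 1}"
    "E_plus_zero A T \<tau> = spectral_space (X (T + \<tau>) \<tau>) {\<mu>. cmod \<mu> \<ge> 1}"
    by (simp_all only: E_minus_zero_def E_plus_zero_def E_minus_def E_zero_def E_plus_def spectral_space_Un)
qed

text \<open>The monodromy matrix of the reversed system is the inverse of the original one, so the
  multipliers are inverted and the conditions on |\<mu>| change sides.\<close>

lemma spectral_space_backward:
  "spectral_space (X (\<tau> - T) \<tau>) {\<mu>. cmod \<mu> < 1} = E_plus A T \<tau>"
  "spectral_space (X (\<tau> - T) \<tau>) {\<mu>. cmod \<mu> \<ge> 1} = E_minus_zero A T \<tau>"
proof -
  let ?M = "X (T + \<tau>) \<tau>" and ?N = "X (\<tau> - T) \<tau>"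
  have "?N = X \<tau> (T + \<tau>)"
    using X_shift[of "\<tau> - T" 1 \<tau>] by (simp add: add.commute)
  then have inv: "?N ** ?M = mat 1" "?M ** ?N = mat 1"
    by (simp_all add: X_cocycle X_refl)
  show "spectral_space ?N {\<mu>. cmod \<mu> < 1} = E_plus A T \<tau>"
    unfolding E_plus_def
    using spectral_space_inverse[OF inv, of "{\<mu>. cmod \<mu> > 1}" "{\<mu>. cmod \<mu> < 1}"]
      spectral_space_inverse[OF inv(2,1), of "{\<mu>. cmod \<mu> < 1}" "{\<mu>. cmod \<mu> > 1}"]
    by (auto simp: norm_inverse inverse_less_1_iff one_less_inverse_iff)
  show "spectral_space ?N {\<mu>. cmod \<mu> \<ge> 1} = E_minus_zero A T \<tau>"
    unfolding E_sums
    using spectral_space_inverse[OF inv, of "{\<mu>. cmod \<mu> \<le> 1}" "{\<mu>. cmod \<mu> \<ge> 1}"]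
      spectral_space_inverse[OF inv(2,1), of "{\<mu>. cmod \<mu> \<ge> 1}" "{\<mu>. cmod \<mu> \<le> 1}"]
    by (auto simp: norm_inverse inverse_le_1_iff one_le_inverse_iff)
qed

text \<open>\<open>F\<close> collects integer shifts, the sets of the theorem only natural ones.
  They agree since 0 <= \<tau> < T: a shift by n < 0 would make the time negative.\<close>

lemma nonneg_times_eq:
  assumes e: "e = 1 \<or> e = -1" and \<tau>: "\<tau> \<in> {0..<T}"
  shows "{t. t \<ge> 0 \<and> (\<exists>n::int. t = e * \<tau> + of_int n * T)} =
    (\<lambda>k. real k * T + e * \<tau>) ` {k::nat. real k * T + e * \<tau> \<ge> 0}" (is "?L = ?R")
proof (intro equalityI subsetI)
  fix t assume "t \<in> ?L"
  then obtain n :: int where n: "0 \<le> t" "t = e * \<tau> + of_int n * T" by blast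
  then have "0 < (of_int n + 1) * T"
    using e \<tau> by (auto simp: distrib_right)
  then have "0 < real_of_int n + 1"
    using T_pos by (simp add: zero_less_mult_iff)
  then obtain k where "n = int k"
    using zero_le_imp_eq_int[of n] by auto
  with n show "t \<in> ?R"
    by (auto simp: add.commute)
next
  fix t assume "t \<in> ?R"
  then obtain k :: nat where "0 \<le> t" "t = real k * T + e * \<tau>" by auto
  then show "t \<in> ?L"
    by (auto intro!: exI[of _ "int k"])
qed

text \<open>A trajectory from \<open>(\<sigma>, y)\<close> to \<open>(0, 0)\<close> of the autonomized system ends at a time \<open>n T\<close>; shifting it by
  \<open>-n T\<close> gives a trajectory of the control system that ends in \<open>0\<close> at time \<open>0\<close>.\<close>

lemma reach_zero_shift:
  "(\<exists>u\<in>\<U>. phi A B (real n * T) \<sigma> y u = 0) \<longleftrightarrow> y \<in> R (\<sigma> - real n * T)"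
proof -
  have "(\<exists>u\<in>\<U>. phi A B (real n * T) \<sigma> y u = 0) \<longleftrightarrow> (\<exists>u\<in>\<U>. phi A B 0 (\<sigma> - real n * T) y u = 0)"
  proof safe
    fix u assume u: "u \<in> \<U>" "phi A B (real n * T) \<sigma> y u = 0"
    then show "\<exists>u\<in>\<U>. phi A B 0 (\<sigma> - real n * T) y u = 0"
      using phi_shift[OF admissible_Linf[OF u(1)], of 0 "\<sigma> - real n * T" y "int n"]
      by (intro bexI[OF _ admissible_shift[OF u(1), of "of_int (int n) * T"]]) simp
  next
    fix u assume u: "u \<in> \<U>" "phi A B 0 (\<sigma> - real n * T) y u = 0"
    then show "\<exists>u\<in>\<U>. phi A B (real n * T) \<sigma> y u = 0"
      using phi_shift[OF admissible_Linf[OF u(1)], of "real n * T" \<sigma> y "- int n"]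
      by (intro bexI[OF _ admissible_shift[OF u(1), of "of_int (- int n) * T"]]) simp
  qed
  also have "\<dots> \<longleftrightarrow> y \<in> R (\<sigma> - real n * T)"
    by (auto simp: control_at_eq[symmetric] control_at_def)
  finally show ?thesis .
qed

end

theorem theorem4p3:
  fixes T :: real
    and A :: "real \<Rightarrow> real^'d^'d"
    and B :: "real \<Rightarrow> real^'m^'d"
    and U :: "(real^'m) set"
  assumes "T > 0"
    and "A \<in> Linf UNIV" and "ae_periodic T A"
    and "B \<in> Linf UNIV" and "ae_periodic T B"
    and "bounded U" and "convex U" and "0 \<in> interior U"
    and "controllable A B"
  shows "({0..<T} \<times> {0} \<subseteq> phase_space T interior_of reach_aut A B U T (0, 0) \<and>
          (\<lambda>\<tau>. fundamental_solution A (real CARD('d) * T + \<tau>) \<tau>) \<cdot>\<^sub>f bundle_over T (K_minus A B U T)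
              \<oplus>\<^sub>f bundle_over T (E_plus_zero A T)
            \<subseteq> phase_space T interior_of reach_aut A B U T (0, 0) \<and>
          phase_space T interior_of reach_aut A B U T (0, 0)
            \<subseteq> bundle_over T (K_minus A B U T) \<oplus>\<^sub>f bundle_over T (E_plus_zero A T) \<and>
          (\<forall>\<tau>\<in>{0..<T}. convex (K_minus A B U T \<tau>)) \<and>
          (\<exists>C. \<forall>\<tau>\<in>{0..<T}. \<forall>x\<in>K_minus A B U T \<tau>. norm x \<le> C))
       \<and> ({0..<T} \<times> {0} \<subseteq> phase_space T interior_of control_aut A B U T (0, 0) \<and>
          bundle_over T (E_minus_zero A T) \<oplus>\<^sub>f
              ((\<lambda>\<tau>. fundamental_solution A (- real CARD('d) * T + \<tau>) \<tau>) \<cdot>\<^sub>f bundle_over T (K_plus A B U T))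
            \<subseteq> phase_space T interior_of control_aut A B U T (0, 0) \<and>
          phase_space T interior_of control_aut A B U T (0, 0)
            \<subseteq> bundle_over T (E_minus_zero A T) \<oplus>\<^sub>f bundle_over T (K_plus A B U T) \<and>
          (\<forall>\<tau>\<in>{0..<T}. convex (K_plus A B U T \<tau>)) \<and>
          (\<exists>C. \<forall>\<tau>\<in>{0..<T}. \<forall>x\<in>K_plus A B U T \<tau>. norm x \<le> C))"
    (is "?reach \<and> ?control")
proof
  interpret periodic_system A B T U
    using assms by unfold_locales
  have n: "CARD('d) > 0" by simp
  show ?reach
  proof -
    interpret fwd: periodic_reach T X R
      using periodic_reach_direction[of 1] zero_interior_R[OF assms(9)] by simp
    have F: "reach_NT A B U T \<tau> 0 0 = fwd.F (1 * \<tau>)" if "\<tau> \<in> {0..<T}" for \<tau>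
      unfolding reach_NT_def fwd.F_def reach_at_eq nonneg_times_eq[OF disjI1[OF refl] that] by simp
    have K: "K_minus A B U T \<tau> = interior (fwd.F (1 * \<tau>)) \<inter> fwd.stable (1 * \<tau>)" if "\<tau> \<in> {0..<T}" for \<tau>
      by (simp only: K_minus_def F[OF that] fwd.stable_def E_minus_def mult_1)
    have E: "E_plus_zero A T \<tau> = fwd.unstable (1 * \<tau>)" for \<tau>
      by (simp add: E_sums fwd.unstable_def)
    have P: "reach_aut A B U T (0, 0) = (SIGMA \<tau>:{0..<T}. fwd.F (1 * \<tau>))"
    proof (intro equalityI subsetI)
      fix p assume "p \<in> reach_aut A B U T (0, 0)"
      then obtain t u where t: "t \<ge> 0" "u \<in> \<U>" "p = (t rmod T, phi A B t 0 0 u)"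
        by (auto simp: reach_aut_def phi_aut_def)
      obtain n :: int where n: "t = t rmod T + of_int n * T"
        using rmod_decompose[OF T_pos] by blast
      have "phi A B t 0 0 u \<in> fwd.F (t rmod T)"
        by (rule fwd.FI[OF _ t(1) n]) (simp add: R_def t(2))
      then show "p \<in> (SIGMA \<tau>:{0..<T}. fwd.F (1 * \<tau>))"
        using T_pos by (simp add: t(3) rmod_nonneg rmod_less)
    next
      fix p assume "p \<in> (SIGMA \<tau>:{0..<T}. fwd.F (1 * \<tau>))"
      then obtain \<tau> x where p: "p = (\<tau>, x)" "\<tau> \<in> {0..<T}" "x \<in> fwd.F \<tau>" by auto
      obtain n :: int where n: "0 \<le> \<tau> + of_int n * T" "x \<in> R (\<tau> + of_int n * T)"
        using fwd.FE[OF p(3)] .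
      then obtain u where u: "u \<in> \<U>" "x = phi A B (\<tau> + of_int n * T) 0 0 u"
        by (auto simp: R_def)
      have "(\<tau> + of_int n * T) rmod T = \<tau>"
        by (rule rmod_eqI[OF T_pos p(2) refl])
      then have "p = phi_aut A B T (\<tau> + of_int n * T) (0, 0) u"
        by (simp add: phi_aut_def p(1) u(2))
      then show "p \<in> reach_aut A B U T (0, 0)"
        unfolding reach_aut_def using n(1) u(1) by blast
    qed
    note incl = fwd.bundle_inclusions[OF disjI1[OF refl] P n _ K E,
        where Y="\<lambda>\<tau>. X (real CARD('d) * T + \<tau>) \<tau>", unfolded mult_1, OF refl]
    show ?thesis
      by (intro conjI incl)
  qed
  show ?control
  proof -
    interpret bwd: periodic_reach T "\<lambda>t s. X (- t) (- s)" "\<lambda>t. R (- t)"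
      using periodic_reach_direction[of "-1"] zero_interior_R_backward[OF assms(9)] by simp
    have F: "control_NT A B U T \<tau> 0 0 = bwd.F (-1 * \<tau>)" if "\<tau> \<in> {0..<T}" for \<tau>
      unfolding control_NT_def bwd.F_def control_at_eq nonneg_times_eq[OF disjI2[OF refl] that]
      by (simp add: algebra_simps)
    have spec: "X (- (T + - 1 * \<tau>)) (- (- 1 * \<tau>)) = X (\<tau> - T) \<tau>" for \<tau>
      by simp
    have K: "K_plus A B U T \<tau> = interior (bwd.F (-1 * \<tau>)) \<inter> bwd.stable (-1 * \<tau>)" if "\<tau> \<in> {0..<T}" for \<tau>
      unfolding K_plus_def F[OF that] bwd.stable_def spec spectral_space_backward ..
    have E: "E_minus_zero A T \<tau> = bwd.unstable (-1 * \<tau>)" for \<tau>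
      unfolding bwd.unstable_def spec spectral_space_backward ..
    have P: "control_aut A B U T (0, 0) = (SIGMA \<tau>:{0..<T}. bwd.F (-1 * \<tau>))"
    proof (intro equalityI subsetI)
      fix p assume "p \<in> control_aut A B U T (0, 0)"
      then obtain \<sigma> y t u where p: "p = (\<sigma>, y)" "\<sigma> \<in> {0..<T}" "t \<ge> 0" "u \<in> \<U>"
        "(\<sigma> + t) rmod T = 0" "phi A B (\<sigma> + t) \<sigma> y u = 0"
        by (auto simp: control_aut_def phi_aut_def)
      obtain n :: int where n: "\<sigma> + t = of_int n * T"
        using rmod_decompose[OF T_pos, of "\<sigma> + t"] p(5) by auto
      then have "0 \<le> of_int n * T" using p(2,3) by auto
      then have "0 \<le> n" using T_pos by (simp add: zero_le_mult_iff)
      then obtain k where "n = int k" using zero_le_imp_eq_int by blast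
      then have k: "\<sigma> + t = real k * T" using n by simp
      have "y \<in> R (\<sigma> - real k * T)"
        using p(4,6) reach_zero_shift unfolding k by blast
      also have "\<sigma> - real k * T = - t"
        using k by simp
      finally have "y \<in> bwd.F (-1 * \<sigma>)"
        by (rule bwd.FI[where n="int k"]) (use p(3) k in auto)
      then show "p \<in> (SIGMA \<tau>:{0..<T}. bwd.F (-1 * \<tau>))"
        using p(1,2) by simp
    next
      fix p assume "p \<in> (SIGMA \<tau>:{0..<T}. bwd.F (-1 * \<tau>))"
      then obtain \<sigma> y where p: "p = (\<sigma>, y)" "\<sigma> \<in> {0..<T}" "y \<in> bwd.F (-1 * \<sigma>)" by auto
      from p(3)[unfolded bwd.F_def nonneg_times_eq[OF disjI2[OF refl] p(2)]]
      obtain k :: nat where k: "0 \<le> real k * T + -1 * \<sigma>" "y \<in> R (- (real k * T + -1 * \<sigma>))"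
        by blast
      then have "y \<in> R (\<sigma> - real k * T)" by simp
      then obtain u where u: "u \<in> \<U>" "phi A B (real k * T) \<sigma> y u = 0"
        using reach_zero_shift by blast
      have "(real k * T) rmod T = 0"
        by simp
      then have "phi_aut A B T (real k * T - \<sigma>) p u = (0, 0)"
        using u(2) by (simp add: phi_aut_def p(1))
      then show "p \<in> control_aut A B U T (0, 0)"
        unfolding control_aut_def using k(1) u(1) p(1,2) by (auto intro!: exI[of _ "real k * T - \<sigma>"])
    qed
    \<comment> \<open>The time dT - \<tau> of the reversed system is the original time \<tau> -
      dT.\<close>
    have Y: "X (- real CARD('d) * T + \<tau>) \<tau> = X (- (real CARD('d) * T + -1 * \<tau>)) (- (-1 * \<tau>))" for \<tau>
      by simp
    note incl = bwd.bundle_inclusions[OF disjI2[OF refl] P n Y K E]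
    show ?thesis
      \<comment> \<open>\<open>bundle_inclusions\<close> puts the transported summand first, the
        controllable half of the theorem puts it last.\<close>
      unfolding fibre_sum_commute[of "bundle_over T (E_minus_zero A T)"]
      by (intro conjI incl)
  qed
qed

end
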